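(* For integers $k,t\ge 1$, $b_k(t)=\Theta_k(t)$.
   Context: All matroids are finite. A line of a matroid $M$ is a flat of rank $2$, and a hyperplane of $M$ is a flat of rank $r(M)-1$. Two sets $X,Y$ are skew in $M$ if $r_M(X\cup Y)=r_M(X)+r_M(Y)$. A 2-colouring of a simple matroid $M$ is a partition $(R,B)$ of $E(M)$ into a set $R$ of red elements and a set $B$ of blue elements. For integers $k,t\ge 1$, $b_k(t)$ is the largest number $n$ for which there exists a simple rank-$(k+1)$ real-representable matroid $M$ having a 2-colouring $(R,B)$ with $|R|=t$ and $|B|=n$ such that: (C1) $r_M(B)\ge 2$; (C2) $H\cap R\ne\emptyset$ for every hyperplane $H$ of $M$; (C3) for every line $L$ of $M|B$ there is a rank-$(k-1)$ flat $F$ of $M$ skew to $L$ with $F\cap R=\emptyset$. If for given $k,t$ no such $n$ exists, then $b_k(t)=0$. (That $b_k(t)$ is well-defined, i.e. that such $n$ are bounded, is part of what is asserted. For $k=1$ each point is a hyperplane, so (C2) gives $b_1(t)=0$ for all $t$.) $\Theta_k$ is the usual asymptotic notation in $t$, with implied constants allowed to depend on $k$.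
   Formalization: For k=1 the claim b_1(t)=Θ(t) is false, since b_1(t)=0 for all t; the formal theorem asserts b_k(t)=Θ_k(t) (as t tends to infinity) for k≥2, and for k=1 asserts instead that b_1(t)=0 for all t≥1, with well-definedness for all k,t≥1. *)

theory Defs
  imports Complex_Main "HOL-Library.Landau_Symbols"
begin

locale matroid =
  fixes E :: "'a set" and indep :: "'a set \<Rightarrow> bool"
  assumes finite_ground: "finite E"
    and indep_ground: "indep I \<Longrightarrow> I \<subseteq> E"
    and indep_empty: "indep {}"
    and indep_subset: "indep J \<Longrightarrow> I \<subseteq> J \<Longrightarrow> indep I"
    and indep_augment: "indep I \<Longrightarrow> indep J \<Longrightarrow> card I < card J \<Longrightarrow>
          \<exists>x\<in>J - I. indep (insert x I)"
begin

definition rank :: "'a set \<Rightarrow> nat" where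
  "rank X = Max (card ` {I. I \<subseteq> X \<and> indep I})"

definition simple :: bool where
  "simple \<longleftrightarrow> (\<forall>x\<in>E. \<forall>y\<in>E. indep {x, y})"

definition flat :: "'a set \<Rightarrow> bool" where
  "flat F \<longleftrightarrow> F \<subseteq> E \<and> (\<forall>x\<in>E - F. rank F < rank (insert x F))"

definition line :: "'a set \<Rightarrow> bool" where
  "line L \<longleftrightarrow> flat L \<and> rank L = 2"

definition hyperplane :: "'a set \<Rightarrow> bool" where
  "hyperplane H \<longleftrightarrow> flat H \<and> rank H + 1 = rank E"

definition skew :: "'a set \<Rightarrow> 'a set \<Rightarrow> bool" where
  "skew X Y \<longleftrightarrow> rank (X \<union> Y) = rank X + rank Y"

text \<open>
  \<open>v\<close> is a real matrix with \<open>d\<close> rows and with columns indexed by \<open>E\<close>: the column of \<open>x\<close>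
  is \<open>(v x 0, \<dots>, v x (d - 1))\<close>. The independent sets must be exactly the sets of
  linearly independent columns, where the columns are regarded as an indexed family (so
  that two elements with equal columns are dependent).
\<close>
definition real_representable :: bool where
  "real_representable \<longleftrightarrow>
     (\<exists>(d :: nat) (v :: 'a \<Rightarrow> nat \<Rightarrow> real). \<forall>X\<subseteq>E.
        indep X \<longleftrightarrow>
          (\<forall>c :: 'a \<Rightarrow> real. (\<forall>i<d. (\<Sum>x\<in>X. c x * v x i) = 0) \<longrightarrow> (\<forall>x\<in>X. c x = 0)))"

definition restrict_indep :: "'a set \<Rightarrow> 'a set \<Rightarrow> bool" where
  "restrict_indep X I \<longleftrightarrow> I \<subseteq> X \<and> indep I"

lemma matroid_restrict: "X \<subseteq> E \<Longrightarrow> matroid X (restrict_indep X)"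
proof
  assume "X \<subseteq> E"
  then show "finite X"
    using finite_ground finite_subset by blast
next
  fix I J
  assume "restrict_indep X I" "restrict_indep X J" "card I < card J"
  then show "\<exists>x\<in>J - I. restrict_indep X (insert x I)"
    using indep_augment[of I J] unfolding restrict_indep_def by blast
qed (auto simp: restrict_indep_def indep_empty intro: indep_subset)

definition two_colouring :: "'a set \<Rightarrow> 'a set \<Rightarrow> bool" where
  "two_colouring R B \<longleftrightarrow> R \<union> B = E \<and> R \<inter> B = {}"

text \<open>The lines of the restriction \<open>M|B\<close> are \<open>matroid.line B (restrict_indep B)\<close>.\<close>
definition admissible_colouring :: "nat \<Rightarrow> 'a set \<Rightarrow> 'a set \<Rightarrow> bool" where
  "admissible_colouring k R B \<longleftrightarrow>
     two_colouring R B \<and>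
     rank B \<ge> 2 \<and>
     (\<forall>H. hyperplane H \<longrightarrow> H \<inter> R \<noteq> {}) \<and>
     (\<forall>L. matroid.line B (restrict_indep B) L \<longrightarrow>
        (\<exists>F. flat F \<and> rank F = k - 1 \<and> skew F L \<and> F \<inter> R = {}))"

end

text \<open>
  Every finite matroid is isomorphic to one whose ground set consists of natural numbers, so
  restricting the ground sets to this type loses nothing.
\<close>
definition blue_counts :: "nat \<Rightarrow> nat \<Rightarrow> nat set" where
  "blue_counts k t =
     {n. \<exists>(E :: nat set) indep R B.
        matroid E indep \<and>
        matroid.simple E indep \<and>
        matroid.real_representable E indep \<and>
        matroid.rank indep E = k + 1 \<and>
        matroid.admissible_colouring E indep k R B \<and>
        card R = t \<and> card B = n}"

text \<open>\<open>Max\<close> of an infinite set is unspecified; this value of \<open>max_blue k t\<close> is meaningful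
  only when \<open>blue_counts k t\<close> is finite.\<close>
definition max_blue :: "nat \<Rightarrow> nat \<Rightarrow> nat" where
  "max_blue k t = (if blue_counts k t = {} then 0 else Max (blue_counts k t))"

end

theory Submission
  imports Defs "HOL-Analysis.Finite_Function_Topology"
begin

text \<open>
  Upper bound. The key is a weak form of Dirac's theorem: among \<open>n\<close> points of a real projective
  space, either a constant fraction lies on a line, or some point lies on at least a constant times
  \<open>n\<close> connecting lines. Given this, a set of \<open>n\<close> points spanning rank \<open>j \<ge> 3\<close>, all of whose
  hyperplanes are met by \<open>t\<close> red points, satisfies \<open>n = O(t)\<close> or has a constant fraction of its points
  in a proper flat: discard the points that are also red, project from a point on many connecting
  lines, and induct on the rank. Iterating, a constant fraction of the blue points lies in a flat
  \<open>A\<close> for which only the first alternative is possible. Condition (C3) for a blue line inside \<open>A\<close>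
  supplies a red-free complement of \<open>A\<close>; projecting the red points along it onto \<open>A\<close> gives at most
  \<open>t\<close> points meeting all hyperplanes of \<open>A\<close>, so the number of blue points is \<open>O(t)\<close>.

  For the weak Dirac theorem, project generically to the plane and join two points of a line \<open>l\<close> if
  fewer than \<open>\<delta> |l|\<close> points of \<open>l\<close> lie between them. If the theorem failed, this would give a drawing
  with at least \<open>\<delta> n\<^sup>2 / 4\<close> segments but only \<open>O(\<delta>\<^sup>4 n\<^sup>4)\<close> crossings of non-collinear segments,
  contradicting the crossing lemma when \<open>\<delta>\<close> is small.

  Lower bound. Take \<open>t - k + 1\<close> blue points on a line and \<open>k - 1\<close> further blue points in general
  position, together with one red point for each of the \<open>t\<close> hyperplanes that the blue points span.
\<close>

section \<open>Plane drawings with straight segments\<close>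

text \<open>The weak Dirac theorem fails over finite fields: in a projective plane of order q every
  point is on only q + 1 lines and every line has only q + 1 points, about the square root of the
  number of all points. So the order of the reals must enter, and it does so through planarity.
  Joining points at distance below \<delta> |l| gives order \<delta> n^2 edges, for which the
  crossing lemma forces order \<delta>^3 n^4 crossings. But only O(\<delta>^2 |l|^2) edges of a line
  l pass over a given place, so pairs of lines leave room for only O(\<delta>^4 n^4); a small fixed
  \<delta> is contradictory. Edges on a common line overlap heavily. The crossing lemma is therefore
  needed in a form where such overlaps are not crossings; the price is a term for collinear triples,
  small because no line is rich. In the matroid part the red points need not lie in the flat
  \<open>A\<close>, and a projection onto \<open>A\<close> could send a red point to zero, losing
  the information it carries. The red-free flat from (C3) excludes exactly this.\<close>

type_synonym point = "real \<times> real"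
type_synonym segment = "point \<times> point"

abbreviation lo :: "segment \<Rightarrow> real" where "lo e \<equiv> fst (fst e)"
abbreviation hi :: "segment \<Rightarrow> real" where "hi e \<equiv> fst (snd e)"

definition slope :: "segment \<Rightarrow> real" where
  "slope e = (snd (snd e) - snd (fst e)) / (hi e - lo e)"

definition height :: "segment \<Rightarrow> real \<Rightarrow> real" where
  "height e x = snd (fst e) + slope e * (x - lo e)"

text \<open>The last conjunct exempts a common end, so segments sharing a vertex need not clash,
  while a vertex inside another segment or a collinear overlap does. Comparing heights over one
  abscissa is enough because the point sets used have distinct abscissae, so no segment is
  vertical.\<close>

definition clash :: "segment \<Rightarrow> segment \<Rightarrow> bool" where
  "clash e f \<longleftrightarrow> (\<exists>x. lo e \<le> x \<and> x \<le> hi e \<and> lo f \<le> x \<and> x \<le> hi f \<and>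
     height e x = height f x \<and> \<not> (x \<in> {lo e, hi e} \<and> x \<in> {lo f, hi f}))"

lemma clash_sym: "clash e f \<longleftrightarrow> clash f e"
  unfolding clash_def by metis

lemma height_lo: "height e (lo e) = snd (fst e)"
  by (simp add: height_def)

lemma height_hi: "lo e \<noteq> hi e \<Longrightarrow> height e (hi e) = snd (snd e)"
  by (simp add: height_def slope_def)

lemma height_shift: "height e x = height e y + slope e * (x - y)"
  by (simp add: height_def algebra_simps)

lemma height_eqI:
  assumes "height e x = height f x" "height e y = height f y" "x \<noteq> y"
  shows "height e = height f"
proof -
  have "slope e * (x - y) = slope f * (x - y)"
    using assms(1,2) height_shift[of e x y] height_shift[of f x y] by simp
  then have "slope e = slope f"
    using assms(3) by simp
  then show ?thesis
    using assms(1) height_shift[of e _ x] height_shift[of f _ x] by (metis ext)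
qed

text \<open>If the order were reversed, the two affine functions would agree strictly between
  \<open>x\<close> and \<open>y\<close>, at an inner point of both segments. The conclusion is weak
  because the segments may meet at \<open>y\<close>.\<close>

lemma height_order_preserved:
  assumes "\<not> clash e f" "lo e \<le> x" "lo f \<le> x" "x < y" "y \<le> hi e" "y \<le> hi f"
    and "height e x < height f x"
  shows "height e y \<le> height f y"
proof (rule ccontr)
  assume "\<not> ?thesis"
  then have y: "height f y < height e y" by simp
  define d where "d = slope e - slope f"
  define g where "g = height f x - height e x"
  have g: "g > 0" using assms(7) by (simp add: g_def)
  have "height e y - height f y = d * (y - x) - g"
    by (simp add: height_shift[of e y x] height_shift[of f y x] d_def g_def algebra_simps)
  then have dg: "d * (y - x) > g" using y by simp
  then have "d * (y - x) > 0" using g by linarith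
  then have d: "d > 0" using assms(4) by (simp add: zero_less_mult_iff)
  define z where "z = x + g / d"
  have z: "x < z" "z < y"
    using g d dg by (auto simp: z_def field_simps)
  have "height e z - height f z = d * (z - x) - g"
    by (simp add: height_shift[of e z x] height_shift[of f z x] d_def g_def algebra_simps)
  then have "height e z = height f z"
    using d by (simp add: z_def)
  then have "clash e f"
    unfolding clash_def using z assms(2-6) by (intro exI[of _ z]) auto
  then show False using assms(1) by simp
qed

text \<open>The left end of the shorter segment is an inner point of the longer one. Hence, without
  clashes, the segments ending at a vertex are strictly ordered by slope.\<close>

lemma clash_common_right_end:
  assumes "e \<noteq> f" "snd e = snd f" "slope e = slope f" "lo e < hi e" "lo f < hi f"
  shows "clash e f"
proof -
  have *: "clash e f" if "e \<noteq> f" "snd e = snd f" "slope e = slope f" "lo e < hi e" "lo f < hi f"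
      "lo e \<le> lo f" for e f
  proof -
    have h: "height e x = height f x" for x
      using height_shift[of e x "hi e"] height_shift[of f x "hi f"] that
        height_hi[of e] height_hi[of f] by simp
    have "lo e \<noteq> lo f"
    proof
      assume "lo e = lo f"
      then have "fst e = fst f"
        using h[of "lo e"] height_lo[of e] height_lo[of f] by (simp add: prod_eq_iff)
      then show False using that(1,2) by (simp add: prod_eq_iff)
    qed
    then show ?thesis
      unfolding clash_def using that h by (intro exI[of _ "lo f"]) auto
  qed
  show ?thesis
    using *[of e f] *[of f e] assms clash_sym[of e f] by (metis linear)
qed

lemma clash_common_left_end:
  assumes "e \<noteq> f" "fst e = fst f" "slope e = slope f" "lo e < hi e" "lo f < hi f"
  shows "clash e f"
proof -
  have *: "clash e f" if "e \<noteq> f" "fst e = fst f" "slope e = slope f" "lo e < hi e" "lo f < hi f"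
      "hi e \<le> hi f" for e f
  proof -
    have h: "height e x = height f x" for x
      using that by (simp add: height_def)
    have "hi e \<noteq> hi f"
    proof
      assume "hi e = hi f"
      then have "snd e = snd f"
        using h[of "hi e"] height_hi[of e] height_hi[of f] that by (simp add: prod_eq_iff)
      then show False using that(1,2) by (simp add: prod_eq_iff)
    qed
    then show ?thesis
      unfolding clash_def using that h by (intro exI[of _ "hi e"]) auto
  qed
  show ?thesis
    using *[of e f] *[of f e] assms clash_sym[of e f] by (metis linear)
qed

section \<open>Plane drawings have linearly many segments\<close>

lemma two_le_cardE:
  assumes "2 \<le> card S"
  obtains x y where "x \<in> S" "y \<in> S" "x \<noteq> y"
proof -
  obtain U where "U \<subseteq> S" "card U = 2" using obtain_subset_with_card_n[OF assms] by blast
  then show thesis using that unfolding card_2_iff by blast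
qed

lemma finite_max_on:
  fixes f :: "'a \<Rightarrow> real"
  assumes "finite S" "S \<noteq> {}"
  shows "\<exists>x\<in>S. \<forall>y\<in>S. f y \<le> f x"
proof -
  have "Max (f ` S) \<in> f ` S" using assms by simp
  then obtain x where "x \<in> S" "f x = Max (f ` S)" by auto
  then show ?thesis using assms by (metis Max_ge finite_imageI imageI)
qed

text \<open>
  A sweep from left to right replaces Euler's formula. Apart from one segment per vertex, every
  segment \<open>e\<close> has a next segment \<open>nx e\<close> above it with the same right endpoint. Charge \<open>e\<close> to the last
  vertex \<open>apex e\<close> in the region between the two: to the right of it the region is empty, so each vertex
  is charged at most twice, once from strictly above \<open>e\<close> and once from \<open>e\<close> itself.
\<close>

lemma noncrossing_card_le:
  fixes P :: "point set" and E :: "segment set"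
  assumes P: "finite P" "inj_on fst P" and E: "E \<subseteq> P \<times> P"
    and left: "\<And>e. e \<in> E \<Longrightarrow> lo e < hi e"
    and nc: "\<And>e f. e \<in> E \<Longrightarrow> f \<in> E \<Longrightarrow> e \<noteq> f \<Longrightarrow> \<not> clash e f"
  shows "card E \<le> 3 * card P"
proof -
  have finE: "finite E" using E P(1) finite_subset by blast
  have inP: "fst e \<in> P" "snd e \<in> P" if "e \<in> E" for e
    using that E by auto
  \<comment> \<open>To the left of a common right end a smaller slope means a higher segment, so
    these are the topmost segments at each right end. Every other segment has a successor with the
    next smaller slope.\<close>
  define tops where "tops = {e \<in> E. \<forall>g\<in>E. snd g = snd e \<longrightarrow> slope e \<le> slope g}"
  have "inj_on snd tops"
  proof (rule inj_onI)
    fix e f assume ef: "e \<in> tops" "f \<in> tops" "snd e = snd f"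
    then have "slope e = slope f" by (force simp: tops_def intro: antisym)
    then show "e = f"
      using clash_common_right_end[of e f] ef nc[of e f] left[of e] left[of f] by (auto simp: tops_def)
  qed
  then have card_tops: "card tops \<le> card P"
    using inP P(1) by (intro card_inj_on_le[of snd]) (auto simp: tops_def)
  have "\<exists>f\<in>E. snd f = snd e \<and> slope f < slope e \<and>
      (\<forall>g\<in>E. snd g = snd e \<longrightarrow> slope g < slope e \<longrightarrow> slope g \<le> slope f)" if "e \<in> E - tops" for e
  proof -
    let ?S = "{g \<in> E. snd g = snd e \<and> slope g < slope e}"
    have "?S \<noteq> {}" using that by (force simp: tops_def)
    moreover have "finite ?S" using finE by simp
    ultimately have "\<exists>f\<in>?S. \<forall>g\<in>?S. slope g \<le> slope f"
      by (rule finite_max_on[rotated])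
    then show ?thesis by blast
  qed
  then obtain nx where nx: "\<And>e. e \<in> E - tops \<Longrightarrow> nx e \<in> E \<and> snd (nx e) = snd e \<and> slope (nx e) < slope e \<and>
      (\<forall>g\<in>E. snd g = snd e \<longrightarrow> slope g < slope e \<longrightarrow> slope g \<le> slope (nx e))"
    by metis
  \<comment> \<open>The wedge between \<open>e\<close> and \<open>nx e\<close>, as far left as both
    exist. With closed sides it contains the later of the two left ends, so it is nonempty and has a
    rightmost vertex.\<close>
  define region where "region e = {v \<in> P. fst v < hi e \<and> lo e \<le> fst v \<and> lo (nx e) \<le> fst v \<and>
      height e (fst v) \<le> snd v \<and> snd v \<le> height (nx e) (fst v)}" for e
  have below: "height e x < height (nx e) x" if "e \<in> E - tops" "x < hi e" for e x
  proof -
    have s: "slope (nx e) < slope e" and sn: "snd (nx e) = snd e" and i: "e \<in> E" "nx e \<in> E"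
      using nx[OF that(1)] that by auto
    have "height (nx e) (hi e) = height e (hi e)"
      using height_hi[of e] height_hi[of "nx e"] left[OF i(1)] left[OF i(2)] sn by simp
    moreover have "slope e * (x - hi e) < slope (nx e) * (x - hi e)"
      using s that(2) by (simp add: mult_strict_right_mono_neg)
    ultimately show ?thesis
      using height_shift[of e x "hi e"] height_shift[of "nx e" x "hi e"] by simp
  qed
  have "region e \<noteq> {}" if e: "e \<in> E - tops" for e
  proof (cases "lo (nx e) \<le> lo e")
    case True
    then have "fst e \<in> region e"
      using below[OF e, of "lo e"] left[of e] e inP[of e] height_lo[of e] by (auto simp: region_def)
    then show ?thesis by blast
  next
    case False
    have i: "nx e \<in> E" "snd (nx e) = snd e" using nx[OF e] by auto
    have "fst (nx e) \<in> region e"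
      using below[OF e, of "lo (nx e)"] left[of "nx e"] i inP[of "nx e"] height_lo[of "nx e"] False
      by (auto simp: region_def)
    then show ?thesis by blast
  qed
  moreover have "finite (region e)" for e using P(1) by (simp add: region_def)
  ultimately have "\<exists>v\<in>region e. \<forall>w\<in>region e. fst w \<le> fst v" if "e \<in> E - tops" for e
    using finite_max_on[of "region e" fst] that by blast
  then obtain apex where apex: "\<And>e. e \<in> E - tops \<Longrightarrow> apex e \<in> region e \<and> (\<forall>w\<in>region e. fst w \<le> fst (apex e))"
    by metis
  \<comment> \<open>A segment strictly between \<open>e\<close> and \<open>nx e\<close> at or beyond
    the apex has nowhere to end. Ending before the common right end puts a vertex into the region;
    ending there puts its slope strictly between two neighbouring slopes; going further takes it
    through the common right end, which is a clash.\<close>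
  have squeeze: False
    if e: "e \<in> E - tops" and e': "e' \<in> E"
      and x: "lo e \<le> x" "lo (nx e) \<le> x" "lo e' \<le> x" "x < hi e" "x < hi e'" "fst (apex e) \<le> x"
      and h: "height e x < height e' x" "height e' x < height (nx e) x" for e e' x
  proof -
    have f: "nx e \<in> E" "snd (nx e) = snd e" using nx[OF e] by auto
    have ne: "e \<noteq> e'" "e' \<noteq> nx e" using h by auto
    have c: "\<not> clash e e'" "\<not> clash e' (nx e)" using ne nc e e' f by auto
    have o: "height e y \<le> height e' y" "height e' y \<le> height (nx e) y"
      if "x < y" "y \<le> hi e" "y \<le> hi e'" for y
      using height_order_preserved[OF c(1), of x y] height_order_preserved[OF c(2), of x y] that x h f
      by auto
    have heq: "height (nx e) (hi e) = height e (hi e)"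
      using height_hi[of e] height_hi[of "nx e"] left[of e] left[OF f(1)] f e by simp
    have le': "lo e' < hi e'" using left e' by blast
    consider "hi e' < hi e" | "hi e' = hi e" | "hi e' > hi e" by linarith
    then show False
    proof cases
      case 1
      then have "snd e' \<in> region e"
        using o[of "hi e'"] x inP[OF e'] height_hi[of e'] le' by (auto simp: region_def)
      then show False using apex[OF e] x by force
    next
      case 2
      then have s: "snd e' = snd e"
        using inj_onD[OF P(2)] inP(2) e e' by blast
      have eq: "height e' (hi e) = height e (hi e)"
        using height_hi[of e] height_hi[of e'] left[of e] le' s e by simp
      have "slope e' * (x - hi e) > slope e * (x - hi e)"
        using h(1) height_shift[of e x "hi e"] height_shift[of e' x "hi e"] eq by simp
      then have s1: "slope e' < slope e" using x by (simp add: mult_less_cancel_right)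
      have "slope (nx e) * (x - hi e) > slope e' * (x - hi e)"
        using h(2) height_shift[of "nx e" x "hi e"] height_shift[of e' x "hi e"] eq heq by simp
      then have "slope (nx e) < slope e'" using x by (simp add: mult_less_cancel_right)
      then show False using nx[OF e] e' s s1 by force
    next
      case 3
      have "height e (hi e) = height e' (hi e)"
        using o[of "hi e"] 3 x heq by auto
      then have "clash e e'"
        unfolding clash_def using x 3 by (intro exI[of _ "hi e"]) auto
      then show False using c by simp
    qed
  qed
  define key where "key e = (apex e, height e (fst (apex e)) < snd (apex e))" for e
  have apexD: "apex e \<in> P" "fst (apex e) < hi e" "lo e \<le> fst (apex e)" "lo (nx e) \<le> fst (apex e)"
     "height e (fst (apex e)) \<le> snd (apex e)" "snd (apex e) \<le> height (nx e) (fst (apex e))"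
    if "e \<in> E - tops" for e
    using apex[OF that] by (auto simp: region_def)
  have above: False if e: "e \<in> E - tops" "e' \<in> E - tops" and k: "key e = key e'"
      and fl: "height e (fst (apex e)) < snd (apex e)"
      and h: "height e (fst (apex e)) < height e' (fst (apex e))" for e e'
    using squeeze[OF e(1), of e' "fst (apex e)"] apexD[OF e(1)] apexD[OF e(2)] k fl h e(2)
    by (auto simp: key_def)
  have same: False if e: "e \<in> E - tops" "e' \<in> E - tops" and k: "key e = key e'"
      and fl: "height e (fst (apex e)) = snd (apex e)"
      and lo: "lo e = fst (apex e)" "lo e' = fst (apex e)"
      and s: "slope e < slope e'" for e e'
  proof -
    let ?x = "fst (apex e)"
    have k': "apex e' = apex e" "height e' ?x = snd (apex e)"
      using k fl apexD(5)[OF e(2)] by (auto simp: key_def)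
    have b: "height e ?x < height (nx e) ?x" using below[OF e(1), of ?x] apexD[OF e(1)] by simp
    define g where "g = height (nx e) ?x - height e ?x"
    define c where "c = \<bar>slope e' - slope (nx e)\<bar>"
    have c: "c \<ge> 0" "slope e' - slope (nx e) \<le> c" by (auto simp: c_def)
    \<comment> \<open>A step to the right so short that both segments still exist and the steeper
      \<open>e'\<close> has not yet risen to \<open>nx e\<close>.\<close>
    define d where "d = min (min ((hi e - ?x) / 2) ((hi e' - ?x) / 2)) (g / (2 * (c + 1)))"
    have g: "g > 0" using b by (simp add: g_def)
    have d: "d > 0" using g c apexD(2)[OF e(1)] apexD(2)[OF e(2)] k' by (simp add: d_def)
    have "d \<le> (hi e - ?x) / 2" "d \<le> (hi e' - ?x) / 2"
      unfolding d_def by (meson min.cobounded1 min.cobounded2 order_trans)+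
    moreover have "?x < hi e" "?x < hi e'" using apexD(2)[OF e(1)] apexD(2)[OF e(2)] k' by auto
    ultimately have dh: "?x + d < hi e" "?x + d < hi e'" by (simp_all add: field_simps)
    have "d \<le> g / (2 * (c + 1))" unfolding d_def by (rule min.cobounded2)
    then have "d * (2 * (c + 1)) \<le> g"
      using c(1) by (subst (asm) pos_le_divide_eq) auto
    moreover have "(slope e' - slope (nx e)) * d \<le> c * d"
      using d c(2) by (intro mult_right_mono) auto
    moreover have "0 \<le> c * d" using d c by simp
    ultimately have dg: "(slope e' - slope (nx e)) * d < g" using d by (simp add: algebra_simps)
    show False
    proof (rule squeeze[OF e(1), of e' "?x + d"])
      show "height e (?x + d) < height e' (?x + d)"
        using height_shift[of e "?x + d" ?x] height_shift[of e' "?x + d" ?x] k' fl s d by simp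
      show "height e' (?x + d) < height (nx e) (?x + d)"
        using height_shift[of "nx e" "?x + d" ?x] height_shift[of e' "?x + d" ?x] k' fl dg g_def
        by (simp add: algebra_simps)
    qed (use e dh d lo apexD[OF e(1)] in auto)
  qed
  have "inj_on key (E - tops)"
  proof (rule inj_onI, rule ccontr)
    fix e e' assume e: "e \<in> E - tops" "e' \<in> E - tops" and k: "key e = key e'" and ne: "e \<noteq> e'"
    let ?x = "fst (apex e)"
    have k': "apex e' = apex e" using k by (simp add: key_def)
    have nce: "\<not> clash e e'" using nc e ne by auto
    note a = apexD[OF e(1)] apexD[OF e(2), unfolded k']
    show False
    proof (cases "height e ?x < snd (apex e)")
      case True
      have k2: "height e' (fst (apex e')) < snd (apex e')" using k True by (auto simp: key_def)
      have "height e ?x = height e' ?x"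
        using above[OF e k True] above[OF e(2,1) k[symmetric] k2] k' by force
      moreover have "lo e \<noteq> ?x"
      proof
        assume "lo e = ?x"
        then have "fst e = apex e" using inj_onD[OF P(2)] inP(1) e(1) a(1) by blast
        then show False using True height_lo[of e] by simp
      qed
      ultimately have "clash e e'"
        unfolding clash_def using a by (intro exI[of _ ?x]) auto
      then show False using nce by simp
    next
      case False
      then have f: "height e ?x = snd (apex e)" "height e' ?x = snd (apex e)"
        using a k by (auto simp: key_def)
      \<comment> \<open>Both segments pass through the apex; unless both start there, it is an inner
        point of one of them and hence a clash.\<close>
      have "lo e = ?x \<and> lo e' = ?x"
      proof (rule ccontr)
        assume "\<not> ?thesis"
        then have "clash e e'"
          unfolding clash_def using a f by (intro exI[of _ ?x]) auto
        then show False using nce by simp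
      qed
      then have l: "lo e = ?x" "lo e' = ?x" by auto
      have "fst e = apex e" "fst e' = apex e"
        using inj_onD[OF P(2)] inP(1) e a(1) l by blast+
      then have "slope e \<noteq> slope e'"
        using clash_common_left_end[OF ne] nce left[of e] left[of e'] e by auto
      then consider "slope e < slope e'" | "slope e' < slope e" by linarith
      then show False
        using same[OF e k f(1)] same[OF e(2,1) k[symmetric]] l f k' by cases auto
    qed
  qed
  moreover have "key ` (E - tops) \<subseteq> P \<times> UNIV"
    using apexD(1) by (auto simp: key_def)
  ultimately have "card (E - tops) \<le> card (P \<times> (UNIV :: bool set))"
    using P(1) by (intro card_inj_on_le[of key]) auto
  then have "card (E - tops) \<le> 2 * card P" by (simp add: card_cartesian_product)
  moreover have "card E = card tops + card (E - tops)"
    using finE by (metis (no_types, lifting) card_Diff_subset card_mono finite_subset le_add_diff_inverse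
        mem_Collect_eq subsetI tops_def)
  ultimately show ?thesis using card_tops by linarith
qed

section \<open>A crossing bound in which collinear overlaps are not crossings\<close>

definition line_pts :: "point set \<Rightarrow> point \<Rightarrow> point \<Rightarrow> point set" where
  "line_pts P a b = {c \<in> P. snd c = height (a, b) (fst c)}"

definition clash_pairs :: "segment set \<Rightarrow> (segment \<times> segment) set" where
  "clash_pairs E = {(e, f). e \<in> E \<and> f \<in> E \<and> clash e f \<and> height e \<noteq> height f}"

definition triples :: "point set \<Rightarrow> (point \<times> point \<times> point) set" where
  "triples P = {(a, b, c). a \<in> P \<and> b \<in> P \<and> a \<noteq> b \<and> c \<in> line_pts P a b - {a, b}}"

text \<open>Deleting one segment of a clashing pair lowers the number of clashing pairs by at least
  one; repeat until the drawing is plane.\<close>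

lemma card_le_clashes:
  fixes P :: "point set" and E :: "segment set"
  assumes "finite P" "inj_on fst P" "E \<subseteq> P \<times> P" "\<And>e. e \<in> E \<Longrightarrow> lo e < hi e"
  shows "card E \<le> 3 * card P + card {(e, f). e \<in> E \<and> f \<in> E \<and> e \<noteq> f \<and> clash e f}"
  using assms(3,4)
proof (induction "card E" arbitrary: E rule: less_induct)
  case less
  let ?C = "\<lambda>E. {(e, f). e \<in> E \<and> f \<in> E \<and> e \<noteq> f \<and> clash e f}"
  have finE: "finite E" using less.prems(1) assms(1) finite_subset by blast
  have finC: "finite (?C E)"
    by (rule finite_subset[of _ "E \<times> E"]) (use finE in auto)
  show ?case
  proof (cases "\<exists>e f. e \<in> E \<and> f \<in> E \<and> e \<noteq> f \<and> clash e f")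
    case False
    then have "card E \<le> 3 * card P"
      by (intro noncrossing_card_le[OF assms(1,2) less.prems]) blast+
    then show ?thesis by simp
  next
    case True
    then obtain e f where ef: "e \<in> E" "f \<in> E" "e \<noteq> f" "clash e f" by blast
    have c: "card E = Suc (card (E - {e}))"
      using finE ef(1) by (metis card.remove)
    have "card (E - {e}) \<le> 3 * card P + card (?C (E - {e}))"
      by (rule less.hyps) (use c less.prems in auto)
    moreover have "?C (E - {e}) \<subset> ?C E" using ef by blast
    then have "card (?C (E - {e})) < card (?C E)" by (rule psubset_card_mono[OF finC])
    ultimately show ?thesis using c by linarith
  qed
qed

text \<open>Segments whose line carries a third point of \<open>P\<close> are dropped at the cost of
  one triple each. Two distinct segments among the rest cannot share a line, so each of their
  clashes is counted in \<open>clash_pairs\<close>.\<close>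

lemma crossing_bound:
  fixes P :: "point set" and E :: "segment set"
  assumes P: "finite P" "inj_on fst P" and E: "E \<subseteq> P \<times> P" and left: "\<And>e. e \<in> E \<Longrightarrow> lo e < hi e"
  shows "card E \<le> 3 * card P + card (clash_pairs E) + card (triples P)"
proof -
  have finE: "finite E" using E P(1) finite_subset by blast
  define E1 where "E1 = {e \<in> E. line_pts P (fst e) (snd e) \<subseteq> {fst e, snd e}}"
  have fin: "finite (clash_pairs E)" "finite (triples P)"
    by (rule finite_subset[of _ "E \<times> E"]; use finE in \<open>auto simp: clash_pairs_def\<close>)
       (rule finite_subset[of _ "P \<times> P \<times> P"]; use P in \<open>auto simp: triples_def line_pts_def\<close>)
  have "\<forall>e\<in>E - E1. \<exists>c. c \<in> line_pts P (fst e) (snd e) - {fst e, snd e}"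
    unfolding E1_def by blast
  then obtain c where c: "\<And>e. e \<in> E - E1 \<Longrightarrow> c e \<in> line_pts P (fst e) (snd e) - {fst e, snd e}"
    by metis
  have ne: "fst e \<noteq> snd e" if "e \<in> E" for e using left[OF that] by auto
  have "inj_on (\<lambda>e. (fst e, snd e, c e)) (E - E1)" by (auto simp: inj_on_def)
  moreover have "(\<lambda>e. (fst e, snd e, c e)) ` (E - E1) \<subseteq> triples P"
  proof (rule image_subsetI)
    fix e assume "e \<in> E - E1"
    then show "(fst e, snd e, c e) \<in> triples P"
      using c[of e] E ne[of e] by (auto simp: triples_def)
  qed
  ultimately have "card (E - E1) \<le> card (triples P)"
    using fin(2) by (rule card_inj_on_le)
  moreover have "card E1 \<le> 3 * card P + card {(e, f). e \<in> E1 \<and> f \<in> E1 \<and> e \<noteq> f \<and> clash e f}"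
    using E left by (intro card_le_clashes[OF P]) (auto simp: E1_def)
  moreover have "card {(e, f). e \<in> E1 \<and> f \<in> E1 \<and> e \<noteq> f \<and> clash e f} \<le> card (clash_pairs E)"
  proof (rule card_mono[OF fin(1)], rule subsetI)
    fix z assume "z \<in> {(e, f). e \<in> E1 \<and> f \<in> E1 \<and> e \<noteq> f \<and> clash e f}"
    then obtain e f where z: "z = (e, f)" and e: "e \<in> E1" and f: "f \<in> E1" and "e \<noteq> f" "clash e f"
      by blast
    have ff: "fst f \<in> P" "snd f \<in> P" "lo f < hi f" "lo e < hi e"
      using f e E left by (auto simp: E1_def)
    have "height e \<noteq> height f"
    proof
      assume h: "height e = height f"
      have "fst f \<in> line_pts P (fst e) (snd e)" "snd f \<in> line_pts P (fst e) (snd e)"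
        using h height_lo[of f] height_hi[of f] ff by (auto simp: line_pts_def)
      then have "fst f \<in> {fst e, snd e}" "snd f \<in> {fst e, snd e}" using e by (auto simp: E1_def)
      then have "fst f = fst e \<and> snd f = snd e" using ff(3,4) by auto
      then show False using \<open>e \<noteq> f\<close> by (simp add: prod_eq_iff)
    qed
    then show "z \<in> clash_pairs E"
      unfolding z using \<open>clash e f\<close> e f by (auto simp: clash_pairs_def E1_def)
  qed
  moreover have "card E = card E1 + card (E - E1)"
    using finE by (subst card_Diff_subset) (auto simp: E1_def card_mono)
  ultimately show ?thesis by linarith
qed

section \<open>Amplification by random sampling\<close>

definition weight :: "real \<Rightarrow> 'a set \<Rightarrow> 'a set \<Rightarrow> real" where
  "weight p P S = p ^ card S * (1 - p) ^ card (P - S)"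

text \<open>\<open>weight p P S\<close> is the probability that keeping each point of
  \<open>P\<close> independently with probability \<open>p\<close> leaves exactly \<open>S\<close>.
  Expanding a product with factors \<open>p + 0\<close> on \<open>T\<close> and
  \<open>p + (1 - p)\<close> elsewhere keeps just the sets containing \<open>T\<close>.\<close>

lemma sum_weight_superset:
  assumes "finite P" "T \<subseteq> P"
  shows "(\<Sum>S\<in>Pow P. if T \<subseteq> S then weight p P S else 0) = p ^ card T"
proof -
  let ?g = "\<lambda>x. if x \<in> T then 0 else 1 - p"
  have "(\<Sum>S\<in>Pow P. if T \<subseteq> S then weight p P S else 0) = (\<Sum>S\<in>Pow P. (\<Prod>x\<in>S. p) * prod ?g (P - S))"
  proof (rule sum.cong)
    fix S assume S: "S \<in> Pow P"
    show "(if T \<subseteq> S then weight p P S else 0) = (\<Prod>x\<in>S. p) * prod ?g (P - S)"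
    proof (cases "T \<subseteq> S")
      case True
      then have "prod ?g (P - S) = (\<Prod>x\<in>P - S. 1 - p)" by (intro prod.cong) auto
      then show ?thesis using True by (simp add: weight_def)
    next
      case False
      then have "\<exists>x\<in>P - S. ?g x = 0" using assms(2) by auto
      then have "prod ?g (P - S) = 0" using assms(1) by (intro prod_zero) auto
      then show ?thesis using False by simp
    qed
  qed simp
  also have "\<dots> = (\<Prod>x\<in>P. p + ?g x)" using assms(1) by (rule prod_add[symmetric])
  also have "\<dots> = (\<Prod>x\<in>P. if x \<in> T then p else 1)" by (intro prod.cong) auto
  also have "\<dots> = p ^ card T"
    using assms by (simp add: prod.If_cases Int_absorb1)
  finally show ?thesis .
qed

text \<open>Linearity of expectation: \<open>x\<close> is counted when its whole support survives
  the sampling.\<close>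

lemma sum_weight_card:
  assumes "finite P" "finite X" "\<And>x. x \<in> X \<Longrightarrow> supp x \<subseteq> P"
  shows "(\<Sum>S\<in>Pow P. weight p P S * real (card {x \<in> X. supp x \<subseteq> S})) = (\<Sum>x\<in>X. p ^ card (supp x))"
proof -
  have "(\<Sum>S\<in>Pow P. weight p P S * real (card {x \<in> X. supp x \<subseteq> S}))
      = (\<Sum>S\<in>Pow P. \<Sum>x\<in>X. if supp x \<subseteq> S then weight p P S else 0)"
    using assms(2) by (intro sum.cong) (auto simp: sum.If_cases Int_def mult.commute)
  also have "\<dots> = (\<Sum>x\<in>X. \<Sum>S\<in>Pow P. if supp x \<subseteq> S then weight p P S else 0)"
    by (rule sum.swap)
  also have "\<dots> = (\<Sum>x\<in>X. p ^ card (supp x))"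
    using assms by (intro sum.cong) (auto simp: sum_weight_superset)
  finally show ?thesis .
qed

text \<open>A common end would have to lie over the only abscissa where the two different lines
  agree, and \<open>clash\<close> excludes a meeting at ends of both. The four distinct ends give
  crossings the factor \<open>p ^ 4\<close> below.\<close>

lemma clash_pairs_four_ends:
  assumes "(e, f) \<in> clash_pairs E" "\<And>e. e \<in> E \<Longrightarrow> lo e < hi e"
  shows "card {fst e, snd e, fst f, snd f} = 4"
proof -
  have ef: "lo e < hi e" "lo f < hi f" "clash e f" "height e \<noteq> height f"
    using assms by (auto simp: clash_pairs_def)
  obtain x where x: "lo e \<le> x" "x \<le> hi e" "lo f \<le> x" "x \<le> hi f" "height e x = height f x"
     "\<not> (x \<in> {lo e, hi e} \<and> x \<in> {lo f, hi f})"
    using ef(3) by (auto simp: clash_def)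
  have h: "height e (lo e) = snd (fst e)" "height e (hi e) = snd (snd e)"
    "height f (lo f) = snd (fst f)" "height f (hi f) = snd (snd f)"
    using height_lo height_hi[of e] height_hi[of f] ef by auto
  have xx: "y = x" if "height e y = height f y" for y
    using height_eqI[OF x(5) that] ef(4) by auto
  have "fst e \<noteq> fst f" "fst e \<noteq> snd f" "snd e \<noteq> fst f" "snd e \<noteq> snd f"
    using xx[of "lo e"] xx[of "hi e"] h x(6) by auto
  moreover have "fst e \<noteq> snd e" "fst f \<noteq> snd f" using ef by auto
  ultimately show ?thesis by simp
qed

text \<open>The expectation of \<open>crossing_bound\<close> over a random subset. The triples and
  clash pairs of a sample are exactly those supported in it, so vertices, segments, triples and
  crossings scale with the first four powers of \<open>p\<close>.\<close>

lemma sampled_crossing_bound: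
  fixes P :: "point set" and E :: "segment set"
  assumes P: "finite P" "inj_on fst P" and E: "E \<subseteq> P \<times> P" and left: "\<And>e. e \<in> E \<Longrightarrow> lo e < hi e"
    and p: "0 \<le> (p::real)" "p \<le> 1"
  shows "p^2 * card E \<le> 3 * p * card P + p^4 * card (clash_pairs E) + p^3 * card (triples P)"
proof -
  have finE: "finite E" using E P(1) finite_subset by blast
  have fin: "finite (clash_pairs E)" "finite (triples P)"
    by (rule finite_subset[of _ "E \<times> E"]; use finE in \<open>auto simp: clash_pairs_def\<close>)
       (rule finite_subset[of _ "P \<times> P \<times> P"]; use P in \<open>auto simp: triples_def line_pts_def\<close>)
  let ?sE = "\<lambda>e::segment. {fst e, snd e}"
  let ?sC = "\<lambda>c::segment \<times> segment. {fst (fst c), snd (fst c), fst (snd c), snd (snd c)}"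
  let ?sT = "\<lambda>t::point \<times> point \<times> point. {fst t, fst (snd t), snd (snd t)}"
  have wt: "0 \<le> weight p P S" for S using p by (simp add: weight_def)
  have each: "real (card {e \<in> E. ?sE e \<subseteq> S}) \<le> 3 * real (card {v \<in> P. {v} \<subseteq> S})
      + real (card {c \<in> clash_pairs E. ?sC c \<subseteq> S}) + real (card {t \<in> triples P. ?sT t \<subseteq> S})"
    if S: "S \<in> Pow P" for S
  proof -
    have "card {e \<in> E. ?sE e \<subseteq> S} \<le> 3 * card S + card (clash_pairs {e \<in> E. ?sE e \<subseteq> S}) + card (triples S)"
      using S P left by (intro crossing_bound) (auto intro: finite_subset inj_on_subset)
    moreover have "{v \<in> P. {v} \<subseteq> S} = S" using S by auto
    moreover have "clash_pairs {e \<in> E. ?sE e \<subseteq> S} = {c \<in> clash_pairs E. ?sC c \<subseteq> S}"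
      by (auto simp: clash_pairs_def)
    moreover have "triples S = {t \<in> triples P. ?sT t \<subseteq> S}"
      using S by (auto simp: triples_def line_pts_def)
    ultimately show ?thesis by (simp flip: of_nat_add)
  qed
  have lin: "(\<Sum>S\<in>A. w S * (3 * a S + b S + c S)) = 3 * (\<Sum>S\<in>A. w S * a S) + (\<Sum>S\<in>A. w S * b S) + (\<Sum>S\<in>A. w S * c S)"
    for w a b c :: "point set \<Rightarrow> real" and A
    by (simp add: sum.distrib sum_distrib_left algebra_simps)
  let ?w = "\<lambda>f. \<Sum>S\<in>Pow P. weight p P S * real (f S)"
  have v: "?w (\<lambda>S. card {v \<in> P. {v} \<subseteq> S}) = p * card P"
    using sum_weight_card[of P P "\<lambda>v. {v}" p] P by simp
  have "?w (\<lambda>S. card {c \<in> clash_pairs E. ?sC c \<subseteq> S}) = (\<Sum>c\<in>clash_pairs E. p ^ card (?sC c))"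
    by (rule sum_weight_card) (use P fin E in \<open>auto simp: clash_pairs_def\<close>)
  moreover have "card (?sC c) = 4" if "c \<in> clash_pairs E" for c
    using clash_pairs_four_ends[of "fst c" "snd c" E] that left by simp
  ultimately have c: "?w (\<lambda>S. card {c \<in> clash_pairs E. ?sC c \<subseteq> S}) = p ^ 4 * card (clash_pairs E)"
    by simp
  have "?w (\<lambda>S. card {t \<in> triples P. ?sT t \<subseteq> S}) = (\<Sum>t\<in>triples P. p ^ card (?sT t))"
    by (rule sum_weight_card) (use P fin in \<open>auto simp: triples_def line_pts_def\<close>)
  moreover have "card (?sT t) = 3" if "t \<in> triples P" for t
    using that by (auto simp: triples_def card_insert_if)
  ultimately have t: "?w (\<lambda>S. card {t \<in> triples P. ?sT t \<subseteq> S}) = p ^ 3 * card (triples P)"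
    by simp
  have "?w (\<lambda>S. card {e \<in> E. ?sE e \<subseteq> S}) = (\<Sum>e\<in>E. p ^ card (?sE e))"
    by (rule sum_weight_card) (use P finE E in auto)
  moreover have "card (?sE e) = 2" if "e \<in> E" for e
  proof -
    have "fst e \<noteq> snd e" using left[OF that] by auto
    then show ?thesis by simp
  qed
  ultimately have e: "?w (\<lambda>S. card {e \<in> E. ?sE e \<subseteq> S}) = p ^ 2 * card E"
    by simp
  have "?w (\<lambda>S. card {e \<in> E. ?sE e \<subseteq> S})
    \<le> (\<Sum>S\<in>Pow P. weight p P S * (3 * real (card {v \<in> P. {v} \<subseteq> S})
      + real (card {c \<in> clash_pairs E. ?sC c \<subseteq> S}) + real (card {t \<in> triples P. ?sT t \<subseteq> S})))"
    using each wt by (intro sum_mono mult_left_mono) blast+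
  also have "\<dots> = 3 * ?w (\<lambda>S. card {v \<in> P. {v} \<subseteq> S})
      + ?w (\<lambda>S. card {c \<in> clash_pairs E. ?sC c \<subseteq> S}) + ?w (\<lambda>S. card {t \<in> triples P. ?sT t \<subseteq> S})"
    by (rule lin)
  finally show ?thesis unfolding v c t e by simp
qed

section \<open>A weak Dirac theorem\<close>

lemma height_endpoints:
  assumes "fst a \<noteq> fst b"
  shows "height (a, b) (fst a) = snd a" "height (a, b) (fst b) = snd b"
  using height_lo[of "(a, b)"] height_hi[of "(a, b)"] assms by auto

lemma finite_line_pts: "finite P \<Longrightarrow> finite (line_pts P a b)"
  by (simp add: line_pts_def)

lemma line_pts_subset: "line_pts P a b \<subseteq> P"
  by (auto simp: line_pts_def)

lemma endpoints_in_line_pts: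
  assumes "inj_on fst P" "a \<in> P" "b \<in> P" "a \<noteq> b"
  shows "a \<in> line_pts P a b" "b \<in> line_pts P a b"
proof -
  have "fst a \<noteq> fst b" using assms by (meson inj_onD)
  then show "a \<in> line_pts P a b" "b \<in> line_pts P a b"
    using assms height_endpoints[of a b] by (simp_all add: line_pts_def)
qed

lemma line_pts_height_eq:
  assumes "inj_on fst P" "c \<in> line_pts P a b" "d \<in> line_pts P a b" "c \<noteq> d"
  shows "height (c, d) = height (a, b)"
proof -
  have "fst c \<noteq> fst d"
    using assms unfolding line_pts_def by (metis (no_types, lifting) inj_onD mem_Collect_eq)
  then show ?thesis
    using assms height_endpoints[of c d]
    by (intro height_eqI[of _ "fst c" _ "fst d"]) (auto simp: line_pts_def)
qed

lemma line_pts_eq: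
  assumes "inj_on fst P" "c \<in> line_pts P a b" "d \<in> line_pts P a b" "c \<noteq> d"
  shows "line_pts P c d = line_pts P a b"
  using line_pts_height_eq[OF assms] by (simp add: line_pts_def)

section \<open>Joining nearby points of a line yields many edges\<close>

lemma nearest_subset_exists:
  fixes f :: "'a \<Rightarrow> real"
  assumes "finite A" "D \<le> card A"
  shows "\<exists>U\<subseteq>A. card U = D \<and> (\<forall>u\<in>U. \<forall>c\<in>A. f c < f u \<longrightarrow> c \<in> U)"
  using assms(2)
proof (induction D)
  case 0
  then show ?case by (intro exI[of _ "{}"]) auto
next
  case (Suc D)
  then have "D \<le> card A" by simp
  then obtain U where U: "U \<subseteq> A" "card U = D" "\<forall>u\<in>U. \<forall>c\<in>A. f c < f u \<longrightarrow> c \<in> U"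
    using Suc.IH by blast
  have "finite U" using U assms finite_subset by blast
  have "A - U \<noteq> {}" using U Suc.prems by auto
  moreover have "finite (A - U)" using assms by simp
  ultimately obtain m where m: "m \<in> A - U" "\<And>y. y \<in> A - U \<Longrightarrow> - f y \<le> - f m"
    using finite_max_on[of "A - U" "\<lambda>x. - f x"] by blast
  show ?case
  proof (intro exI[of _ "insert m U"] conjI)
    show "card (insert m U) = Suc D" using m U \<open>finite U\<close> by simp
    show "\<forall>u\<in>insert m U. \<forall>c\<in>A. f c < f u \<longrightarrow> c \<in> insert m U"
      using U(3) m(2) by force
  qed (use U m in auto)
qed

text \<open>The first such point strictly before \<open>x\<close> has all the others before
  \<open>x\<close> between itself and \<open>x\<close>, so they are fewer than \<open>r\<close>.
  Adding that first point and possibly one at \<open>x\<close> itself gives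
  \<open>r + 2\<close>.\<close>

lemma card_close_to_le:
  fixes f :: "'a \<Rightarrow> real"
  assumes "finite A" "inj_on f A" "0 \<le> r"
  shows "real (card {a \<in> A. f a \<le> x \<and> real (card {c \<in> A. f a < f c \<and> f c < x}) < r}) \<le> r + 2"
proof -
  let ?S = "{a \<in> A. f a \<le> x \<and> real (card {c \<in> A. f a < f c \<and> f c < x}) < r}"
  define T where "T = {a \<in> ?S. f a < x}"
  have fin: "finite T" "finite ?S" using assms by (auto simp: T_def)
  have "\<forall>a\<in>?S - T. \<forall>b\<in>?S - T. a = b"
  proof (intro ballI)
    fix a b assume "a \<in> ?S - T" "b \<in> ?S - T"
    then have "a \<in> A" "b \<in> A" "f a = x" "f b = x" by (auto simp: T_def)
    then show "a = b" using assms(2) by (metis inj_onD)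
  qed
  then have "card (?S - T) \<le> 1"
    using card_le_Suc0_iff_eq[of "?S - T"] fin by simp
  moreover have "real (card T) \<le> r + 1"
  proof (cases "T = {}")
    case False
    then obtain m where m: "m \<in> T" "\<And>y. y \<in> T \<Longrightarrow> - f y \<le> - f m"
      using finite_max_on[OF fin(1), of "\<lambda>x. - f x"] by blast
    have "T - {m} \<subseteq> {c \<in> A. f m < f c \<and> f c < x}"
    proof
      fix c assume c: "c \<in> T - {m}"
      then have "f m \<noteq> f c" using m(1) assms(2) unfolding T_def inj_on_def by blast
      then have "f m < f c" using m(2)[of c] c by simp
      then show "c \<in> {c \<in> A. f m < f c \<and> f c < x}" using c by (simp add: T_def)
    qed
    then have "card (T - {m}) \<le> card {c \<in> A. f m < f c \<and> f c < x}"
      using assms by (intro card_mono) auto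
    moreover have "real (card {c \<in> A. f m < f c \<and> f c < x}) < r"
      using m by (simp add: T_def)
    moreover have "card T = Suc (card (T - {m}))" using fin m by (metis card.remove)
    ultimately show ?thesis by simp
  qed (use assms in simp)
  moreover have "T \<subseteq> ?S" unfolding T_def by blast
  then have "card ?S = card T + card (?S - T)"
    using fin by (simp add: card_Diff_subset card_mono)
  ultimately show ?thesis by linarith
qed

definition near_edges :: "real \<Rightarrow> point set \<Rightarrow> segment set" where
  "near_edges \<delta> P = {(a, b). a \<in> P \<and> b \<in> P \<and> fst a < fst b \<and> 1 \<le> \<delta> * real (card (line_pts P a b)) \<and>
     real (card {c \<in> line_pts P a b. fst a < fst c \<and> fst c < fst b}) < \<delta> * real (card (line_pts P a b))}"

lemma near_edges_subset: "near_edges \<delta> P \<subseteq> P \<times> P"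
  by (auto simp: near_edges_def)

text \<open>
  The requirement \<open>1 \<le> \<delta> |l|\<close> in \<^const>\<open>near_edges\<close> discards short lines; these carry few pairs when no
  point is on many lines, and without them \<open>\<delta> |l| + 2 \<le> 3 \<delta> |l|\<close>.
\<close>

lemma near_degree_on_line:
  assumes P: "finite P" "inj_on fst P" and d: "0 < \<delta>" "\<delta> \<le> 1 / 8"
    and a: "a \<in> P" "b0 \<in> P" "a \<noteq> b0" and l: "l = line_pts P a b0"
  shows "\<delta> * real (card (l - {a})) - 1
     \<le> real (card {b \<in> l. (a, b) \<in> near_edges \<delta> P \<or> (b, a) \<in> near_edges \<delta> P})"
    (is "_ \<le> real (card ?N)")
proof -
  have finl: "finite l" and lP: "l \<subseteq> P" using P l by (auto simp: finite_line_pts line_pts_def)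
  have al: "a \<in> l" using endpoints_in_line_pts[OF P(2) a] l by simp
  have injl: "inj_on fst l" using lP P(2) inj_on_subset by blast
  have leq: "line_pts P a b = l" "line_pts P b a = l" if "b \<in> l" "b \<noteq> a" for b
    using line_pts_eq[OF P(2), of a a b0 b] line_pts_eq[OF P(2), of b a b0 a] that al l by auto
  have le: "\<delta> * real (card (l - {a})) \<le> \<delta> * real (card l)"
    using d finl by (intro mult_left_mono) (auto intro: card_mono)
  show ?thesis
  proof (cases "1 \<le> \<delta> * real (card l)")
    case False
    then show ?thesis using le by simp
  next
    case True
    \<comment> \<open>The \<open>D\<close> nearest points on one side of \<open>a\<close> are enough
      neighbours. At most \<open>D - 1\<close> points lie strictly between \<open>a\<close> and any
      of them, and \<open>D - 1\<close> is still below \<delta> |l|.\<close>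
    define D where "D = nat \<lceil>\<delta> * real (card l)\<rceil>"
    have D: "\<delta> * real (card l) \<le> real D" "real D < \<delta> * real (card l) + 1"
      using True by (auto simp: D_def) linarith
    define aft where "aft = {c \<in> l. fst a < fst c}"
    define bef where "bef = {c \<in> l. fst c < fst a}"
    have fin: "finite aft" "finite bef" using finl by (auto simp: aft_def bef_def)
    have lun: "l = insert a (aft \<union> bef)"
    proof (rule equalityI, rule subsetI)
      fix c assume "c \<in> l"
      then have "fst c = fst a \<Longrightarrow> c = a" using al injl by (meson inj_onD)
      then show "c \<in> insert a (aft \<union> bef)"
        using \<open>c \<in> l\<close> unfolding aft_def bef_def by (cases "fst c" "fst a" rule: linorder_cases) blast+
    qed (use al in \<open>auto simp: aft_def bef_def\<close>)
    have "card l = Suc (card (aft \<union> bef))"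
      by (subst lun, subst card_insert_disjoint) (use fin in \<open>auto simp: aft_def bef_def\<close>)
    then have cl: "card l = Suc (card aft + card bef)"
      using fin by (subst (asm) card_Un_disjoint) (auto simp: aft_def bef_def)
    have "\<delta> * real (card l) \<le> real (card l) / 8" using d(2) mult_right_mono[of \<delta> "1/8" "real (card l)"] by simp
    then have "2 * real D < real (card l) / 2" using D True by (simp add: field_simps)
    then have "D \<le> card aft \<or> D \<le> card bef" using cl by (simp add: field_simps) linarith
    \<comment> \<open>One side of \<open>a\<close> has \<open>D\<close> points because
      \<open>\<delta> \<le> 1 / 8\<close>. The sign \<open>g\<close> lets one argument treat both
      sides.\<close>
    then obtain g :: real where g: "g = 1 \<or> g = -1" and Dle: "D \<le> card {c \<in> l. g * fst a < g * fst c}"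
    proof
      assume "D \<le> card aft"
      then show thesis by (intro that[of 1]) (simp_all add: aft_def)
    next
      assume "D \<le> card bef"
      then show thesis by (intro that[of "-1"]) (simp_all add: bef_def)
    qed
    let ?A = "{c \<in> l. g * fst a < g * fst c}"
    obtain U where U: "U \<subseteq> ?A" "card U = D" "\<And>u c. u \<in> U \<Longrightarrow> c \<in> ?A \<Longrightarrow> g * fst c < g * fst u \<Longrightarrow> c \<in> U"
    proof -
      have "finite ?A" using finl by simp
      then show thesis
        using nearest_subset_exists[OF _ Dle, of "\<lambda>c. g * fst c"] that by blast
    qed
    have "?A \<subseteq> l" by blast
    then have finU: "finite U" using U(1) finl by (meson finite_subset)
    have "U \<subseteq> ?N"
    proof
      fix b assume b: "b \<in> U"
      then have bl: "b \<in> l" "g * fst a < g * fst b" using U(1) by auto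
      then have ba: "b \<noteq> a" by auto
      have "card {c \<in> l. g * fst a < g * fst c \<and> g * fst c < g * fst b} \<le> card (U - {b})"
        using U(3)[OF b] finU by (intro card_mono) auto
      also have "\<dots> = D - 1" using b finU U(2) by simp
      finally have "real (card {c \<in> l. g * fst a < g * fst c \<and> g * fst c < g * fst b}) < \<delta> * real (card l)"
        using D True by (simp add: of_nat_diff)
      then show "b \<in> ?N"
        using g bl leq[OF bl(1) ba] True a lP by (auto simp: near_edges_def conj_commute)
    qed
    then have "D \<le> card ?N" using U(2) finl card_mono[of ?N U] by auto
    then show ?thesis using D le by linarith
  qed
qed

text \<open>The lines through \<open>a\<close> partition the other points, and each line falls short
  of its share \<delta> |l - {a}| by at most 1. The total loss is thus at most the number of lines
  through \<open>a\<close>.\<close>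

lemma near_degree:
  assumes P: "finite P" "inj_on fst P" and d: "0 < \<delta>" "\<delta> \<le> 1 / 8" and a: "a \<in> P"
  shows "\<delta> * real (card P - 1) - real (card (line_pts P a ` (P - {a})))
     \<le> real (card {b. (a, b) \<in> near_edges \<delta> P \<or> (b, a) \<in> near_edges \<delta> P})" (is "_ \<le> real (card ?N)")
proof -
  let ?L = "line_pts P a ` (P - {a})"
  have finL: "finite ?L" using P by simp
  have finl: "finite l" if "l \<in> ?L" for l using that finite_line_pts[OF P(1)] by blast
  have finN: "finite ?N" by (rule finite_subset[OF _ P(1)]) (auto simp: near_edges_def)
  have aN: "a \<notin> ?N" by (auto simp: near_edges_def)
  have "P - {a} \<subseteq> (\<Union>l\<in>?L. l - {a})"
    using endpoints_in_line_pts[OF P(2) a] by auto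
  then have "card (P - {a}) \<le> card (\<Union>l\<in>?L. l - {a})"
    using finl finL by (intro card_mono) auto
  also have "\<dots> \<le> (\<Sum>l\<in>?L. card (l - {a}))" using finL by (rule card_UN_le)
  finally have "real (card P - 1) \<le> (\<Sum>l\<in>?L. real (card (l - {a})))"
    using a P(1) by (metis card_Diff_singleton of_nat_mono of_nat_sum)
  then have "\<delta> * real (card P - 1) - real (card ?L) \<le> (\<Sum>l\<in>?L. \<delta> * real (card (l - {a})) - 1)"
    using d by (simp add: sum_subtractf sum_distrib_left[symmetric])
  also have "\<dots> \<le> (\<Sum>l\<in>?L. real (card (?N \<inter> l)))"
  proof (rule sum_mono)
    fix l assume "l \<in> ?L"
    then obtain b0 where b0: "b0 \<in> P" "a \<noteq> b0" "l = line_pts P a b0" by auto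
    have "?N \<inter> l = {b \<in> l. (a, b) \<in> near_edges \<delta> P \<or> (b, a) \<in> near_edges \<delta> P}" by auto
    then show "\<delta> * real (card (l - {a})) - 1 \<le> real (card (?N \<inter> l))"
      using near_degree_on_line[OF P d a b0] by simp
  qed
  also have "\<dots> = real (card (\<Union>l\<in>?L. ?N \<inter> l))"
  proof (subst card_UN_disjoint)
    show "\<forall>l\<in>?L. \<forall>l'\<in>?L. l \<noteq> l' \<longrightarrow> (?N \<inter> l) \<inter> (?N \<inter> l') = {}"
    proof (intro ballI impI, rule ccontr)
      fix l l' assume l: "l \<in> ?L" "l' \<in> ?L" "l \<noteq> l'" and "(?N \<inter> l) \<inter> (?N \<inter> l') \<noteq> {}"
      then obtain x where x: "x \<in> ?N" "x \<in> l" "x \<in> l'" by auto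
      then have "x \<noteq> a" using aN by auto
      have "line_pts P a x = l" if "l \<in> ?L" "x \<in> l" for l
      proof -
        obtain b where b: "b \<in> P" "a \<noteq> b" "l = line_pts P a b"
          using \<open>l \<in> ?L\<close> by (elim imageE) blast
        then show ?thesis
          using line_pts_eq[OF P(2), of a a b x] endpoints_in_line_pts(1)[OF P(2) a, of b] that(2) \<open>x \<noteq> a\<close>
          by simp
      qed
      then show False using l x by metis
    qed
  qed (use finL finN in auto)
  also have "\<dots> \<le> real (card ?N)" using finN by (simp add: card_mono UN_least)
  finally show ?thesis .
qed

text \<open>With n points, \<open>4 \<le> card P\<close> gives n - 1 \<ge> 3n/4, so every degree is
  at least 3\<delta>n/4 - \<delta>n/4 = \<delta>n/2. Each edge is seen from its two ends, which
  halves the sum of degrees.\<close>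

lemma card_near_edges_ge:
  assumes P: "finite P" "inj_on fst P" and d: "0 < \<delta>" "\<delta> \<le> 1 / 8" and n: "4 \<le> card P"
    and few: "\<And>a. a \<in> P \<Longrightarrow> real (card (line_pts P a ` (P - {a}))) \<le> \<delta> / 4 * real (card P)"
  shows "\<delta> * (real (card P))\<^sup>2 / 4 \<le> real (card (near_edges \<delta> P))"
proof -
  let ?E = "near_edges \<delta> P"
  let ?N = "\<lambda>a. {b. (a, b) \<in> ?E \<or> (b, a) \<in> ?E}"
  have finE: "finite ?E" using near_edges_subset P(1) finite_subset by blast
  have finN: "finite (?N a)" for a by (rule finite_subset[OF _ P(1)]) (auto simp: near_edges_def)
  have deg: "\<delta> * real (card P) / 2 \<le> real (card (?N a))" if "a \<in> P" for a
  proof -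
    have "\<delta> * (3 * real (card P) / 4) \<le> \<delta> * real (card P - 1)"
      using d n by (intro mult_left_mono) (auto simp: of_nat_diff)
    then show ?thesis
      using near_degree[OF P d that] few[OF that] by (simp add: field_simps)
  qed
  have "real (card P) * (\<delta> * real (card P) / 2) \<le> (\<Sum>a\<in>P. real (card (?N a)))"
    using sum_mono[of P "\<lambda>_. \<delta> * real (card P) / 2" "\<lambda>a. real (card (?N a))"] deg by simp
  also have "\<dots> = real (card (SIGMA a:P. ?N a))" using P finN by (simp add: card_SigmaI)
  also have "\<dots> \<le> real (card (?E \<union> prod.swap ` ?E))"
  proof (intro of_nat_mono card_mono)
    have "(b, a) \<in> ?E \<Longrightarrow> (a, b) \<in> prod.swap ` ?E" for a b
      by (metis pair_in_swap_image)
    then show "(SIGMA a:P. ?N a) \<subseteq> ?E \<union> prod.swap ` ?E" by blast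
  qed (use finE in simp)
  also have "\<dots> \<le> real (card ?E + card (prod.swap ` ?E))" by (metis card_Un_le of_nat_mono)
  also have "\<dots> \<le> 2 * real (card ?E)" using card_image_le[OF finE, of prod.swap] by simp
  finally show ?thesis by (simp add: power2_eq_square field_simps)
qed

lemma card_triples_le:
  assumes "finite P" and M: "\<And>a b. a \<in> P \<Longrightarrow> b \<in> P \<Longrightarrow> a \<noteq> b \<Longrightarrow> card (line_pts P a b) \<le> M"
  shows "card (triples P) \<le> (card P)\<^sup>2 * M"
proof -
  let ?S = "SIGMA a:P. SIGMA b:P - {a}. line_pts P a b"
  have "card (triples P) \<le> card ?S"
    using assms finite_line_pts by (intro card_mono) (auto simp: triples_def)
  also have "\<dots> = (\<Sum>a\<in>P. \<Sum>b\<in>P - {a}. card (line_pts P a b))"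
    using assms finite_line_pts by (simp add: card_SigmaI)
  also have "\<dots> \<le> (\<Sum>a\<in>P. \<Sum>b\<in>P - {a}. M)"
    using M by (intro sum_mono) auto
  also have "\<dots> \<le> (\<Sum>a\<in>P. card P * M)"
    using assms(1) by (intro sum_mono) (auto intro: card_mono simp: Diff_subset)
  finally show ?thesis by (simp add: power2_eq_square)
qed

section \<open>Few crossings between edges on different lines\<close>

definition lines :: "point set \<Rightarrow> point set set" where
  "lines P = {line_pts P a b |a b. a \<in> P \<and> b \<in> P \<and> a \<noteq> b}"

lemma finite_lines: "finite P \<Longrightarrow> finite (lines P)"
  by (rule finite_subset[of _ "Pow P"]) (auto simp: lines_def line_pts_def)

text \<open>Two points determine their line, so ordered pairs of distinct points on different lines
  are different, and there are at most n^2 of them. The factor 2 comes from |l|^2 \<le> 2 |l| (|l| -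
  1) for |l| \<ge> 2.\<close>

lemma sum_card_lines_sq_le:
  assumes P: "finite P" "inj_on fst P"
  shows "(\<Sum>l\<in>lines P. (card l)\<^sup>2) \<le> 2 * (card P)\<^sup>2"
proof -
  define Q where "Q l = (SIGMA a:l. l - {a})" for l :: "point set"
  have l: "finite l" "l \<subseteq> P" "2 \<le> card l" if "l \<in> lines P" for l
  proof -
    from that obtain a b where ab: "a \<in> P" "b \<in> P" "a \<noteq> b" "l = line_pts P a b"
      unfolding lines_def by blast
    show fl: "finite l" and "l \<subseteq> P" using ab P finite_line_pts line_pts_subset by blast+
    have "{a, b} \<subseteq> l" using ab endpoints_in_line_pts[OF P(2), of a b] by simp
    then have "card {a, b} \<le> card l" using fl by (rule card_mono[rotated])
    then show "2 \<le> card l" using ab by simp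
  qed
  have "(\<Sum>l\<in>lines P. (card l)\<^sup>2) \<le> (\<Sum>l\<in>lines P. 2 * card (Q l))"
  proof (rule sum_mono)
    fix l' assume "l' \<in> lines P"
    then have a: "finite l'" "2 \<le> card l'" using l by blast+
    have "card (Q l') = card l' * (card l' - 1)"
      using a by (simp add: Q_def card_SigmaI)
    moreover have "card l' * card l' \<le> card l' * (2 * (card l' - 1))"
      using a by (intro mult_left_mono) auto
    ultimately show "(card l')\<^sup>2 \<le> 2 * card (Q l')" by (simp add: power2_eq_square algebra_simps)
  qed
  also have "\<dots> = 2 * (\<Sum>l\<in>lines P. card (Q l))" by (simp add: sum_distrib_left)
  also have "(\<Sum>l\<in>lines P. card (Q l)) = card (\<Union>l\<in>lines P. Q l)"
  proof (subst card_UN_disjoint)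
    show "finite (lines P)" using P finite_lines by blast
    show "\<forall>l\<in>lines P. finite (Q l)" using l by (auto simp: Q_def)
    show "\<forall>l\<in>lines P. \<forall>l'\<in>lines P. l \<noteq> l' \<longrightarrow> Q l \<inter> Q l' = {}"
    proof (intro ballI impI, rule ccontr)
      fix l l' assume ll: "l \<in> lines P" "l' \<in> lines P" "l \<noteq> l'" "Q l \<inter> Q l' \<noteq> {}"
      then obtain c d where cd: "c \<in> l" "d \<in> l" "c \<in> l'" "d \<in> l'" "c \<noteq> d" by (auto simp: Q_def)
      have "line_pts P c d = k" if "k \<in> lines P" "c \<in> k" "d \<in> k" for k
      proof -
        from that(1) obtain a b where "k = line_pts P a b" unfolding lines_def by blast
        then show ?thesis using line_pts_eq[OF P(2)] that(2,3) cd(5) by blast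
      qed
      then show False using ll cd by metis
    qed
  qed simp
  also have "card (\<Union>l\<in>lines P. Q l) \<le> card (P \<times> P)"
    using P l(2) by (intro card_mono) (auto simp: Q_def)
  finally show ?thesis by (simp add: power2_eq_square card_cartesian_product)
qed

text \<open>Both ends of such an edge are close to \<open>x\<close> in the sense of
  \<open>card_close_to_le\<close>, which is applied from the left and, with negated abscissae, from
  the right. This leaves at most (3 \<delta> |l|)^2 pairs of ends.\<close>

lemma card_edges_covering_le:
  assumes P: "finite P" "inj_on fst P"
  shows "real (card {e \<in> near_edges \<delta> P. line_pts P (fst e) (snd e) = l \<and> lo e \<le> x \<and> x \<le> hi e})
     \<le> 9 * \<delta>\<^sup>2 * (real (card l))\<^sup>2" (is "real (card ?C) \<le> _")
proof (cases "?C = {}")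
  case False
  then obtain e0 where e0: "e0 \<in> ?C" by blast
  define r where "r = \<delta> * real (card l)"
  have r: "1 \<le> r" using e0 by (auto simp: near_edges_def r_def)
  have l: "l \<subseteq> P" using e0 line_pts_subset by blast
  then have fl: "finite l" and injl: "inj_on fst l" using P finite_subset inj_on_subset by blast+
  define S where "S = {a \<in> l. fst a \<le> x \<and> real (card {c \<in> l. fst a < fst c \<and> fst c < x}) < r}"
  define T where "T = {a \<in> l. - fst a \<le> - x \<and> real (card {c \<in> l. - fst a < - fst c \<and> - fst c < - x}) < r}"
  have "?C \<subseteq> S \<times> T"
  proof
    fix e assume e: "e \<in> ?C"
    obtain a b where ab: "e = (a, b)" by (cases e)
    have h: "a \<in> P" "b \<in> P" "fst a < fst b" "line_pts P a b = l" "fst a \<le> x" "x \<le> fst b"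
      "real (card {c \<in> l. fst a < fst c \<and> fst c < fst b}) < r"
      using e unfolding ab near_edges_def r_def by auto
    have "a \<noteq> b" using h(3) by auto
    then have "a \<in> l" "b \<in> l" using endpoints_in_line_pts[OF P(2) h(1,2)] h(4) by auto
    moreover have "card {c \<in> l. fst a < fst c \<and> fst c < x} \<le> card {c \<in> l. fst a < fst c \<and> fst c < fst b}"
      using h fl by (intro card_mono) auto
    moreover have "card {c \<in> l. - fst b < - fst c \<and> - fst c < - x} \<le> card {c \<in> l. fst a < fst c \<and> fst c < fst b}"
      using h fl by (intro card_mono) auto
    ultimately show "e \<in> S \<times> T"
      using h unfolding ab S_def T_def by auto
  qed
  then have "card ?C \<le> card (S \<times> T)"
    using fl by (intro card_mono) (auto simp: S_def T_def)
  then have "real (card ?C) \<le> real (card S) * real (card T)"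
    by (simp add: card_cartesian_product flip: of_nat_mult)
  also have "\<dots> \<le> (3 * r) * (3 * r)"
  proof (intro mult_mono)
    show "real (card S) \<le> 3 * r"
      using card_close_to_le[OF fl injl, of r x] r by (simp add: S_def)
    have "inj_on (\<lambda>a. - fst a) l" using injl by (simp add: inj_on_def)
    then show "real (card T) \<le> 3 * r"
      using card_close_to_le[OF fl, of "\<lambda>a. - fst a" r "- x"] r by (simp add: T_def)
  qed (use r in auto)
  also have "\<dots> = 9 * \<delta>\<^sup>2 * (real (card l))\<^sup>2" by (simp add: r_def power2_eq_square)
  finally show ?thesis .
next
  case True
  then show ?thesis by (simp only: card.empty) simp
qed

text \<open>Edges on two given different lines can clash only over the abscissa \<open>x0\<close>
  where the lines meet, so both must cover it. Summed over all pairs of lines, the product of the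
  two covering bounds becomes a square, and 324 = (9 * 2)^2.\<close>

lemma card_clash_pairs_le:
  assumes P: "finite P" "inj_on fst P"
  shows "real (card (clash_pairs (near_edges \<delta> P))) \<le> 324 * \<delta> ^ 4 * (real (card P)) ^ 4"
proof -
  let ?E = "near_edges \<delta> P"
  let ?ln = "\<lambda>e. line_pts P (fst e) (snd e)"
  define C where "C l l' = {(e, f). (e, f) \<in> clash_pairs ?E \<and> ?ln e = l \<and> ?ln f = l'}" for l l'
  define w where "w l = 9 * \<delta>\<^sup>2 * (real (card l))\<^sup>2" for l :: "point set"
  have finE: "finite ?E" using near_edges_subset P(1) finite_subset by blast
  have finC: "finite (clash_pairs ?E)"
    by (rule finite_subset[of _ "?E \<times> ?E"]) (use finE in \<open>auto simp: clash_pairs_def\<close>)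
  have wt: "0 \<le> w l" for l by (simp add: w_def)
  have e_in: "fst e \<in> ?ln e" "snd e \<in> ?ln e" "fst e \<noteq> snd e" "?ln e \<in> lines P" if "e \<in> ?E" for e
  proof -
    have "fst e \<in> P" "snd e \<in> P" and ne: "fst e \<noteq> snd e" using that by (auto simp: near_edges_def)
    then show "fst e \<in> ?ln e" "snd e \<in> ?ln e" "fst e \<noteq> snd e" "?ln e \<in> lines P"
      using endpoints_in_line_pts[OF P(2)] unfolding lines_def by blast+
  qed
  have hgt: "height e = height e'" if "e \<in> ?E" "?ln e = ?ln e'" for e e'
    using line_pts_height_eq[OF P(2), of "fst e" "fst e'" "snd e'" "snd e"] e_in[OF that(1)] that(2) by simp
  have Cle: "real (card (C l l')) \<le> w l * w l'" for l l'
  proof (cases "C l l' = {}")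
    case False
    then obtain e0 f0 where ef0: "(e0, f0) \<in> C l l'" by (auto simp: C_def)
    then obtain x0 where x0: "height e0 x0 = height f0 x0"
      by (auto simp: C_def clash_pairs_def clash_def)
    have ne: "height e0 \<noteq> height f0" using ef0 by (simp add: C_def clash_pairs_def)
    define cov where "cov l = {e \<in> ?E. ?ln e = l \<and> lo e \<le> x0 \<and> x0 \<le> hi e}" for l
    have "C l l' \<subseteq> cov l \<times> cov l'"
    proof
      fix z assume z: "z \<in> C l l'"
      obtain e f where ef: "z = (e, f)" by (cases z)
      have E: "e \<in> ?E" "f \<in> ?E" "?ln e = l" "?ln f = l'" "clash e f"
        using z unfolding ef C_def clash_pairs_def by auto
      have "height e = height e0" "height f = height f0"
        using hgt[OF E(1), of e0] hgt[OF E(2), of f0] E(3,4) ef0 by (auto simp: C_def)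
      then obtain x where x: "lo e \<le> x" "x \<le> hi e" "lo f \<le> x" "x \<le> hi f" "height e0 x = height f0 x"
        using E(5) unfolding clash_def by auto
      have "x = x0" using height_eqI[OF x(5) x0] ne by blast
      then show "z \<in> cov l \<times> cov l'" using x E unfolding ef cov_def by simp
    qed
    then have "card (C l l') \<le> card (cov l \<times> cov l')"
      using finE by (intro card_mono) (auto simp: cov_def)
    then have "real (card (C l l')) \<le> real (card (cov l)) * real (card (cov l'))"
      by (simp add: card_cartesian_product flip: of_nat_mult)
    also have "\<dots> \<le> w l * w l'"
      unfolding cov_def w_def by (intro mult_mono card_edges_covering_le[OF P]) auto
    finally show ?thesis .
  qed (use wt in simp)
  have "clash_pairs ?E \<subseteq> (\<Union>l\<in>lines P. \<Union>l'\<in>lines P. C l l')"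
  proof
    fix z assume z: "z \<in> clash_pairs ?E"
    obtain e f where ef: "z = (e, f)" by (cases z)
    have "e \<in> ?E" "f \<in> ?E" using z unfolding ef clash_pairs_def by auto
    then have "?ln e \<in> lines P" "?ln f \<in> lines P" using e_in(4) by auto
    moreover have "z \<in> C (?ln e) (?ln f)" using z unfolding ef C_def by simp
    ultimately show "z \<in> (\<Union>l\<in>lines P. \<Union>l'\<in>lines P. C l l')" by blast
  qed
  moreover have "finite (C l l')" for l l'
    by (rule finite_subset[OF _ finC]) (auto simp: C_def)
  ultimately have "card (clash_pairs ?E) \<le> card (\<Union>l\<in>lines P. \<Union>l'\<in>lines P. C l l')"
    using finite_lines[OF P(1)] by (intro card_mono) auto
  also have "\<dots> \<le> (\<Sum>l\<in>lines P. card (\<Union>l'\<in>lines P. C l l'))"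
    using finite_lines[OF P(1)] by (rule card_UN_le)
  also have "\<dots> \<le> (\<Sum>l\<in>lines P. \<Sum>l'\<in>lines P. card (C l l'))"
    using finite_lines[OF P(1)] by (intro sum_mono card_UN_le)
  finally have "real (card (clash_pairs ?E)) \<le> real (\<Sum>l\<in>lines P. \<Sum>l'\<in>lines P. card (C l l'))"
    by (rule of_nat_mono)
  also have "\<dots> = (\<Sum>l\<in>lines P. \<Sum>l'\<in>lines P. real (card (C l l')))" by simp
  also have "\<dots> \<le> (\<Sum>l\<in>lines P. \<Sum>l'\<in>lines P. w l * w l')"
    using Cle by (intro sum_mono)
  also have "\<dots> = (\<Sum>l\<in>lines P. w l)\<^sup>2" by (simp add: sum_product power2_eq_square)
  also have "\<dots> \<le> (18 * \<delta>\<^sup>2 * (real (card P))\<^sup>2)\<^sup>2"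
  proof (rule power_mono)
    have "real (\<Sum>l\<in>lines P. (card l)\<^sup>2) \<le> real (2 * (card P)\<^sup>2)"
      using sum_card_lines_sq_le[OF P] by (rule of_nat_mono)
    then have "(\<Sum>l\<in>lines P. (real (card l))\<^sup>2) \<le> 2 * (real (card P))\<^sup>2" by simp
    then have "9 * \<delta>\<^sup>2 * (\<Sum>l\<in>lines P. (real (card l))\<^sup>2) \<le> 9 * \<delta>\<^sup>2 * (2 * (real (card P))\<^sup>2)"
      by (intro mult_left_mono) auto
    then show "(\<Sum>l\<in>lines P. w l) \<le> 18 * \<delta>\<^sup>2 * (real (card P))\<^sup>2"
      by (simp add: w_def sum_distrib_left[symmetric])
  qed (simp add: wt sum_nonneg)
  finally show ?thesis by (simp add: power_mult_distrib flip: power_mult)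
qed

lemma planar_weak_dirac:
  fixes P :: "point set"
  assumes P: "finite P" "inj_on fst P" and n: "2 \<le> card P"
  shows "(\<exists>a\<in>P. \<exists>b\<in>P. a \<noteq> b \<and> 1 / 10 ^ 26 * real (card P) \<le> real (card (line_pts P a b)))
    \<or> (\<exists>a\<in>P. 1 / 10 ^ 26 * real (card P) \<le> real (card (line_pts P a ` (P - {a}))))"
proof (rule ccontr)
  assume neg: "\<not> ?thesis"
  define N where "N = real (card P)"
  define c :: real where "c = 1 / 10 ^ 26"
  \<comment> \<open>With s = 24 / \<delta> the left side \<delta> s^2 / 4 = 144 / \<delta> of the
    final inequality is twice the vertex term 3 s. The crossing term becomes 324 * 24^4, which does
    not depend on \<delta>, so a small \<delta> fits it into the remaining half; \<open>c\<close>
    then makes the triple term c s^3 less than 1.\<close>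
  define \<delta> :: real where "\<delta> = 1 / 10 ^ 7"
  define s :: real where "s = 24 * 10 ^ 7"
  have line: "real (card (line_pts P a b)) < c * N" if "a \<in> P" "b \<in> P" "a \<noteq> b" for a b
    using neg that unfolding c_def N_def by force
  have few: "real (card (line_pts P a ` (P - {a}))) < c * N" if "a \<in> P" for a
    using neg that unfolding c_def N_def by force
  \<comment> \<open>Any two points span a line with at least two points, so the negated claim
    already forces \<open>2 < c * N\<close>. This makes \<open>N\<close> so large that
    \<open>p = s / N\<close> is a probability.\<close>
  obtain a b where ab: "a \<in> P" "b \<in> P" "a \<noteq> b"
    using two_le_cardE[OF n] .
  have "{a, b} \<subseteq> line_pts P a b" using endpoints_in_line_pts[OF P(2) ab] by simp
  then have "card {a, b} \<le> card (line_pts P a b)" by (rule card_mono[OF finite_line_pts[OF P(1)]])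
  then have "2 < c * N" using line[OF ab] ab(3) by simp
  then have N: "2 * 10 ^ 26 < N" by (simp add: c_def)
  define p where "p = s / N"
  have N0: "N > 0" and s0: "s > 0" using N by (simp_all add: s_def)
  have p: "0 \<le> p" "p \<le> 1" using N N0 by (simp_all add: p_def s_def)
  have pN: "p * N = s" using N0 by (simp add: p_def)
  have E: "\<delta> * N\<^sup>2 / 4 \<le> real (card (near_edges \<delta> P))"
    unfolding N_def
  proof (rule card_near_edges_ge[OF P])
    show "4 \<le> card P" using N unfolding N_def by simp
    fix a assume "a \<in> P"
    have "c * N \<le> \<delta> / 4 * N" using N0 by (simp add: c_def \<delta>_def)
    then show "real (card (line_pts P a ` (P - {a}))) \<le> \<delta> / 4 * real (card P)"
      using few[OF \<open>a \<in> P\<close>] unfolding N_def by linarith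
  qed (simp_all add: \<delta>_def)
  define M where "M = nat \<lfloor>c * N\<rfloor>"
  have M: "real M \<le> c * N" unfolding M_def using N0 by (intro of_nat_floor) (simp add: c_def)
  have "card (triples P) \<le> (card P)\<^sup>2 * M"
  proof (rule card_triples_le[OF P(1)])
    fix a b assume "a \<in> P" "b \<in> P" "a \<noteq> b"
    then show "card (line_pts P a b) \<le> M"
      using line[of a b] unfolding M_def by (simp add: le_nat_floor)
  qed
  then have "real (card (triples P)) \<le> N\<^sup>2 * real M"
    unfolding N_def by (metis of_nat_mono of_nat_mult of_nat_power)
  also have "\<dots> \<le> N\<^sup>2 * (c * N)" using M by (intro mult_left_mono) auto
  finally have T: "real (card (triples P)) \<le> c * N ^ 3" by (simp add: power2_eq_square power3_eq_cube algebra_simps)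
  have C: "real (card (clash_pairs (near_edges \<delta> P))) \<le> 324 * \<delta> ^ 4 * N ^ 4"
    unfolding N_def by (rule card_clash_pairs_le[OF P])
  have "p\<^sup>2 * (\<delta> * N\<^sup>2 / 4) \<le> p\<^sup>2 * real (card (near_edges \<delta> P))"
    using E by (intro mult_left_mono) auto
  also have "\<dots> \<le> 3 * p * N + p ^ 4 * real (card (clash_pairs (near_edges \<delta> P))) + p ^ 3 * real (card (triples P))"
    unfolding N_def
    by (rule sampled_crossing_bound[OF P near_edges_subset _ p]) (auto simp: near_edges_def)
  also have "\<dots> \<le> 3 * p * N + p ^ 4 * (324 * \<delta> ^ 4 * N ^ 4) + p ^ 3 * (c * N ^ 3)"
    using C T p by (intro add_mono mult_left_mono) auto
  also have "\<dots> = 3 * (p * N) + 324 * \<delta> ^ 4 * (p * N) ^ 4 + c * (p * N) ^ 3"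
    by (simp add: power_mult_distrib algebra_simps)
  also have "p\<^sup>2 * (\<delta> * N\<^sup>2 / 4) = \<delta> / 4 * (p * N)\<^sup>2" by (simp add: power_mult_distrib)
  finally have "\<delta> / 4 * s\<^sup>2 \<le> 3 * s + 324 * \<delta> ^ 4 * s ^ 4 + c * s ^ 3" unfolding pN .
  then show False by (simp add: \<delta>_def s_def c_def power_divide)
qed

section \<open>From projective point sets to the plane by generic projection\<close>

lemma exists_functional_nonzero:
  fixes Z :: "'v::real_vector set"
  assumes "finite Z" "0 \<notin> Z"
  shows "\<exists>f::'v \<Rightarrow> real. linear f \<and> (\<forall>z\<in>Z. f z \<noteq> 0)"
  using assms
proof (induction Z rule: finite_induct)
  case empty
  show ?case by (intro exI[of _ "\<lambda>_. 0"]) (auto intro: linear_zero)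
next
  case (insert z Z)
  then obtain f :: "'v \<Rightarrow> real" where f: "linear f" "\<forall>z\<in>Z. f z \<noteq> 0" by auto
  have "independent {z}" using insert by auto
  then obtain g :: "'v \<Rightarrow> real" where g: "linear g" "g z = 1"
    using linear_independent_extend[of "{z}" "\<lambda>_. 1::real"] by auto
  have "finite (insert (- f z) ((\<lambda>w. - f w / g w) ` Z))" using insert by simp
  \<comment> \<open>Each vector excludes at most one factor \<open>t\<close> in
    \<open>f + t * g\<close>.\<close>
  then obtain t where t: "t \<notin> insert (- f z) ((\<lambda>w. - f w / g w) ` Z)"
    using ex_new_if_finite[OF infinite_UNIV_char_0] by blast
  have "linear (\<lambda>w. f w + t *\<^sub>R g w)"
    using f g by (intro linear_compose_add linear_compose_scale_right) auto
  moreover have "f w + t * g w \<noteq> 0" if "w \<in> insert z Z" for w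
  proof (cases "w = z")
    case True
    then show ?thesis using t g by (auto simp: add_eq_0_iff)
  next
    case False
    then have w: "w \<in> Z" using that by simp
    show ?thesis
    proof
      assume *: "f w + t * g w = 0"
      then have "g w \<noteq> 0" using f w by auto
      then have "t = - f w / g w" using * by (simp add: field_simps eq_neg_iff_add_eq_0)
      then show False using t w by auto
    qed
  qed
  ultimately show ?case by (intro exI[of _ "\<lambda>w. f w + t *\<^sub>R g w"]) simp
qed

text \<open>A finite set of distinct points of a projective space, one vector for each
  point.\<close>

definition nonparallel :: "'v::real_vector set \<Rightarrow> bool" where
  "nonparallel B \<longleftrightarrow> finite B \<and> 0 \<notin> B \<and> (\<forall>x\<in>B. \<forall>y\<in>B. x \<noteq> y \<longrightarrow> y \<notin> span {x})"

lemma nonparallel_subset: "nonparallel B \<Longrightarrow> A \<subseteq> B \<Longrightarrow> nonparallel A"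
  unfolding nonparallel_def using finite_subset by blast

lemma in_span_pair: "c \<in> span {a, b} \<longleftrightarrow> (\<exists>\<alpha> \<beta>. c = \<alpha> *\<^sub>R a + \<beta> *\<^sub>R b)"
proof -
  have "c \<in> span {a, b} \<longleftrightarrow> (\<exists>\<alpha>. c - \<alpha> *\<^sub>R a \<in> span {b})" by (rule span_breakdown_eq)
  also have "\<dots> \<longleftrightarrow> (\<exists>\<alpha> \<beta>. c = \<alpha> *\<^sub>R a + \<beta> *\<^sub>R b)"
    unfolding span_singleton by (simp add: image_iff diff_eq_eq add.commute)
  finally show ?thesis .
qed

text \<open>\<open>h\<close> picks an affine chart containing all of \<open>B\<close>,
  \<open>f\<close> gives distinct abscissae, and \<open>g\<close> gives ordinates that create no new
  collinear triples. Each of the three only has to avoid zero on a finite set.\<close>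

lemma generic_plane_projection:
  fixes B :: "'v::real_vector set"
  assumes B: "nonparallel B"
  shows "\<exists>\<psi>::'v \<Rightarrow> point. inj_on (fst \<circ> \<psi>) B \<and>
    (\<forall>a\<in>B. \<forall>b\<in>B. \<forall>c\<in>B. a \<noteq> b \<longrightarrow>
       (snd (\<psi> c) = height (\<psi> a, \<psi> b) (fst (\<psi> c)) \<longleftrightarrow> c \<in> span {a, b}))"
proof -
  have fB: "finite B" and B0: "0 \<notin> B" and Bp: "\<And>x y. x \<in> B \<Longrightarrow> y \<in> B \<Longrightarrow> x \<noteq> y \<Longrightarrow> y \<notin> span {x}"
    using B by (auto simp: nonparallel_def)
  obtain h :: "'v \<Rightarrow> real" where h: "linear h" "\<And>x. x \<in> B \<Longrightarrow> h x \<noteq> 0"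
    using exists_functional_nonzero[OF fB B0] by blast
  define n where "n x = (1 / h x) *\<^sub>R x" for x
  have hn: "h (n x) = 1" if "x \<in> B" for x
    using h(2)[OF that] by (simp add: n_def linear_cmul[OF h(1)])
  have xn: "x = h x *\<^sub>R n x" if "x \<in> B" for x using h(2)[OF that] by (simp add: n_def)
  have ndiff: "n x - n y \<noteq> 0" if "x \<in> B" "y \<in> B" "x \<noteq> y" for x y
  proof
    assume "n x - n y = 0"
    then have "y = h y *\<^sub>R n x" using xn[OF that(2)] by simp
    then have "y \<in> span {x}" unfolding n_def by (metis span_base span_scale singletonI)
    then show False using Bp that by blast
  qed
  let ?Z = "(\<lambda>(x, y). n x - n y) ` {(x, y). x \<in> B \<and> y \<in> B \<and> x \<noteq> y}"
  have "finite ?Z"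
    by (rule finite_imageI, rule finite_subset[of _ "B \<times> B"]) (use fB in auto)
  moreover have "0 \<notin> ?Z" using ndiff by auto
  ultimately obtain f :: "'v \<Rightarrow> real" where f: "linear f" "\<And>z. z \<in> ?Z \<Longrightarrow> f z \<noteq> 0"
    using exists_functional_nonzero[of ?Z] by blast
  have fne: "f (n x) \<noteq> f (n y)" if "x \<in> B" "y \<in> B" "x \<noteq> y" for x y
    using f(2)[of "n x - n y"] that linear_diff[OF f(1)] by force
  \<comment> \<open>This vector vanishes exactly when \<open>n c\<close> is on the affine line
    through \<open>n a\<close> and \<open>n b\<close>. Its value under \<open>g\<close> is the
    determinant that tests collinearity of the three images.\<close>
  define z where "z a b c = (f (n b) - f (n a)) *\<^sub>R (n c - n a) - (f (n c) - f (n a)) *\<^sub>R (n b - n a)" for a b c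
  let ?W = "(\<lambda>(a, b, c). z a b c) ` (B \<times> B \<times> B) - {0}"
  have "finite ?W" using fB by simp
  then obtain g :: "'v \<Rightarrow> real" where g: "linear g" "\<And>w. w \<in> ?W \<Longrightarrow> g w \<noteq> 0"
    using exists_functional_nonzero[of ?W] by blast
  define \<psi> where "\<psi> x = (f (n x), g (n x))" for x
  have "inj_on (fst \<circ> \<psi>) B" using fne by (force simp: inj_on_def \<psi>_def)
  moreover have "snd (\<psi> c) = height (\<psi> a, \<psi> b) (fst (\<psi> c)) \<longleftrightarrow> c \<in> span {a, b}"
    if abc: "a \<in> B" "b \<in> B" "c \<in> B" "a \<noteq> b" for a b c
  proof -
    have ne: "f (n b) - f (n a) \<noteq> 0" using fne abc by simp
    have gz: "g (z a b c) = (f (n b) - f (n a)) * (g (n c) - g (n a)) - (f (n c) - f (n a)) * (g (n b) - g (n a))"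
      by (simp add: z_def linear_diff[OF g(1)] linear_cmul[OF g(1)])
    have "snd (\<psi> c) = height (\<psi> a, \<psi> b) (fst (\<psi> c)) \<longleftrightarrow> g (z a b c) = 0"
      unfolding gz using ne by (auto simp: \<psi>_def height_def slope_def field_simps)
    also have "\<dots> \<longleftrightarrow> z a b c = 0"
      using g(2)[of "z a b c"] abc linear_0[OF g(1)] by force
    also have "\<dots> \<longleftrightarrow> c \<in> span {a, b}"
    proof
      assume z0: "z a b c = 0"
      define t where "t = (f (n c) - f (n a)) / (f (n b) - f (n a))"
      have "(f (n b) - f (n a)) *\<^sub>R (n c - n a) = (f (n b) - f (n a)) *\<^sub>R (t *\<^sub>R (n b - n a))"
        using z0 ne by (simp add: z_def t_def)
      then have "n c - n a = t *\<^sub>R (n b - n a)" using ne by (simp only: scaleR_cancel_left) simp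
      then have nc: "n c = t *\<^sub>R n b + (1 - t) *\<^sub>R n a" by (simp add: algebra_simps)
      have "c = h c *\<^sub>R n c" using xn abc by blast
      also have "\<dots> \<in> span {a, b}"
        unfolding nc unfolding n_def
        by (intro span_scale span_add) (auto intro: span_base)
      finally show "c \<in> span {a, b}" .
    next
      assume "c \<in> span {a, b}"
      then obtain \<alpha> \<beta> where "c = \<alpha> *\<^sub>R a + \<beta> *\<^sub>R b" unfolding in_span_pair by blast
      then have "n c = (1 / h c) *\<^sub>R (\<alpha> *\<^sub>R (h a *\<^sub>R n a) + \<beta> *\<^sub>R (h b *\<^sub>R n b))"
        using xn abc unfolding n_def[of c] by metis
      then obtain p q where pq: "n c = p *\<^sub>R n a + q *\<^sub>R n b"
        by (metis scaleR_add_right scaleR_scaleR)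
      have "1 = p + q"
        using arg_cong[OF pq, of h] hn abc by (simp add: linear_add[OF h(1)] linear_cmul[OF h(1)])
      then have p: "p = 1 - q" by simp
      have d: "n c - n a = q *\<^sub>R (n b - n a)" unfolding pq p by (simp add: algebra_simps)
      have "f (n c) - f (n a) = q * (f (n b) - f (n a))"
        using arg_cong[OF d, of f] by (simp add: linear_diff[OF f(1)] linear_cmul[OF f(1)])
      then show "z a b c = 0" unfolding z_def d by simp
    qed
    finally show ?thesis .
  qed
  ultimately show ?thesis by blast
qed

text \<open>Both alternatives depend only on which triples are collinear, and the generic projection
  preserves that in both directions.\<close>

lemma weak_dirac:
  fixes B :: "'v::real_vector set"
  assumes B: "nonparallel B" "2 \<le> card B"
  shows "(\<exists>a\<in>B. \<exists>b\<in>B. a \<noteq> b \<and> 1 / 10 ^ 26 * real (card B) \<le> real (card (B \<inter> span {a, b})))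
    \<or> (\<exists>a\<in>B. 1 / 10 ^ 26 * real (card B) \<le> real (card ((\<lambda>b. B \<inter> span {a, b}) ` (B - {a}))))"
proof -
  obtain \<psi> :: "'v \<Rightarrow> point" where inj: "inj_on (fst \<circ> \<psi>) B"
    and col: "\<And>a b c. a \<in> B \<Longrightarrow> b \<in> B \<Longrightarrow> c \<in> B \<Longrightarrow> a \<noteq> b \<Longrightarrow>
       (snd (\<psi> c) = height (\<psi> a, \<psi> b) (fst (\<psi> c)) \<longleftrightarrow> c \<in> span {a, b})"
    using generic_plane_projection[OF B(1)] by blast
  have inj\<psi>: "inj_on \<psi> B" using inj by (rule inj_on_imageI2)
  define P where "P = \<psi> ` B"
  have cP: "card P = card B" using inj\<psi> by (simp add: P_def card_image)
  have fB: "finite B" using B by (simp add: nonparallel_def)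
  have line: "line_pts P (\<psi> a) (\<psi> b) = \<psi> ` (B \<inter> span {a, b})" if "a \<in> B" "b \<in> B" "a \<noteq> b" for a b
    using col[OF that(1,2) _ that(3)] unfolding line_pts_def P_def by blast
  have "finite P" "inj_on fst P" using fB inj by (auto simp: P_def inj_on_imageI)
  from planar_weak_dirac[OF this] B(2) cP consider
      (a) p q where "p \<in> P" "q \<in> P" "p \<noteq> q" "1 / 10 ^ 26 * real (card B) \<le> real (card (line_pts P p q))"
    | (b) p where "p \<in> P" "1 / 10 ^ 26 * real (card B) \<le> real (card (line_pts P p ` (P - {p})))"
    by auto
  then show ?thesis
  proof cases
    case a
    then obtain x y where xy: "x \<in> B" "y \<in> B" "p = \<psi> x" "q = \<psi> y" by (auto simp: P_def)
    then have "x \<noteq> y" using a by auto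
    moreover have "card (line_pts P p q) = card (B \<inter> span {x, y})"
      unfolding xy(3,4) line[OF xy(1,2) \<open>x \<noteq> y\<close>]
      using inj\<psi> by (intro card_image) (auto intro: inj_on_subset)
    ultimately show ?thesis using a xy by auto
  next
    case b
    then obtain x where x: "x \<in> B" "p = \<psi> x" by (auto simp: P_def)
    have "P - {p} = \<psi> ` (B - {x})"
      using inj\<psi> x unfolding P_def by (auto simp: inj_on_def)
    then have "line_pts P p ` (P - {p}) = (\<lambda>b. line_pts P (\<psi> x) (\<psi> b)) ` (B - {x})"
      using x by (simp add: image_image)
    also have "\<dots> = (\<lambda>b. \<psi> ` (B \<inter> span {x, b})) ` (B - {x})"
      using line x by (intro image_cong) auto
    also have "\<dots> = image \<psi> ` (\<lambda>b. B \<inter> span {x, b}) ` (B - {x})"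
      by (simp add: image_image)
    finally have "card (line_pts P p ` (P - {p})) \<le> card ((\<lambda>b. B \<inter> span {x, b}) ` (B - {x}))"
      using fB by (simp add: card_image_le)
    then show ?thesis using b x by force
  qed
qed

section \<open>Sets blocking all hyperplanes\<close>

lemma dim_mono_finite:
  fixes W :: "'v::real_vector set"
  assumes "V \<subseteq> span W" "finite W"
  shows "dim V \<le> dim W"
proof -
  obtain C where C: "C \<subseteq> W" "independent C" "W \<subseteq> span C" "card C = dim W"
    by (rule real_vector.basis_exists)
  have "V \<subseteq> span C" using assms(1) C(3) span_minimal[OF C(3) subspace_span] by blast
  moreover have "finite C" using C(1) assms(2) finite_subset by blast
  ultimately have "dim V \<le> card C" by (rule real_vector.dim_le_card)
  then show ?thesis using C(4) by simp
qed

lemma dim_subset_finite: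
  fixes W :: "'v::real_vector set"
  assumes "V \<subseteq> W" "finite W"
  shows "dim V \<le> dim W"
  using dim_mono_finite assms span_superset by (metis order_trans)

lemma dim_insert_new:
  fixes S :: "'v::real_vector set"
  assumes "finite S" "x \<notin> span S"
  shows "dim (insert x S) = Suc (dim S)"
proof -
  obtain C where C: "C \<subseteq> S" "independent C" "S \<subseteq> span C" "card C = dim S"
    by (rule real_vector.basis_exists)
  have fC: "finite C" using C(1) assms(1) finite_subset by blast
  have x: "x \<notin> span C" using assms(2) span_mono[OF C(1)] by blast
  then have "x \<notin> C" using span_base by blast
  have "dim (insert x S) = card (insert x C)"
  proof (rule real_vector.dim_unique)
    show "insert x S \<subseteq> span (insert x C)"
      using C(3) span_mono[of C "insert x C"] span_base[of x "insert x C"] by blast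
    show "independent (insert x C)" using x C(2) by (rule independent_insertI)
  qed (use C in auto)
  then show ?thesis using C(4) fC \<open>x \<notin> C\<close> by simp
qed

lemma dim_insert_le:
  fixes S :: "'v::real_vector set"
  assumes "finite S"
  shows "dim (insert x S) \<le> Suc (dim S)"
proof (cases "x \<in> span S")
  case True
  then have "insert x S \<subseteq> span S" using span_superset by blast
  then show ?thesis using dim_mono_finite assms by (metis le_SucI)
qed (use dim_insert_new assms in fastforce)

lemma span_eq_of_dim_le:
  fixes W :: "'v::real_vector set"
  assumes "finite W" "V \<subseteq> W" "dim W \<le> dim V"
  shows "W \<subseteq> span V"
proof (rule ccontr)
  assume "\<not> ?thesis"
  then obtain w where w: "w \<in> W" "w \<notin> span V" by blast
  have "finite V" using assms finite_subset by blast
  then have "Suc (dim V) = dim (insert w V)" using dim_insert_new w by metis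
  also have "insert w V \<subseteq> W" using w assms by blast
  then have "insert w V \<subseteq> span W" using span_superset by blast
  then have "dim (insert w V) \<le> dim W" using dim_mono_finite assms(1) by blast
  finally show False using assms(3) by simp
qed

lemma dim_empty_set: "dim ({} :: 'v::real_vector set) = 0"
  using real_vector.dim_eq_card_independent[OF real_vector.independent_empty] by simp

section \<open>Projection from a point, and induction on the rank\<close>

lemma projection_along_vector:
  fixes a :: "'v::real_vector"
  assumes "a \<noteq> 0"
  shows "\<exists>\<pi>::'v \<Rightarrow> 'v. linear \<pi> \<and> \<pi> a = 0 \<and> (\<forall>x. x - \<pi> x \<in> span {a}) \<and>
     (\<forall>S. finite S \<longrightarrow> dim (insert a S) = Suc (dim (\<pi> ` S)))"
proof -
  have "independent {a}" using assms by simp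
  then obtain h :: "'v \<Rightarrow> real" where h: "linear h" "h a = 1"
    using linear_independent_extend[of "{a}" "\<lambda>_. 1::real"] by auto
  \<comment> \<open>Projection along \<open>a\<close> onto the kernel of \<open>h\<close>. As
    \<open>a\<close> is outside that kernel, adding it to an image raises the dimension by exactly
    one.\<close>
  define \<pi> where "\<pi> x = x - h x *\<^sub>R a" for x
  have lin: "linear \<pi>"
    by (rule linearI) (simp_all add: \<pi>_def linear_add[OF h(1)] linear_cmul[OF h(1)] algebra_simps)
  have \<pi>a: "\<pi> a = 0" by (simp add: \<pi>_def h)
  have d: "x - \<pi> x \<in> span {a}" for x by (simp add: \<pi>_def span_scale span_base)
  have "dim (insert a S) = Suc (dim (\<pi> ` S))" if S: "finite S" for S
  proof -
    have "span (\<pi> ` S) \<subseteq> {x. h x = 0}"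
      by (rule span_minimal)
         (auto simp: \<pi>_def linear_diff[OF h(1)] linear_cmul[OF h(1)] h(2) intro: real_vector.linear_subspace_kernel[OF h(1)])
    then have "a \<notin> span (\<pi> ` S)" using h(2) by auto
    then have 1: "dim (insert a (\<pi> ` S)) = Suc (dim (\<pi> ` S))"
      using S by (intro dim_insert_new) auto
    have "\<pi> x \<in> span (insert a S)" if "x \<in> S" for x
      unfolding \<pi>_def using that by (intro span_diff span_scale) (auto intro: span_base)
    then have 2: "dim (insert a (\<pi> ` S)) \<le> dim (insert a S)"
      using S by (intro dim_mono_finite) (auto intro: span_base)
    have "x \<in> span (insert a (\<pi> ` S))" if "x \<in> S" for x
    proof -
      have "\<pi> x + h x *\<^sub>R a \<in> span (insert a (\<pi> ` S))"
        using that by (intro span_add span_scale) (auto intro: span_base)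
      then show ?thesis by (simp add: \<pi>_def)
    qed
    then have "dim (insert a S) \<le> dim (insert a (\<pi> ` S))"
      using S by (intro dim_mono_finite) (auto intro: span_base)
    then show ?thesis using 1 2 by simp
  qed
  then show ?thesis using lin \<pi>a d by blast
qed

text \<open>\<open>R\<close> may contain parallel vectors and vectors outside the span of
  \<open>B\<close>, since it will be a projected image of red points. The condition
  \<open>0 \<notin> R\<close> matters: zero lies in every span and would block everything.\<close>

definition blocks :: "'v::real_vector set \<Rightarrow> 'v set \<Rightarrow> bool" where
  "blocks R B \<longleftrightarrow> finite R \<and> 0 \<notin> R \<and> (\<forall>A\<subseteq>B. Suc (dim A) = dim B \<longrightarrow> R \<inter> span A \<noteq> {})"

text \<open>Distinct projective points have no common nonzero multiple, so a choice of parallel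
  vectors is injective.\<close>

lemma card_parallel_le:
  assumes "nonparallel B" "finite R" "0 \<notin> R" "\<And>x. x \<in> B \<Longrightarrow> \<exists>r\<in>R. r \<in> span {x}"
  shows "card B \<le> card R"
proof -
  from assms(4) obtain r where r: "\<And>x. x \<in> B \<Longrightarrow> r x \<in> R \<and> r x \<in> span {x}" by metis
  have "inj_on r B"
  proof (rule inj_onI, rule ccontr)
    fix x y assume xy: "x \<in> B" "y \<in> B" "r x = r y" "x \<noteq> y"
    have "r y \<noteq> 0" using r[OF xy(2)] assms(3) by auto
    obtain \<alpha> where \<alpha>: "r x = \<alpha> *\<^sub>R x" using r[OF xy(1)] unfolding span_singleton by blast
    obtain \<beta> where \<beta>: "r y = \<beta> *\<^sub>R y" using r[OF xy(2)] unfolding span_singleton by blast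
    have "\<beta> \<noteq> 0" using \<beta> \<open>r y \<noteq> 0\<close> by auto
    then have "y = (1 / \<beta>) *\<^sub>R r y" using \<beta> by simp
    also have "\<dots> = (\<alpha> / \<beta>) *\<^sub>R x" using \<alpha> xy(3) by simp
    finally have "y \<in> span {x}" by (metis span_base span_scale singletonI)
    then show False using assms(1) xy unfolding nonparallel_def by blast
  qed
  then show ?thesis using r assms(2) by (intro card_inj_on_le[of r]) auto
qed

text \<open>In rank 2 the hyperplanes are the points themselves. In the step the constant collects
  the losses: 1/2 for discarding points that are also red, \<epsilon> from
  \<open>weak_dirac\<close>, and \<open>c\<close> from the induction hypothesis. Whenever the points
  kept fail to span, they are themselves the large subset of smaller dimension.\<close>

lemma blocking_dichotomy:
  assumes "2 \<le> j"
  shows "\<exists>c>0. \<forall>B R. nonparallel (B :: 'v::real_vector set) \<and> dim B = j \<and> blocks R B \<longrightarrow>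
     c * real (card B) \<le> real (card R) \<or> (\<exists>A\<subseteq>B. dim A < j \<and> c * real (card B) \<le> real (card A))"
  using assms
proof (induction j rule: nat_induct_at_least)
  case base
  show ?case
  proof (intro exI[of _ 1] conjI allI impI, simp)
    fix B R :: "'v set" assume BR: "nonparallel B \<and> dim B = 2 \<and> blocks R B"
    have B: "finite B" "0 \<notin> B"
      using BR by (auto simp: nonparallel_def)
    have "\<exists>r\<in>R. r \<in> span {x}" if "x \<in> B" for x
    proof -
      have "x \<noteq> 0" using B(2) that by auto
      then have "dim {x} = 1"
        using real_vector.dim_eq_card_independent[of "{x}"] by simp
      then have "Suc (dim {x}) = dim B" "{x} \<subseteq> B" using BR that by auto
      then have "R \<inter> span {x} \<noteq> {}" using BR unfolding blocks_def by blast
      then show ?thesis by blast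
    qed
    then have "card B \<le> card R"
      using BR by (intro card_parallel_le) (auto simp: blocks_def)
    then show "1 * real (card B) \<le> real (card R) \<or> (\<exists>A\<subseteq>B. dim A < 2 \<and> 1 * real (card B) \<le> real (card A))"
      by simp
  qed
next
  case (Suc i)
  then obtain c where c: "c > 0" and IH: "\<And>B R. nonparallel (B :: 'v set) \<Longrightarrow> dim B = i \<Longrightarrow> blocks R B \<Longrightarrow>
     c * real (card B) \<le> real (card R) \<or> (\<exists>A\<subseteq>B. dim A < i \<and> c * real (card B) \<le> real (card A))"
    by blast
  define \<epsilon> :: real where "\<epsilon> = 1 / 10 ^ 26"
  define k where "k = min (\<epsilon> / 2) (c * \<epsilon> / 2)"
  have \<epsilon>: "0 < \<epsilon>" "\<epsilon> < 1" by (simp_all add: \<epsilon>_def)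
  have k: "0 < k" "k \<le> \<epsilon> / 2" "k \<le> c * \<epsilon> / 2" using \<epsilon> c by (simp_all add: k_def)
  show ?case
  proof (intro exI[of _ k] conjI allI impI)
    fix B R :: "'v set" assume "nonparallel B \<and> dim B = Suc i \<and> blocks R B"
    then have npB: "nonparallel B" and dB: "dim B = Suc i" and bl: "blocks R B" by auto
    let ?goal = "k * real (card B) \<le> real (card R) \<or> (\<exists>A\<subseteq>B. dim A < Suc i \<and> k * real (card B) \<le> real (card A))"
    have fB: "finite B" and B0: "0 \<notin> B" using npB by (auto simp: nonparallel_def)
    have fR: "finite R" and R0: "0 \<notin> R" using bl by (auto simp: blocks_def)
    \<comment> \<open>The centre of projection must come from this set: a red vector parallel to the
      centre would be mapped to zero.\<close>
    define C where "C = {x \<in> B. R \<inter> span {x} = {}}"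
    have C: "C \<subseteq> B" "finite C" using fB by (auto simp: C_def)
    then have npC: "nonparallel C" using npB nonparallel_subset by blast
    have BC: "card (B - C) \<le> card R"
      using nonparallel_subset[OF npB, of "B - C"] fR R0
      by (intro card_parallel_le) (auto simp: C_def)
    have cB: "card B = card C + card (B - C)"
      using C fB by (simp add: card_Diff_subset card_mono)
    have kB: "k * real (card B) \<le> 1 / 2 * real (card B)"
      using k \<epsilon> by (intro mult_right_mono) auto
    show ?goal
    proof (cases "card B \<le> 2 * card (B - C)")
      case True
      then have "1 / 2 * real (card B) \<le> real (card R)" using BC by simp
      then show ?thesis using kB by linarith
    next
      case False
      then have half: "1 / 2 * real (card B) \<le> real (card C)" using cB by simp
      have \<epsilon>C: "\<epsilon> / 2 * real (card B) \<le> \<epsilon> * real (card C)"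
        using mult_left_mono[OF half, of \<epsilon>] \<epsilon> by simp
      have k\<epsilon>: "k * real (card B) \<le> \<epsilon> / 2 * real (card B)"
        using k by (intro mult_right_mono) auto
      show ?thesis
      proof (cases "dim C < Suc i")
        case True
        then show ?thesis using C half kB by (intro disjI2 exI[of _ C]) auto
      next
        case dC: False
        have "dim C \<le> card C" using C(2) by (intro real_vector.dim_le_card) (auto intro: span_base)
        then have "2 \<le> card C" using dC \<open>2 \<le> i\<close> by simp
        from weak_dirac[OF npC this, folded \<epsilon>_def] consider
            (line) a b where "a \<in> C" "b \<in> C" "\<epsilon> * real (card C) \<le> real (card (C \<inter> span {a, b}))"
          | (point) a where "a \<in> C" "\<epsilon> * real (card C) \<le> real (card ((\<lambda>b. C \<inter> span {a, b}) ` (C - {a})))"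
          by blast
        then show ?thesis
        proof cases
          case line
          have "dim (C \<inter> span {a, b}) \<le> card {a, b}" by (intro real_vector.dim_le_card) auto
          also have "\<dots> < Suc i" using \<open>2 \<le> i\<close> by (simp add: card_insert_if)
          finally show ?thesis
            using line(3) C(1) \<epsilon>C k\<epsilon> by (intro disjI2 exI[of _ "C \<inter> span {a, b}"]) auto
        next
          case point
          let ?ln = "\<lambda>b. C \<inter> span {a, b}"
          \<comment> \<open>One point on each connecting line through \<open>a\<close>, so that the
            projections are pairwise nonparallel.\<close>
          obtain Q where Q: "Q \<subseteq> C - {a}" "inj_on ?ln Q" "?ln ` (C - {a}) = ?ln ` Q"
            using subset_image_inj[of "?ln ` (C - {a})" ?ln "C - {a}"] by auto
          have cQ: "\<epsilon> * real (card C) \<le> real (card Q)"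
            using point(2) Q by (simp add: card_image)
          have fQ: "finite Q" using Q(1) C(2) finite_subset by blast
          have aC: "a \<in> C" "a \<in> B" "a \<noteq> 0" using point(1) C(1) B0 by auto
          have QB: "Q \<subseteq> B" "insert a Q \<subseteq> B" using Q(1) C(1) aC by auto
          have notin: "y \<notin> span {a}" if "y \<in> Q" for y
          proof -
            have "y \<in> B" "a \<noteq> y" using that Q(1) QB(1) by auto
            then show ?thesis using npB aC(2) unfolding nonparallel_def by simp
          qed
          obtain \<pi> :: "'v \<Rightarrow> 'v" where \<pi>: "linear \<pi>" "\<pi> a = 0" "\<And>x. x - \<pi> x \<in> span {a}"
            "\<And>S. finite S \<Longrightarrow> dim (insert a S) = Suc (dim (\<pi> ` S))"
            using projection_along_vector[OF aC(3)] by blast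
          have in_line: "y \<in> span {a, x}" if "\<pi> y \<in> span {\<pi> x}" for x y
          proof -
            have "\<pi> x \<in> span {a, x}"
              using span_diff[of x "{a, x}" "x - \<pi> x"] \<pi>(3)[of x] span_mono[of "{a}" "{a, x}"]
              by (auto intro: span_base)
            then have "span {\<pi> x} \<subseteq> span {a, x}" by (intro span_minimal) auto
            then have "\<pi> y \<in> span {a, x}" using that by blast
            moreover have "y - \<pi> y \<in> span {a, x}" using \<pi>(3)[of y] span_mono[of "{a}" "{a, x}"] by blast
            ultimately show ?thesis using span_add[of "\<pi> y" "{a, x}" "y - \<pi> y"] by simp
          qed
          have \<pi>0: "y \<in> span {a}" if "\<pi> y = 0" for y using \<pi>(3)[of y] that by simp
          have same_line: "x = y" if "x \<in> Q" "y \<in> Q" "\<pi> y \<in> span {\<pi> x}" for x y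
          proof -
            have "y \<in> span {a, x}" using in_line that(3) .
            moreover have "y \<notin> span {a}" using notin that(2) .
            ultimately have "x \<in> span {a, y}"
              using in_span_insert[of y x "{a}"] by (simp add: insert_commute)
            then have "span {a, x} = span {a, y}"
              using \<open>y \<in> span {a, x}\<close> by (intro equalityI span_minimal) (auto intro: span_base)
            then show ?thesis using inj_onD[OF Q(2), of x y] that(1,2) by simp
          qed
          have inj\<pi>: "inj_on \<pi> Q"
            using same_line by (auto simp: inj_on_def intro: span_base)
          define B' where "B' = \<pi> ` Q"
          have cB': "card B' = card Q" using inj\<pi> by (simp add: B'_def card_image)
          have npB': "nonparallel B'"
            unfolding nonparallel_def
          proof (intro conjI ballI impI)
            show "finite B'" using fQ by (simp add: B'_def)
            show "0 \<notin> B'"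
            proof
              assume "0 \<in> B'"
              then obtain x where x: "x \<in> Q" "\<pi> x = 0" by (auto simp: B'_def)
              then show False using \<pi>0[of x] notin[of x] by blast
            qed
          qed (use same_line in \<open>auto simp: B'_def\<close>)
          have dQ: "dim (insert a Q) = Suc (dim B')" using \<pi>(4)[OF fQ] by (simp add: B'_def)
          show ?thesis
          proof (cases "dim (insert a Q) < Suc i")
            case True
            have "dim Q \<le> dim (insert a Q)"
              using fQ by (intro dim_mono_finite) (auto intro: span_base)
            then have "dim Q < Suc i" using True by simp
            then show ?thesis
              using cQ QB \<epsilon>C k\<epsilon> by (intro disjI2 exI[of _ Q]) auto
          next
            case False
            have "dim (insert a Q) \<le> dim B"
              using QB(2) fB by (intro dim_mono_finite) (auto intro: span_base)
            then have dB': "dim B' = i" using False dQ dB by simp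
            \<comment> \<open>A lift of a hyperplane of \<open>B'\<close>, together with
              \<open>a\<close>, spans a hyperplane of \<open>B\<close>, and the red vector there
              projects into the given hyperplane.\<close>
            have "blocks (\<pi> ` R) B'"
              unfolding blocks_def
            proof (intro conjI allI impI)
              show "finite (\<pi> ` R)" using fR by simp
              show "0 \<notin> \<pi> ` R"
              proof
                assume "0 \<in> \<pi> ` R"
                then obtain r where "r \<in> R" "\<pi> r = 0" by auto
                then show False using \<pi>0[of r] aC(1) by (auto simp: C_def)
              qed
              fix A' assume A': "A' \<subseteq> B'" "Suc (dim A') = dim B'"
              then obtain Q1 where Q1: "Q1 \<subseteq> Q" "A' = \<pi> ` Q1" unfolding B'_def by (meson subset_imageE)
              have "finite Q1" using Q1 fQ finite_subset by blast
              then have "dim (insert a Q1) = Suc (dim A')" using \<pi>(4) Q1(2) by simp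
              then have "Suc (dim (insert a Q1)) = dim B" using A' dB dB' by simp
              moreover have "insert a Q1 \<subseteq> B" using Q1 QB by blast
              ultimately obtain r where r: "r \<in> R" "r \<in> span (insert a Q1)"
                using bl unfolding blocks_def by blast
              have "\<pi> r \<in> \<pi> ` span (insert a Q1)" using r by blast
              also have "\<dots> = span (insert 0 A')"
                using linear_span_image[OF \<pi>(1), of "insert a Q1"] \<pi>(2) Q1(2) by simp
              finally show "\<pi> ` R \<inter> span A' \<noteq> {}" using r(1) by auto
            qed
            from IH[OF npB' dB' this] show ?thesis
            proof
              assume "c * real (card B') \<le> real (card (\<pi> ` R))"
              moreover have "card (\<pi> ` R) \<le> card R" using fR by (rule card_image_le)
              moreover have "c * (\<epsilon> / 2 * real (card B)) \<le> c * real (card B')"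
                using cQ cB' \<epsilon>C c by (intro mult_left_mono) auto
              moreover have "k * real (card B) \<le> c * \<epsilon> / 2 * real (card B)"
                using k by (intro mult_right_mono) auto
              ultimately show ?thesis by simp
            next
              assume "\<exists>A\<subseteq>B'. dim A < i \<and> c * real (card B') \<le> real (card A)"
              then obtain A' where A': "A' \<subseteq> B'" "dim A' < i" "c * real (card B') \<le> real (card A')" by blast
              \<comment> \<open>Lifting a subset of dimension below \<open>i\<close> gains at most
                the one dimension of \<open>a\<close>, so the lift stays below
                \<open>Suc i\<close>.\<close>
              then obtain Q1 where Q1: "Q1 \<subseteq> Q" "A' = \<pi> ` Q1" unfolding B'_def by (meson subset_imageE)
              have fQ1: "finite Q1" using Q1 fQ finite_subset by blast
              then have "dim (insert a Q1) = Suc (dim A')" using \<pi>(4) Q1(2) by simp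
              moreover have "dim Q1 \<le> dim (insert a Q1)"
                using fQ1 by (intro dim_mono_finite) (auto intro: span_base)
              ultimately have "dim Q1 < Suc i" using A'(2) by simp
              moreover have "card A' \<le> card Q1" using Q1 fQ1 card_image_le by blast
              moreover have "c * (\<epsilon> / 2 * real (card B)) \<le> c * real (card B')"
                using cQ cB' \<epsilon>C c by (intro mult_left_mono) auto
              moreover have "k * real (card B) \<le> c * \<epsilon> / 2 * real (card B)"
                using k by (intro mult_right_mono) auto
              ultimately show ?thesis
                using A'(3) Q1(1) QB(1) by (intro disjI2 exI[of _ Q1]) auto
            qed
          qed
        qed
      qed
    qed
  qed (rule k(1))
qed

text \<open>If \<open>B\<close> does not serve as \<open>A\<close>, the dichotomy gives a large
  subset of smaller dimension, and this can be repeated. \<open>A\<close> comes before the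
  quantifier over \<open>R\<close> because the blocking set used later is built only after
  \<open>A\<close> is known. The case \<open>dim A < 2\<close> concerns at most one point and is
  treated there.\<close>

lemma linearly_blocked_subset_exists:
  "\<exists>c>0. \<forall>B. nonparallel (B :: 'v::real_vector set) \<and> dim B \<le> j \<longrightarrow>
     (\<exists>A\<subseteq>B. c * real (card B) \<le> real (card A) \<and>
        (2 \<le> dim A \<longrightarrow> (\<forall>R. blocks R A \<longrightarrow> c * real (card A) \<le> real (card R))))"
proof (induction j)
  case 0
  show ?case
  proof (intro exI[of _ 1] conjI allI impI)
    fix B :: "'v set" assume "nonparallel B \<and> dim B \<le> 0"
    then show "\<exists>A\<subseteq>B. 1 * real (card B) \<le> real (card A) \<and>
        (2 \<le> dim A \<longrightarrow> (\<forall>R. blocks R A \<longrightarrow> 1 * real (card A) \<le> real (card R)))"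
      by (intro exI[of _ B]) simp
  qed simp
next
  case (Suc j)
  then obtain c where c: "c > 0" and IH: "\<And>B. nonparallel (B :: 'v set) \<Longrightarrow> dim B \<le> j \<Longrightarrow>
     \<exists>A\<subseteq>B. c * real (card B) \<le> real (card A) \<and>
        (2 \<le> dim A \<longrightarrow> (\<forall>R. blocks R A \<longrightarrow> c * real (card A) \<le> real (card R)))"
    by blast
  show ?case
  proof (cases "2 \<le> Suc j")
    case False
    show ?thesis
    proof (intro exI[of _ 1] conjI allI impI)
      fix B :: "'v set" assume "nonparallel B \<and> dim B \<le> Suc j"
      then show "\<exists>A\<subseteq>B. 1 * real (card B) \<le> real (card A) \<and>
          (2 \<le> dim A \<longrightarrow> (\<forall>R. blocks R A \<longrightarrow> 1 * real (card A) \<le> real (card R)))"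
        using False by (intro exI[of _ B]) simp
    qed simp
  next
    case True
    from blocking_dichotomy[OF this] obtain d where d: "d > 0" and
      D: "\<And>B R. nonparallel (B :: 'v set) \<Longrightarrow> dim B = Suc j \<Longrightarrow> blocks R B \<Longrightarrow>
       d * real (card B) \<le> real (card R) \<or> (\<exists>A\<subseteq>B. dim A < Suc j \<and> d * real (card B) \<le> real (card A))"
      by blast
    \<comment> \<open>The bounds \<open>c\<close> and \<open>d\<close> cover the cases where the
      induction hypothesis or \<open>B\<close> itself suffices; \<open>c * d\<close> pays for one
      descent followed by the induction hypothesis; 1 allows \<open>A = B\<close>.\<close>
    define m where "m = min 1 (min c (min d (c * d)))"
    have m: "m > 0" "m \<le> 1" "m \<le> c" "m \<le> d" "m \<le> c * d" using c d by (auto simp: m_def)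
    have le: "m * real x \<le> e * real x" if "m \<le> e" for x :: nat and e
      using that by (intro mult_right_mono) auto
    show ?thesis
    proof (intro exI[of _ m] conjI allI impI)
      fix B :: "'v set" assume B: "nonparallel B \<and> dim B \<le> Suc j"
      show "\<exists>A\<subseteq>B. m * real (card B) \<le> real (card A) \<and>
        (2 \<le> dim A \<longrightarrow> (\<forall>R. blocks R A \<longrightarrow> m * real (card A) \<le> real (card R)))" (is ?G)
      proof -
        have small: ?G if A0: "A0 \<subseteq> B" "dim A0 \<le> j" "m * real (card B) \<le> c * real (card A0)" for A0
        proof -
          obtain A where A: "A \<subseteq> A0" "c * real (card A0) \<le> real (card A)"
            "2 \<le> dim A \<longrightarrow> (\<forall>R. blocks R A \<longrightarrow> c * real (card A) \<le> real (card R))"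
            using IH[of A0] A0 B nonparallel_subset by blast
          show ?thesis
            using A A0 le[OF m(3)] by (intro exI[of _ A]) (meson order_trans)
        qed
        show ?G
        proof (cases "dim B \<le> j")
          case True
          then show ?thesis using small[of B] le[OF m(3)] by blast
        next
          case False
          then have dB: "dim B = Suc j" using B by simp
          show ?thesis
          proof (cases "\<forall>R. blocks R B \<longrightarrow> d * real (card B) \<le> real (card R)")
            case True
            then show ?thesis
              using le[OF m(4)] le[OF m(2)] by (intro exI[of _ B]) (simp, meson order_trans)
          next
            case False
            then obtain A0 where A0: "A0 \<subseteq> B" "dim A0 < Suc j" "d * real (card B) \<le> real (card A0)"
              using D[of B] B dB by blast
            have "m * real (card B) \<le> c * (d * real (card B))"
              using le[OF m(5), of "card B"] by (simp add: mult.assoc)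
            also have "\<dots> \<le> c * real (card A0)" using A0(3) c by (intro mult_left_mono) auto
            finally show ?thesis using small[of A0] A0 by simp
          qed
        qed
      qed
    qed (rule m(1))
  qed
qed

section \<open>Matroids represented by vectors\<close>

text \<open>Matrix columns form an indexed family in which equal columns are dependent, while
  \<open>independent\<close> speaks of a set. Injectivity is the difference: equal vectors are
  exposed by the coefficients 1 and -1.\<close>

lemma independent_family_iff:
  fixes \<phi> :: "'a \<Rightarrow> 'v::real_vector"
  assumes "finite X"
  shows "(\<forall>c. (\<Sum>x\<in>X. c x *\<^sub>R \<phi> x) = 0 \<longrightarrow> (\<forall>x\<in>X. c x = 0)) \<longleftrightarrow> inj_on \<phi> X \<and> independent (\<phi> ` X)"
proof
  assume L: "\<forall>c. (\<Sum>x\<in>X. c x *\<^sub>R \<phi> x) = 0 \<longrightarrow> (\<forall>x\<in>X. c x = 0)"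
  have inj: "inj_on \<phi> X"
  proof (rule inj_onI, rule ccontr)
    fix x y assume xy: "x \<in> X" "y \<in> X" "\<phi> x = \<phi> y" "x \<noteq> y"
    define c where "c z = (if z = x then 1 else if z = y then -1 else 0 :: real)" for z
    have "(\<Sum>z\<in>X. c z *\<^sub>R \<phi> z) = (\<Sum>z\<in>{x, y}. c z *\<^sub>R \<phi> z)"
      using assms xy by (intro sum.mono_neutral_right) (auto simp: c_def)
    also have "\<dots> = 0" using xy by (simp add: c_def)
    finally have "c x = 0" using L xy(1) by blast
    then show False by (simp add: c_def)
  qed
  have "independent (\<phi> ` X)"
  proof
    assume "dependent (\<phi> ` X)"
    then obtain u where u: "\<exists>v\<in>\<phi> ` X. u v \<noteq> 0" "(\<Sum>v\<in>\<phi> ` X. u v *\<^sub>R v) = 0"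
      using real_vector.dependent_finite[of "\<phi> ` X"] assms by auto
    have "(\<Sum>x\<in>X. u (\<phi> x) *\<^sub>R \<phi> x) = 0" using u(2) inj by (simp add: sum.reindex)
    then have "\<forall>x\<in>X. u (\<phi> x) = 0" using L[rule_format, of "\<lambda>x. u (\<phi> x)"] by blast
    then show False using u(1) by blast
  qed
  then show "inj_on \<phi> X \<and> independent (\<phi> ` X)" using inj by blast
next
  assume R: "inj_on \<phi> X \<and> independent (\<phi> ` X)"
  show "\<forall>c. (\<Sum>x\<in>X. c x *\<^sub>R \<phi> x) = 0 \<longrightarrow> (\<forall>x\<in>X. c x = 0)"
  proof (intro allI impI ballI)
    fix c x assume c: "(\<Sum>x\<in>X. c x *\<^sub>R \<phi> x) = 0" and x: "x \<in> X"
    define u where "u v = c (the_inv_into X \<phi> v)" for v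
    have "(\<Sum>v\<in>\<phi> ` X. u v *\<^sub>R v) = (\<Sum>x\<in>X. c x *\<^sub>R \<phi> x)"
      using R by (auto simp: sum.reindex u_def the_inv_into_f_f intro!: sum.cong)
    then have s: "(\<Sum>v\<in>\<phi> ` X. u v *\<^sub>R v) = 0" using c by simp
    have "u (\<phi> x) = 0"
    proof (rule ccontr)
      assume "u (\<phi> x) \<noteq> 0"
      then have "dependent (\<phi> ` X)"
        using real_vector.dependent_finite[of "\<phi> ` X"] assms s x by blast
      then show False using R by blast
    qed
    then show "c x = 0" using R x by (simp add: u_def the_inv_into_f_f)
  qed
qed

lemma lookup_scaleR:
  fixes x :: "'a \<Rightarrow>\<^sub>0 'b::real_vector"
  shows "Poly_Mapping.lookup (r *\<^sub>R x) i = r *\<^sub>R Poly_Mapping.lookup x i"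
proof -
  have "finite {i. r *\<^sub>R Poly_Mapping.lookup x i \<noteq> 0}"
    by (rule finite_subset[OF _ finite_keys[of x]]) (auto simp: in_keys_iff)
  then show ?thesis by (simp add: scaleR_poly_mapping_def)
qed

text \<open>Columns become finitely supported sequences, so that matrices with any number of rows
  live in one real vector space.\<close>

lemma independent_columns_iff:
  fixes v :: "'a \<Rightarrow> nat \<Rightarrow> real" and \<phi> :: "'a \<Rightarrow> nat \<Rightarrow>\<^sub>0 real"
  assumes "finite X" and \<phi>: "\<And>x i. x \<in> X \<Longrightarrow> Poly_Mapping.lookup (\<phi> x) i = (if i < d then v x i else 0)"
  shows "(\<forall>c :: 'a \<Rightarrow> real. (\<forall>i<d. (\<Sum>x\<in>X. c x * v x i) = 0) \<longrightarrow> (\<forall>x\<in>X. c x = 0))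
    \<longleftrightarrow> inj_on \<phi> X \<and> independent (\<phi> ` X)"
proof -
  have "(\<forall>i<d. (\<Sum>x\<in>X. c x * v x i) = 0) \<longleftrightarrow> (\<Sum>x\<in>X. c x *\<^sub>R \<phi> x) = 0" for c :: "'a \<Rightarrow> real"
  proof -
    have "Poly_Mapping.lookup (\<Sum>x\<in>X. c x *\<^sub>R \<phi> x) i = (if i < d then \<Sum>x\<in>X. c x * v x i else 0)" for i
      by (simp add: lookup_sum lookup_scaleR \<phi>)
    then show ?thesis
      by (metis (mono_tags, lifting) lookup_zero poly_mapping_eqI)
  qed
  then show ?thesis using independent_family_iff[OF assms(1), of \<phi>] by simp
qed

section \<open>Rank, flats and closure expressed by vectors\<close>

locale vector_matroid = matroid E indep for E :: "'a set" and indep +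
  fixes \<phi> :: "'a \<Rightarrow> 'v::real_vector"
  assumes indep_iff: "X \<subseteq> E \<Longrightarrow> indep X \<longleftrightarrow> inj_on \<phi> X \<and> independent (\<phi> ` X)"
begin

lemma rank_eq_dim:
  assumes "X \<subseteq> E"
  shows "rank X = dim (\<phi> ` X)"
  unfolding rank_def
proof (rule Max_eqI)
  have fX: "finite X" using assms finite_ground finite_subset by blast
  have "{I. I \<subseteq> X \<and> indep I} \<subseteq> Pow X" by blast
  then show "finite (card ` {I. I \<subseteq> X \<and> indep I})" using fX finite_subset by blast
  fix y assume "y \<in> card ` {I. I \<subseteq> X \<and> indep I}"
  then obtain I where I: "I \<subseteq> X" "indep I" "y = card I" by blast
  then have "inj_on \<phi> I" "independent (\<phi> ` I)" using indep_iff[of I] assms by auto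
  then have "y = dim (\<phi> ` I)"
    using I(3) by (simp add: card_image real_vector.dim_eq_card_independent)
  also have "\<dots> \<le> dim (\<phi> ` X)"
    using I(1) fX by (intro dim_mono_finite) (auto intro: span_base)
  finally show "y \<le> dim (\<phi> ` X)" .
next
  obtain C where C: "C \<subseteq> \<phi> ` X" "independent C" "\<phi> ` X \<subseteq> span C" "card C = dim (\<phi> ` X)"
    by (rule real_vector.basis_exists)
  obtain I where I: "I \<subseteq> X" "inj_on \<phi> I" "C = \<phi> ` I"
    using C(1) subset_image_inj[of C \<phi> X] by blast
  have "indep I" using indep_iff[of I] I C(2) assms by simp
  moreover have "card I = dim (\<phi> ` X)" using C(4) I by (simp add: card_image)
  ultimately show "dim (\<phi> ` X) \<in> card ` {I. I \<subseteq> X \<and> indep I}"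
    using I(1) by (intro image_eqI[of _ _ I]) auto
qed

lemma flat_iff: "flat F \<longleftrightarrow> F \<subseteq> E \<and> (\<forall>x\<in>E. \<phi> x \<in> span (\<phi> ` F) \<longrightarrow> x \<in> F)"
proof (cases "F \<subseteq> E")
  case True
  then have fF: "finite (\<phi> ` F)" using finite_ground finite_subset by blast
  have "rank F < rank (insert x F) \<longleftrightarrow> \<phi> x \<notin> span (\<phi> ` F)" if x: "x \<in> E" for x
  proof (cases "\<phi> x \<in> span (\<phi> ` F)")
    case in_span: True
    then have "insert (\<phi> x) (\<phi> ` F) \<subseteq> span (\<phi> ` F)" using span_superset by blast
    then have "dim (insert (\<phi> x) (\<phi> ` F)) \<le> dim (\<phi> ` F)" using dim_mono_finite fF by blast
    then show ?thesis using in_span True x rank_eq_dim[of F] rank_eq_dim[of "insert x F"] by simp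
  next
    case False
    then have "dim (insert (\<phi> x) (\<phi> ` F)) = Suc (dim (\<phi> ` F))" using dim_insert_new fF by blast
    then show ?thesis using False True x rank_eq_dim[of F] rank_eq_dim[of "insert x F"] by simp
  qed
  then show ?thesis unfolding flat_def using True by blast
qed (simp add: flat_def)

definition closure :: "'a set \<Rightarrow> 'a set" where
  "closure X = {x \<in> E. \<phi> x \<in> span (\<phi> ` X)}"

lemma span_closure:
  assumes "X \<subseteq> E"
  shows "span (\<phi> ` closure X) = span (\<phi> ` X)"
proof (intro equalityI span_minimal)
  show "\<phi> ` closure X \<subseteq> span (\<phi> ` X)" by (auto simp: closure_def)
  show "\<phi> ` X \<subseteq> span (\<phi> ` closure X)"
    using assms by (auto simp: closure_def intro!: span_base)
qed auto

lemma flat_closure: "X \<subseteq> E \<Longrightarrow> flat (closure X)"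
  unfolding flat_iff span_closure by (auto simp: closure_def)

lemma rank_closure: "X \<subseteq> E \<Longrightarrow> rank (closure X) = dim (\<phi> ` X)"
  using rank_eq_dim[of "closure X"] span_closure[of X] real_vector.span_eq_dim
  by (metis (no_types, lifting) closure_def mem_Collect_eq subsetI)

lemma vector_matroid_restrict:
  assumes "B \<subseteq> E"
  shows "vector_matroid B (restrict_indep B) \<phi>"
proof -
  interpret M: matroid B "restrict_indep B" by (rule matroid_restrict[OF assms])
  show ?thesis
    by unfold_locales (use indep_iff assms in \<open>auto simp: restrict_indep_def\<close>)
qed

text \<open>\<open>simple\<close> includes the case \<open>x = y\<close>, which excludes zero
  vectors.\<close>

lemma simple_imp:
  assumes simple
  shows "inj_on \<phi> E" "nonparallel (\<phi> ` E)"
proof -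
  have *: "\<phi> x \<noteq> \<phi> y" "\<phi> y \<notin> span {\<phi> x}" if xy: "x \<in> E" "y \<in> E" "x \<noteq> y" for x y
  proof -
    have i: "inj_on \<phi> {x, y}" "independent (\<phi> ` {x, y})"
      using assms xy indep_iff[of "{x, y}"] unfolding simple_def by auto
    then show ne: "\<phi> x \<noteq> \<phi> y" using xy(3) by auto
    have "independent (insert (\<phi> y) {\<phi> x})" using i(2) by (simp add: insert_commute)
    then show "\<phi> y \<notin> span {\<phi> x}"
      using ne by (subst (asm) real_vector.independent_insert) auto
  qed
  show "inj_on \<phi> E" using *(1) by (auto simp: inj_on_def)
  have "\<phi> x \<noteq> 0" if "x \<in> E" for x
    using assms that indep_iff[of "{x}"] unfolding simple_def by force
  then show "nonparallel (\<phi> ` E)"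
    unfolding nonparallel_def using finite_ground *(2) by (auto simp: image_iff)
qed

text \<open>In rank 2 a single blue point, which (C1) supplies, is already a hyperplane without red
  elements.\<close>

lemma no_admissible_colouring_rank_two:
  assumes simple "rank E = 2" "admissible_colouring k R B"
  shows False
proof -
  have B: "R \<union> B = E" "R \<inter> B = {}" "rank B \<ge> 2" and hyp: "\<And>H. hyperplane H \<Longrightarrow> H \<inter> R \<noteq> {}"
    using assms(3) unfolding admissible_colouring_def two_colouring_def by auto
  have "B \<noteq> {}"
  proof
    assume "B = {}"
    then show False using B(3) rank_eq_dim[of "{}"] dim_empty_set[where 'v = 'v] by simp
  qed
  then obtain b where b: "b \<in> B" by blast
  have bE: "b \<in> E" using B b by blast
  have np: "\<phi> b \<noteq> 0" "\<And>x. x \<in> E \<Longrightarrow> x \<noteq> b \<Longrightarrow> \<phi> x \<notin> span {\<phi> b}"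
    using simple_imp[OF assms(1)] bE unfolding nonparallel_def inj_on_def by (metis imageI)+
  have "flat {b}" unfolding flat_iff using bE np(2) by auto
  moreover have "rank {b} = 1"
    using rank_eq_dim[of "{b}"] bE np(1) real_vector.dim_eq_card_independent[of "{\<phi> b}"] by simp
  ultimately have "hyperplane {b}" using assms(2) by (simp add: hyperplane_def)
  then show False using hyp B(2) b by blast
qed

end

section \<open>Projecting the red points along a red-free flat\<close>

lemma dim_Un_le:
  fixes S :: "'v::real_vector set"
  assumes "finite S" "finite T"
  shows "dim (S \<union> T) \<le> dim S + card T"
  using assms(2)
proof (induction T rule: finite_induct)
  case (insert x T)
  then show ?case using dim_insert_le[of "S \<union> T" x] assms(1) by simp
qed simp

text \<open>A basis \<open>C\<close> of \<open>A\<close> is extended by a set \<open>X\<close> of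
  vectors from \<open>F\<close>; \<open>\<pi>\<close> fixes \<open>C\<close> and kills
  \<open>X\<close>. Since \<open>F\<close> may meet the span of \<open>A\<close> nontrivially,
  \<open>X\<close> need not span \<open>F\<close>, but what \<open>\<pi>\<close> kills in the span
  of \<open>A \<union> F\<close> still lies in the span of \<open>F\<close>.\<close>

lemma complement_projection:
  fixes A F :: "'v::real_vector set"
  assumes "finite A" "finite F"
  obtains X \<pi> where "X \<subseteq> F" "linear \<pi>" "\<And>a. a \<in> A \<Longrightarrow> \<pi> a = a" "\<And>x. x \<in> X \<Longrightarrow> \<pi> x = 0"
    "dim (A \<union> F) = dim A + card X" "A \<union> F \<subseteq> span (A \<union> X)"
    "\<And>w. w \<in> span (A \<union> F) \<Longrightarrow> \<pi> w = 0 \<Longrightarrow> w \<in> span X"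
proof -
  obtain C where C: "C \<subseteq> A" "independent C" "A \<subseteq> span C" "card C = dim A"
    by (rule real_vector.basis_exists)
  obtain D where D: "C \<subseteq> D" "D \<subseteq> C \<union> F" "independent D" "C \<union> F \<subseteq> span D"
    using real_vector.maximal_independent_subset_extend[of C "C \<union> F"] C(2) by blast
  define X where "X = D - C"
  have fin: "finite C" "finite D" "finite X"
    using C(1) D(2) assms finite_subset unfolding X_def by (meson finite_UnI finite_Diff)+
  obtain \<pi> :: "'v \<Rightarrow> 'v" where \<pi>: "linear \<pi>" "\<forall>d\<in>D. \<pi> d = (if d \<in> C then d else 0)"
    using linear_independent_extend[OF D(3), of "\<lambda>d. if d \<in> C then d else 0"] by blast
  have "C \<subseteq> span D" using D(4) by blast
  then have AD: "A \<union> F \<subseteq> span D"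
    using C(3) D(4) span_minimal[of C "span D"] by auto
  have fixC: "\<pi> w = w" if "w \<in> span C" for w
  proof (rule linear_eq_on[of \<pi> "\<lambda>x. x" w C])
    show "\<And>b. b \<in> C \<Longrightarrow> \<pi> b = b" using \<pi>(2) D(1) by auto
  qed (use \<pi> that in \<open>auto intro: linear_ident\<close>)
  have diff: "w - \<pi> w \<in> span X" if "w \<in> span D" for w
    using that
  proof (induction rule: span_induct_alt)
    case base
    show ?case using linear_0[OF \<pi>(1)] by (simp add: span_zero)
  next
    case (step c x y)
    have "x - \<pi> x \<in> span X"
      using \<pi>(2) step(1) by (auto simp: X_def span_zero intro: span_base)
    moreover have "c *\<^sub>R x + y - \<pi> (c *\<^sub>R x + y) = c *\<^sub>R (x - \<pi> x) + (y - \<pi> y)"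
      by (simp add: linear_add[OF \<pi>(1)] linear_cmul[OF \<pi>(1)] algebra_simps)
    ultimately show ?case using step(2) by (metis span_add span_scale)
  qed
  have "dim (A \<union> F) = card D"
  proof (rule real_vector.dim_unique)
    show "D \<subseteq> A \<union> F" using D(2) C(1) by blast
  qed (use AD D(3) in auto)
  also have "\<dots> = dim A + card X"
    using C(4) D(1) fin card_mono[OF fin(2) D(1)] by (simp add: X_def card_Diff_subset)
  finally have 1: "dim (A \<union> F) = dim A + card X" .
  have "D \<subseteq> A \<union> X" using C(1) by (auto simp: X_def)
  then have 2: "A \<union> F \<subseteq> span (A \<union> X)" using AD span_mono by blast
  have 3: "w \<in> span X" if "w \<in> span (A \<union> F)" "\<pi> w = 0" for w
    using diff[of w] that span_minimal[OF AD] by auto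
  have 4: "\<pi> x = 0" if "x \<in> X" for x using \<pi>(2) that by (simp add: X_def)
  have 5: "\<pi> x = x" if "x \<in> A" for x using fixC C(3) that by blast
  have "X \<subseteq> F" using D(2) by (auto simp: X_def)
  from that[OF this \<pi>(1) 5 4 1 2 3] show thesis .
qed

context vector_matroid
begin

text \<open>The flat \<open>F\<close> given by (C3) for a blue line \<open>L\<close> in the span of
  \<open>A\<close> spans the matroid together with \<open>L\<close>, hence together with
  \<open>A\<close>. No red vector is killed: it would lie in the span of \<open>F\<close>, so its
  element would belong to the red-free flat \<open>F\<close>. A hyperplane of \<open>A\<close>
  together with \<open>X\<close> spans a hyperplane of the matroid, and (C2) gives a red element
  there.\<close>

lemma projected_reds_block:
  assumes simp: simple and rk: "rank E = k + 1" and adm: "admissible_colouring k R B"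
    and A: "A \<subseteq> B" "2 \<le> dim (\<phi> ` A)"
  shows "\<exists>R'. blocks R' (\<phi> ` A) \<and> card R' \<le> card R"
proof -
  have RB: "R \<union> B = E" "R \<inter> B = {}" and hyp: "\<And>H. hyperplane H \<Longrightarrow> H \<inter> R \<noteq> {}"
    and skw: "\<And>L. matroid.line B (restrict_indep B) L \<Longrightarrow>
      \<exists>F. flat F \<and> rank F = k - 1 \<and> skew F L \<and> F \<inter> R = {}"
    using adm unfolding admissible_colouring_def two_colouring_def by auto
  have sub: "R \<subseteq> E" "B \<subseteq> E" "A \<subseteq> E" using RB A by auto
  have fin: "finite R" "finite A" "finite E" using sub finite_ground finite_subset by blast+
  interpret MB: vector_matroid B "restrict_indep B" \<phi> using vector_matroid_restrict sub(2) .
  have npE: "nonparallel (\<phi> ` E)" using simple_imp[OF simp] by blast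
  have "dim (\<phi> ` A) \<le> card (\<phi> ` A)" using fin by (intro real_vector.dim_le_card) (auto intro: span_base)
  then have "2 \<le> card (\<phi> ` A)" using A(2) by simp
  then obtain u w where "u \<in> \<phi> ` A" "w \<in> \<phi> ` A" "u \<noteq> w" by (rule two_le_cardE)
  then obtain a b where ab: "a \<in> A" "b \<in> A" "\<phi> a \<noteq> \<phi> b" by blast
  have abE: "a \<in> B" "b \<in> B" "a \<in> E" "b \<in> E" using ab A(1) sub(2) by auto
  have "\<phi> b \<notin> span {\<phi> a}" "\<phi> a \<noteq> 0" using npE abE ab unfolding nonparallel_def by auto
  then have dab: "dim (\<phi> ` {a, b}) = 2"
    using dim_insert_new[of "{\<phi> a}" "\<phi> b"] real_vector.dim_eq_card_independent[of "{\<phi> a}"]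
    by (simp add: insert_commute)
  \<comment> \<open>The line of \<open>M|B\<close> through \<open>a\<close> and \<open>b\<close>. It
    may contain blue elements outside \<open>A\<close>, but its vectors lie in the span of
    \<open>A\<close>.\<close>
  define L where "L = MB.closure {a, b}"
  have Lab: "span (\<phi> ` L) = span (\<phi> ` {a, b})" unfolding L_def by (rule MB.span_closure) (use abE in simp)
  have LB: "L \<subseteq> B" by (auto simp: L_def MB.closure_def)
  have "MB.line L"
    unfolding MB.line_def L_def using MB.flat_closure[of "{a, b}"] MB.rank_closure[of "{a, b}"] abE dab by simp
  then obtain F where F: "flat F" "rank F = k - 1" "skew F L" "F \<inter> R = {}" using skw by blast
  have FE: "F \<subseteq> E" using F(1) flat_iff by blast
  then have fF: "finite F" using fin(3) finite_subset by blast
  have dL: "dim (\<phi> ` L) = 2" using Lab dab real_vector.span_eq_dim by metis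
  have rL: "rank L = 2" using rank_eq_dim[of L] LB sub(2) dL by auto
  have k: "k \<ge> 1"
  proof -
    have "dim (\<phi> ` A) \<le> dim (\<phi> ` E)"
      using sub fin by (intro dim_subset_finite) auto
    then show ?thesis using A(2) rk rank_eq_dim[of E] by simp
  qed
  have dE: "dim (\<phi> ` E) = k + 1" using rk rank_eq_dim[of E] by simp
  have "rank (F \<union> L) = k + 1" using F(2,3) rL k by (simp add: skew_def)
  then have dFL: "dim (\<phi> ` (F \<union> L)) = k + 1" using rank_eq_dim[of "F \<union> L"] FE LB sub(2) by auto
  have LA: "\<phi> ` L \<subseteq> span (\<phi> ` A)"
    using Lab span_superset[of "\<phi> ` L"] span_mono[of "\<phi> ` {a, b}" "\<phi> ` A"] ab by auto
  have dAF: "dim (\<phi> ` A \<union> \<phi> ` F) = k + 1"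
  proof (rule antisym)
    show "dim (\<phi> ` A \<union> \<phi> ` F) \<le> k + 1"
      unfolding dE[symmetric] using sub FE fin by (intro dim_subset_finite) auto
    have "\<phi> ` (F \<union> L) \<subseteq> span (\<phi> ` A \<union> \<phi> ` F)"
      using LA span_mono[of "\<phi> ` A" "\<phi> ` A \<union> \<phi> ` F"] by (auto intro: span_base)
    then show "k + 1 \<le> dim (\<phi> ` A \<union> \<phi> ` F)"
      unfolding dFL[symmetric] using fin fF by (intro dim_mono_finite) auto
  qed
  have EAF: "\<phi> ` E \<subseteq> span (\<phi> ` A \<union> \<phi> ` F)"
    using dAF dE sub FE fin by (intro span_eq_of_dim_le) auto
  obtain X :: "'v set" and \<pi> :: "'v \<Rightarrow> 'v" where X: "X \<subseteq> \<phi> ` F"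
    and \<pi>: "linear \<pi>" "\<And>x. x \<in> \<phi> ` A \<Longrightarrow> \<pi> x = x" "\<And>x. x \<in> X \<Longrightarrow> \<pi> x = 0"
    and dX: "dim (\<phi> ` A \<union> \<phi> ` F) = dim (\<phi> ` A) + card X"
    and AX: "\<phi> ` A \<union> \<phi> ` F \<subseteq> span (\<phi> ` A \<union> X)"
    and ker: "\<And>w. w \<in> span (\<phi> ` A \<union> \<phi> ` F) \<Longrightarrow> \<pi> w = 0 \<Longrightarrow> w \<in> span X"
    by (fact complement_projection[OF finite_imageI[OF fin(2), of \<phi>] finite_imageI[OF fF, of \<phi>]])
  have fX: "finite X" using X fF finite_subset by blast
  have "blocks (\<pi> ` \<phi> ` R) (\<phi> ` A)"
    unfolding blocks_def
  proof (intro conjI allI impI)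
    show "finite (\<pi> ` \<phi> ` R)" using fin by simp
    show "0 \<notin> \<pi> ` \<phi> ` R"
    proof
      assume "0 \<in> \<pi> ` \<phi> ` R"
      then obtain r where r: "r \<in> R" "\<pi> (\<phi> r) = 0" by auto
      then have rE: "r \<in> E" using sub by blast
      then have "\<phi> r \<in> span X" using ker[of "\<phi> r"] r EAF by blast
      then have "\<phi> r \<in> span (\<phi> ` F)" using span_mono[OF X] by blast
      then have "r \<in> F" using F(1) rE unfolding flat_iff by blast
      then show False using F(4) r by blast
    qed
    fix A1 assume A1: "A1 \<subseteq> \<phi> ` A" "Suc (dim A1) = dim (\<phi> ` A)"
    obtain Q where Q: "Q \<subseteq> A" "A1 = \<phi> ` Q" using A1(1) by (meson subset_imageE)
    obtain Y where Y: "Y \<subseteq> F" "X = \<phi> ` Y" using X by (meson subset_imageE)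
    have QYE: "Q \<union> Y \<subseteq> E" using Q Y sub FE by blast
    have fA1: "finite A1" using A1 fin finite_subset by blast
    \<comment> \<open>For the lower bound, one vector of \<open>A\<close> outside the span of
      \<open>A1\<close> restores the span of all of \<open>A \<union> F\<close>, so only one
      dimension is missing.\<close>
    have "dim (A1 \<union> X) = k"
    proof (rule antisym)
      show "dim (A1 \<union> X) \<le> k"
        using dim_Un_le[OF fA1 fX] A1(2) dX dAF by simp
      have "\<not> \<phi> ` A \<subseteq> span A1"
      proof
        assume "\<phi> ` A \<subseteq> span A1"
        then have "dim (\<phi> ` A) \<le> dim A1" using fA1 dim_mono_finite by blast
        then show False using A1(2) by simp
      qed
      then obtain x where x: "x \<in> \<phi> ` A" "x \<notin> span A1" by blast
      have "\<phi> ` A \<subseteq> span (insert x A1)"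
        using fin x A1 dim_insert_new[OF fA1 x(2)] by (intro span_eq_of_dim_le) auto
      then have "\<phi> ` A \<union> X \<subseteq> span (insert x (A1 \<union> X))"
        using span_mono[of "insert x A1" "insert x (A1 \<union> X)"] by (auto intro: span_base)
      then have "span (\<phi> ` A \<union> X) \<subseteq> span (insert x (A1 \<union> X))" by (intro span_minimal) auto
      then have "\<phi> ` A \<union> \<phi> ` F \<subseteq> span (insert x (A1 \<union> X))" using AX by blast
      then have "k + 1 \<le> dim (insert x (A1 \<union> X))"
        unfolding dAF[symmetric] using fA1 fX by (intro dim_mono_finite) auto
      then show "k \<le> dim (A1 \<union> X)"
        using dim_insert_le[of "A1 \<union> X" x] fA1 fX by simp
    qed
    then have "hyperplane (closure (Q \<union> Y))"
      unfolding hyperplane_def using flat_closure[OF QYE] rank_closure[OF QYE] Q Y rk by (simp add: image_Un)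
    then obtain r where r: "r \<in> R" "\<phi> r \<in> span (A1 \<union> X)"
      using hyp Q Y unfolding closure_def by (force simp: image_Un)
    have "\<pi> (\<phi> r) \<in> \<pi> ` span (A1 \<union> X)" using r by blast
    also have "\<dots> = span (\<pi> ` (A1 \<union> X))" using linear_span_image[OF \<pi>(1)] by metis
    also have "\<dots> \<subseteq> span A1"
    proof (rule span_minimal)
      show "\<pi> ` (A1 \<union> X) \<subseteq> span A1"
        using \<pi>(2,3) A1(1) by (auto simp: subset_iff span_zero intro: span_base)
    qed simp
    finally show "\<pi> ` \<phi> ` R \<inter> span A1 \<noteq> {}" using r(1) by blast
  qed
  moreover have "card (\<pi> ` \<phi> ` R) \<le> card R"
    using fin by (metis card_image_le finite_imageI order_trans)
  ultimately show ?thesis by blast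
qed

end

section \<open>The linear upper bound on the number of blue elements\<close>

lemma vector_matroid_of_representable:
  assumes "matroid E indep" "matroid.real_representable E indep"
  shows "\<exists>\<phi> :: 'a \<Rightarrow> nat \<Rightarrow>\<^sub>0 real. vector_matroid E indep \<phi>"
proof -
  interpret matroid E indep by fact
  obtain d v where dv: "\<And>X. X \<subseteq> E \<Longrightarrow> indep X \<longleftrightarrow>
      (\<forall>c :: 'a \<Rightarrow> real. (\<forall>i<(d::nat). (\<Sum>x\<in>X. c x * v x i) = 0) \<longrightarrow> (\<forall>x\<in>X. c x = 0))"
    using assms(2) unfolding real_representable_def by blast
  define \<phi> where "\<phi> x = (\<Sum>i<d. Poly_Mapping.single i (v x i))" for x
  have look: "Poly_Mapping.lookup (\<phi> x) i = (if i < d then v x i else 0)" for x i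
    by (simp add: \<phi>_def lookup_sum lookup_single when_def sum.delta)
  have "vector_matroid E indep \<phi>"
  proof unfold_locales
    fix X assume X: "X \<subseteq> E"
    then have "finite X" using finite_ground finite_subset by blast
    then show "indep X = (inj_on \<phi> X \<and> independent (\<phi> ` X))"
      unfolding dv[OF X] using look by (rule independent_columns_iff)
  qed
  then show ?thesis by blast
qed

text \<open>A factor \<open>c\<close> is lost twice, in passing from the blue points to
  \<open>A\<close> and in comparing \<open>A\<close> with the projected red points. If
  \<open>A\<close> has dimension below 2, it has at most one point, which \<open>t \<ge> 1\<close>
  absorbs.\<close>

lemma blue_counts_linear_bound:
  "\<exists>c>0. \<forall>t\<ge>1. \<forall>n\<in>blue_counts k t. c * real n \<le> real t"
proof -
  obtain c where c: "c > 0" and good: "\<And>B. nonparallel (B :: (nat \<Rightarrow>\<^sub>0 real) set) \<Longrightarrow> dim B \<le> k + 1 \<Longrightarrow>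
     \<exists>A\<subseteq>B. c * real (card B) \<le> real (card A) \<and>
        (2 \<le> dim A \<longrightarrow> (\<forall>R. blocks R A \<longrightarrow> c * real (card A) \<le> real (card R)))"
    using linearly_blocked_subset_exists[of "k + 1"] by blast
  define c' where "c' = min c (c * c)"
  have c': "c' > 0" "c' \<le> c" "c' \<le> c * c" using c by (auto simp: c'_def)
  have "c' * real n \<le> real t" if t: "t \<ge> 1" and n: "n \<in> blue_counts k t" for t n
  proof -
    obtain E :: "nat set" and indep R B where M: "matroid E indep" "matroid.simple E indep"
      "matroid.real_representable E indep" "matroid.rank indep E = k + 1"
      "matroid.admissible_colouring E indep k R B" "card R = t" "card B = n"
      using n unfolding blue_counts_def by blast
    obtain \<phi> :: "nat \<Rightarrow> nat \<Rightarrow>\<^sub>0 real" where \<phi>: "vector_matroid E indep \<phi>"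
      using vector_matroid_of_representable[OF M(1,3)] by blast
    interpret vector_matroid E indep \<phi> by fact
    have BE: "B \<subseteq> E" using M(5) unfolding admissible_colouring_def two_colouring_def by blast
    have inj: "inj_on \<phi> B" using simple_imp(1)[OF M(2)] BE inj_on_subset by blast
    have np: "nonparallel (\<phi> ` B)" using simple_imp(2)[OF M(2)] BE nonparallel_subset image_mono by metis
    have "dim (\<phi> ` B) \<le> dim (\<phi> ` E)" using BE finite_ground by (intro dim_subset_finite) auto
    then have "dim (\<phi> ` B) \<le> k + 1" using M(4) rank_eq_dim[of E] by simp
    from good[OF np this] obtain A' where A': "A' \<subseteq> \<phi> ` B" "c * real (card (\<phi> ` B)) \<le> real (card A')"
        "2 \<le> dim A' \<Longrightarrow> (\<forall>R. blocks R A' \<longrightarrow> c * real (card A') \<le> real (card R))"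
      by blast
    obtain A where A: "A \<subseteq> B" "A' = \<phi> ` A" using A'(1) by (meson subset_imageE)
    have cB: "c * real n \<le> real (card A')" using A'(2) inj M(7) by (simp add: card_image)
    show ?thesis
    proof (cases "2 \<le> dim A'")
      case True
      then obtain R' where R': "blocks R' A'" "card R' \<le> card R"
        using projected_reds_block[OF M(2,4,5) A(1)] A(2) by blast
      have "c' * real n \<le> c * (c * real n)"
        using mult_right_mono[OF c'(3), of "real n"] by (simp add: mult.assoc)
      also have "\<dots> \<le> c * real (card A')" using cB c by (intro mult_left_mono) auto
      also have "\<dots> \<le> real (card R')" using A'(3)[OF True] R'(1) by blast
      also have "\<dots> \<le> real t" using R'(2) M(6) by simp
      finally show ?thesis .
    next
      case False
      have "card A' \<le> 1"
      proof (rule ccontr)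
        assume "\<not> ?thesis"
        then have "2 \<le> card A'" by simp
        then obtain x y where xy: "x \<in> A'" "y \<in> A'" "x \<noteq> y" by (rule two_le_cardE)
        then have "y \<notin> span {x}" "x \<noteq> 0" using nonparallel_subset[OF np A'(1)] unfolding nonparallel_def by auto
        then have "dim {y, x} = 2"
          using dim_insert_new[of "{x}" y] real_vector.dim_eq_card_independent[of "{x}"] by simp
        moreover have "finite A'" using np A'(1) finite_subset unfolding nonparallel_def by blast
        then have "dim {y, x} \<le> dim A'" using xy by (intro dim_subset_finite) auto
        ultimately show False using False by simp
      qed
      then have "c * real n \<le> 1" using cB by simp
      moreover have "c' * real n \<le> c * real n" using c' by (intro mult_right_mono) auto
      ultimately show ?thesis using t by simp
    qed
  qed
  then show ?thesis using c'(1) by blast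
qed

lemma blue_counts_one: "blue_counts 1 t = {}"
proof (rule ccontr)
  assume "blue_counts 1 t \<noteq> {}"
  then obtain E :: "nat set" and indep R B where M: "matroid E indep" "matroid.simple E indep"
    "matroid.real_representable E indep" "matroid.rank indep E = 1 + 1"
    "matroid.admissible_colouring E indep 1 R B"
    unfolding blue_counts_def by blast
  obtain \<phi> :: "nat \<Rightarrow> nat \<Rightarrow>\<^sub>0 real" where "vector_matroid E indep \<phi>"
    using vector_matroid_of_representable[OF M(1,3)] by blast
  then interpret vector_matroid E indep \<phi> .
  show False using no_admissible_colouring_rank_two[OF M(2) _ M(5)] M(4) by simp
qed

section \<open>The extremal configuration\<close>

lemma vector_matroid_of_family:
  fixes \<phi> :: "'a \<Rightarrow> 'v::real_vector"
  assumes "finite E"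
  shows "vector_matroid E (\<lambda>X. X \<subseteq> E \<and> inj_on \<phi> X \<and> independent (\<phi> ` X)) \<phi>"
proof
  fix I J assume I: "I \<subseteq> E \<and> inj_on \<phi> I \<and> independent (\<phi> ` I)" and J: "J \<subseteq> E \<and> inj_on \<phi> J \<and> independent (\<phi> ` J)"
    and c: "card I < card J"
  have fin: "finite I" "finite J" using I J assms finite_subset by blast+
  have "\<not> \<phi> ` J \<subseteq> span (\<phi> ` I)"
  proof
    assume "\<phi> ` J \<subseteq> span (\<phi> ` I)"
    then have "dim (\<phi> ` J) \<le> dim (\<phi> ` I)" using fin by (intro dim_mono_finite) auto
    then show False
      using I J c by (simp add: real_vector.dim_eq_card_independent card_image)
  qed
  then obtain x where x: "x \<in> J" "\<phi> x \<notin> span (\<phi> ` I)" by blast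
  then have x': "x \<notin> I" "\<phi> x \<notin> \<phi> ` I" using span_base by blast+
  moreover have "independent (insert (\<phi> x) (\<phi> ` I))"
    using x(2) I by (intro independent_insertI) auto
  ultimately show "\<exists>x\<in>J - I. insert x I \<subseteq> E \<and> inj_on \<phi> (insert x I) \<and> independent (\<phi> ` insert x I)"
    using x I J by (intro bexI[of _ x]) auto
next
  fix I J assume "J \<subseteq> E \<and> inj_on \<phi> J \<and> independent (\<phi> ` J)" "I \<subseteq> J"
  then show "I \<subseteq> E \<and> inj_on \<phi> I \<and> independent (\<phi> ` I)"
    by (meson image_mono inj_on_subset real_vector.independent_mono subset_trans)
qed (use assms in \<open>auto simp: real_vector.independent_empty\<close>)

text \<open>Otherwise subtracting the other terms would leave a nonzero multiple of
  \<open>\<phi> e\<close> in the span of the remaining independent vectors.\<close>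

lemma not_in_span_of_coefficient:
  fixes \<phi> :: "'a \<Rightarrow> 'v::real_vector"
  assumes "finite T" "inj_on \<phi> T" "independent (\<phi> ` T)" "e \<in> T" "c e \<noteq> 0"
  shows "(\<Sum>x\<in>T. c x *\<^sub>R \<phi> x) \<notin> span (\<phi> ` (T - {e}))"
proof
  let ?S = "span (\<phi> ` (T - {e}))"
  assume "(\<Sum>x\<in>T. c x *\<^sub>R \<phi> x) \<in> ?S"
  moreover have "(\<Sum>x\<in>T - {e}. c x *\<^sub>R \<phi> x) \<in> ?S"
    by (intro span_sum span_scale span_base) auto
  ultimately have "(\<Sum>x\<in>T. c x *\<^sub>R \<phi> x) - (\<Sum>x\<in>T - {e}. c x *\<^sub>R \<phi> x) \<in> ?S" by (rule span_diff)
  also have "(\<Sum>x\<in>T. c x *\<^sub>R \<phi> x) - (\<Sum>x\<in>T - {e}. c x *\<^sub>R \<phi> x) = c e *\<^sub>R \<phi> e"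
    using assms(1,4) by (simp add: sum.remove)
  finally have "(1 / c e) *\<^sub>R (c e *\<^sub>R \<phi> e) \<in> ?S" by (rule span_scale)
  then have "\<phi> e \<in> ?S" using assms(5) by simp
  moreover have "\<phi> ` (T - {e}) = \<phi> ` T - {\<phi> e}" using assms(2,4) by (auto simp: inj_on_def)
  ultimately show False using assms(3,4) unfolding real_vector.dependent_def by auto
qed

text \<open>
  Blue elements are the indices \<open>a < m\<close> (points on a line) and \<open>m \<le> j < t\<close> (further basis
  vectors); the red elements are \<open>t + a\<close> and \<open>t + j\<close>. Every red vector has at most one zero
  coordinate with respect to each basis \<open>{a, b} \<union> {m..<t}\<close>, and each coordinate with respect to
  such a basis vanishes on some red vector.
\<close>

locale extremal_configuration =
  fixes k t :: nat
  assumes k2: "2 \<le> k" and tk: "k + 1 \<le> t"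
begin

text \<open>\<open>k + 1 \<le> t\<close> gives \<open>m \<ge> 2\<close>, so the blue set has full
  rank. Its hyperplanes are then \<open>m\<close> containing one line point and all further basis
  vectors, and \<open>k - 1\<close> containing the line and omitting one basis vector:
  \<open>t\<close> altogether.\<close>

definition m :: nat where "m = t - (k - 1)"

abbreviation f :: "nat \<Rightarrow> nat \<Rightarrow>\<^sub>0 real" where "f i \<equiv> Poly_Mapping.single i 1"

definition blue_vec :: "nat \<Rightarrow> nat \<Rightarrow>\<^sub>0 real" where
  "blue_vec e = (if e < m then f 0 + real e *\<^sub>R f 1 else f (e - m + 2))"

text \<open>The red \<open>t + a\<close> lies on the hyperplane through \<open>a\<close> and all
  further basis vectors, the red \<open>t + j\<close> on the one omitting \<open>j\<close>.
  \<open>f 1\<close> is the point at infinity of the line, different from every blue point, and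
  coefficients 1 keep the remaining coordinates nonzero.\<close>

definition vec :: "nat \<Rightarrow> nat \<Rightarrow>\<^sub>0 real" where
  "vec e = (if e < t then blue_vec e
    else if e < t + m then blue_vec (e - t) + (\<Sum>j\<in>{m..<t}. blue_vec j)
    else f 1 + (\<Sum>j\<in>{m..<t} - {e - t}. blue_vec j))"

definition E :: "nat set" where "E = {..<2 * t}"
definition B :: "nat set" where "B = {..<t}"
definition R :: "nat set" where "R = {t..<2 * t}"
definition T :: "nat \<Rightarrow> nat \<Rightarrow> nat set" where "T a b = {a, b} \<union> {m..<t}"

definition indep :: "nat set \<Rightarrow> bool" where
  "indep X \<longleftrightarrow> X \<subseteq> E \<and> inj_on vec X \<and> independent (vec ` X)"

section \<open>Coordinates with respect to the blue bases\<close>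

lemma m: "2 \<le> m" "m < t" "t - m = k - 1" "t = m + (k - 1)"
  using k2 tk by (auto simp: m_def)

lemma vec_line: "a < m \<Longrightarrow> vec a = f 0 + real a *\<^sub>R f 1"
  using m by (simp add: vec_def blue_vec_def)

lemma vec_basis: "j \<in> {m..<t} \<Longrightarrow> vec j = f (j - m + 2)"
  using m by (simp add: vec_def blue_vec_def)

lemma sum_blue: "J \<subseteq> {m..<t} \<Longrightarrow> (\<Sum>j\<in>J. blue_vec j) = (\<Sum>j\<in>J. vec j)"
  by (intro sum.cong) (auto simp: vec_def)

lemma vec_red_line: "a < m \<Longrightarrow> vec (t + a) = f 0 + real a *\<^sub>R f 1 + (\<Sum>j\<in>{m..<t}. vec j)"
  using m sum_blue[OF order_refl] by (simp add: vec_def[of "t + a"] blue_vec_def)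

lemma vec_red_basis: "i \<in> {m..<t} \<Longrightarrow> vec (t + i) = f 1 + (\<Sum>j\<in>{m..<t} - {i}. vec j)"
proof -
  assume i: "i \<in> {m..<t}"
  have "(\<Sum>j\<in>{m..<t} - {i}. blue_vec j) = (\<Sum>j\<in>{m..<t} - {i}. vec j)"
    by (rule sum_blue) auto
  then show ?thesis using i by (simp add: vec_def)
qed

lemma lookup_sum_basis:
  "Poly_Mapping.lookup (\<Sum>j\<in>{m..<t}. c j *\<^sub>R vec j) i = (if 2 \<le> i \<and> i \<le> k then c (i - 2 + m) else 0)"
proof -
  have "Poly_Mapping.lookup (\<Sum>j\<in>{m..<t}. c j *\<^sub>R vec j) i = (\<Sum>j\<in>{m..<t}. if j - m + 2 = i then c j else 0)"
    by (auto simp: lookup_sum lookup_scaleR vec_basis lookup_single when_def intro!: sum.cong)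
  also have "\<dots> = (\<Sum>j\<in>{m..<t}. if j = i - 2 + m \<and> 2 \<le> i then c j else 0)"
    by (intro sum.cong) auto
  also have "\<dots> = (if 2 \<le> i \<and> i - 2 + m \<in> {m..<t} then c (i - 2 + m) else 0)"
    by (cases "2 \<le> i") (simp_all add: sum.delta)
  also have "2 \<le> i \<and> i - 2 + m \<in> {m..<t} \<longleftrightarrow> 2 \<le> i \<and> i \<le> k"
    using m k2 by auto
  finally show ?thesis .
qed

lemma lookup_sum_vec:
  assumes "J \<subseteq> {m..<t}"
  shows "Poly_Mapping.lookup (\<Sum>j\<in>J. vec j) i = (if 2 \<le> i \<and> i \<le> k \<and> i - 2 + m \<in> J then 1 else 0)"
proof -
  have "(\<Sum>j\<in>J. vec j) = (\<Sum>j\<in>{m..<t}. (if j \<in> J then 1 else 0) *\<^sub>R vec j)"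
    using assms by (intro sum.mono_neutral_cong_left) auto
  then show ?thesis by (simp only: lookup_sum_basis) simp
qed

lemma sum_T:
  assumes "a < m" "b < m" "a \<noteq> b"
  shows "(\<Sum>e\<in>T a b. c e *\<^sub>R vec e) = c a *\<^sub>R vec a + c b *\<^sub>R vec b + (\<Sum>j\<in>{m..<t}. c j *\<^sub>R vec j)"
proof -
  have "T a b = insert a (insert b {m..<t})" by (auto simp: T_def)
  then show ?thesis using assms by (simp add: add.assoc)
qed

lemma finite_T: "finite (T a b)" by (simp add: T_def)

lemma card_T:
  assumes "a < m" "b < m" "a \<noteq> b"
  shows "card (T a b) = k + 1"
proof -
  have "T a b = insert a (insert b {m..<t})" by (auto simp: T_def)
  then show ?thesis using assms m k2 by simp
qed

lemma T_subset: "a < m \<Longrightarrow> b < m \<Longrightarrow> T a b \<subseteq> B"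
  using m by (auto simp: T_def B_def)

lemma independent_T:
  assumes ab: "a < m" "b < m" "a \<noteq> b"
  shows "inj_on vec (T a b) \<and> independent (vec ` T a b)"
proof -
  have "\<forall>c. (\<Sum>e\<in>T a b. c e *\<^sub>R vec e) = 0 \<longrightarrow> (\<forall>e\<in>T a b. c e = 0)"
  proof (intro allI impI)
    fix c :: "nat \<Rightarrow> real" assume "(\<Sum>e\<in>T a b. c e *\<^sub>R vec e) = 0"
    then have z: "c a *\<^sub>R vec a + c b *\<^sub>R vec b + (\<Sum>j\<in>{m..<t}. c j *\<^sub>R vec j) = 0" using sum_T[OF ab] by simp
    have l: "c a * Poly_Mapping.lookup (vec a) i + c b * Poly_Mapping.lookup (vec b) i
        + (if 2 \<le> i \<and> i \<le> k then c (i - 2 + m) else 0) = 0" for i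
      using arg_cong[OF z, of "\<lambda>p. Poly_Mapping.lookup p i"]
      by (simp add: lookup_add lookup_scaleR lookup_sum_basis)
    have 0: "c a + c b = 0"
      using l[of 0] ab by (simp add: vec_line lookup_add lookup_scaleR lookup_single lookup_one when_def)
    have 1: "c a * real a + c b * real b = 0"
      using l[of 1] ab by (simp add: vec_line lookup_add lookup_scaleR lookup_single lookup_one when_def)
    have "c b * (real b - real a) = 0" using 0 1 by algebra
    then have cb: "c b = 0" using ab by simp
    then have ca: "c a = 0" using 0 by simp
    have "c j = 0" if "j \<in> {m..<t}" for j
    proof -
      have "2 \<le> j - m + 2 \<and> j - m + 2 \<le> k" using that m k2 by auto
      then show ?thesis using l[of "j - m + 2"] ca cb that by simp
    qed
    then show "\<forall>e\<in>T a b. c e = 0" using ca cb by (auto simp: T_def)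
  qed
  then show ?thesis using independent_family_iff[OF finite_T] by blast
qed

text \<open>Cramer's rule for the line points with parameters \<open>a\<close> and
  \<open>b\<close>.\<close>

lemma line_coordinates:
  assumes "a < m" "b < m" "a \<noteq> b"
  shows "\<alpha> *\<^sub>R f 0 + \<beta> *\<^sub>R f 1 =
    ((\<alpha> * real b - \<beta>) / (real b - real a)) *\<^sub>R vec a + ((\<beta> - \<alpha> * real a) / (real b - real a)) *\<^sub>R vec b"
    (is "_ = ?p *\<^sub>R _ + ?q *\<^sub>R _")
proof -
  have ne: "real b - real a \<noteq> 0" using assms by simp
  have p: "?p * (real b - real a) = \<alpha> * real b - \<beta>" and q: "?q * (real b - real a) = \<beta> - \<alpha> * real a"
    using ne by simp_all
  have "(?p + ?q) * (real b - real a) = \<alpha> * (real b - real a)"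
    unfolding distrib_right p q by (simp add: algebra_simps)
  then have 1: "?p + ?q = \<alpha>" using ne by simp
  have "?p * real a + ?q * real b = (?p + ?q) * real a + ?q * (real b - real a)"
    by (simp only: algebra_simps)
  also have "\<dots> = \<beta>" unfolding 1 q by simp
  finally have 2: "?p * real a + ?q * real b = \<beta>" .
  have "?p *\<^sub>R vec a + ?q *\<^sub>R vec b = (?p + ?q) *\<^sub>R f 0 + (?p * real a + ?q * real b) *\<^sub>R f 1"
    using assms by (simp add: vec_line scaleR_add_left scaleR_add_right)
  then show ?thesis unfolding 1 2 by simp
qed

text \<open>The coordinates at \<open>a\<close> and \<open>b\<close> are proportional to b - i and i
  - a, or to -1 and 1 for the red vectors built on \<open>f 1\<close>, so at most one of them
  vanishes. Having at most one zero overall serves (C3); the prescribed zeros serve (C2).\<close>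

lemma red_coordinates:
  assumes ab: "a < m" "b < m" "a \<noteq> b" and r: "r \<in> R"
  shows "\<exists>c. vec r = (\<Sum>e\<in>T a b. c e *\<^sub>R vec e) \<and>
     (\<forall>x\<in>T a b. \<forall>y\<in>T a b. c x = 0 \<longrightarrow> c y = 0 \<longrightarrow> x = y) \<and>
     (r = t + b \<longrightarrow> c a = 0) \<and> (r = t + a \<longrightarrow> c b = 0) \<and> (\<forall>j\<in>{m..<t}. r = t + j \<longrightarrow> c j = 0)"
proof -
  have ne: "real b - real a \<noteq> 0" using ab by simp
  define i where "i = r - t"
  have i: "r = t + i" "i < t" using r by (auto simp: R_def i_def)
  show ?thesis
  proof (cases "i < m")
    case True
    define c where "c e = (if e = a then (real b - real i) / (real b - real a)
       else if e = b then (real i - real a) / (real b - real a) else 1)" for e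
    have "vec r = f 0 + real i *\<^sub>R f 1 + (\<Sum>j\<in>{m..<t}. vec j)"
      using vec_red_line[OF True] i by simp
    also have "(\<Sum>j\<in>{m..<t}. vec j) = (\<Sum>j\<in>{m..<t}. c j *\<^sub>R vec j)"
      using ab by (intro sum.cong) (auto simp: c_def)
    also have "f 0 + real i *\<^sub>R f 1 = c a *\<^sub>R vec a + c b *\<^sub>R vec b"
      using line_coordinates[OF ab, of 1 "real i"] ab by (simp add: c_def)
    finally have "vec r = (\<Sum>e\<in>T a b. c e *\<^sub>R vec e)" using sum_T[OF ab] by simp
    moreover have "\<forall>x\<in>T a b. \<forall>y\<in>T a b. c x = 0 \<longrightarrow> c y = 0 \<longrightarrow> x = y"
      using ab ne by (auto simp: T_def c_def)
    moreover have "r = t + b \<longrightarrow> c a = 0" "r = t + a \<longrightarrow> c b = 0" "\<forall>j\<in>{m..<t}. r = t + j \<longrightarrow> c j = 0"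
      using True i ab by (auto simp: c_def)
    ultimately show ?thesis by blast
  next
    case False
    then have im: "i \<in> {m..<t}" using i by simp
    define c where "c e = (if e = a then - 1 / (real b - real a)
       else if e = b then 1 / (real b - real a) else if e = i then 0 else 1)" for e
    have "vec r = f 1 + (\<Sum>j\<in>{m..<t} - {i}. vec j)"
      using vec_red_basis[OF im] i by simp
    also have "(\<Sum>j\<in>{m..<t} - {i}. vec j) = (\<Sum>j\<in>{m..<t} - {i}. c j *\<^sub>R vec j)"
      using ab by (intro sum.cong) (auto simp: c_def)
    also have "\<dots> = (\<Sum>j\<in>{m..<t}. c j *\<^sub>R vec j)"
      using ab im by (intro sum.mono_neutral_left) (auto simp: c_def)
    also have "f 1 = c a *\<^sub>R vec a + c b *\<^sub>R vec b"
      using line_coordinates[OF ab, of 0 1] ab by (simp add: c_def)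
    finally have "vec r = (\<Sum>e\<in>T a b. c e *\<^sub>R vec e)" using sum_T[OF ab] by simp
    moreover have "\<forall>x\<in>T a b. \<forall>y\<in>T a b. c x = 0 \<longrightarrow> c y = 0 \<longrightarrow> x = y"
      using ab ne by (auto simp: T_def c_def split: if_splits)
    moreover have "r = t + b \<longrightarrow> c a = 0" "r = t + a \<longrightarrow> c b = 0" "\<forall>j\<in>{m..<t}. r = t + j \<longrightarrow> c j = 0"
      using False i ab by (auto simp: c_def)
    ultimately show ?thesis by blast
  qed
qed

text \<open>One of the coordinates at \<open>x\<close> and \<open>y\<close> is nonzero, and its
  basis vector is missing from the span.\<close>

lemma red_not_in_span:
  assumes ab: "a < m" "b < m" "a \<noteq> b" and r: "r \<in> R" and xy: "x \<in> T a b" "y \<in> T a b" "x \<noteq> y"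
  shows "vec r \<notin> span (vec ` (T a b - {x, y}))"
proof -
  obtain c where c: "vec r = (\<Sum>e\<in>T a b. c e *\<^sub>R vec e)"
     "\<And>x y. x \<in> T a b \<Longrightarrow> y \<in> T a b \<Longrightarrow> c x = 0 \<Longrightarrow> c y = 0 \<Longrightarrow> x = y"
    using red_coordinates[OF ab r] by blast
  obtain e where e: "e \<in> {x, y}" "c e \<noteq> 0" using c(2)[OF xy(1,2)] xy(3) by blast
  have "vec r \<notin> span (vec ` (T a b - {e}))"
    unfolding c(1) using independent_T[OF ab] e xy by (intro not_in_span_of_coefficient finite_T) auto
  moreover have "span (vec ` (T a b - {x, y})) \<subseteq> span (vec ` (T a b - {e}))"
    using e by (intro span_mono) auto
  ultimately show ?thesis by blast
qed

lemma red_in_span: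
  assumes ab: "a < m" "b < m" "a \<noteq> b" and u: "u \<in> T a b"
  shows "\<exists>r\<in>R. vec r \<in> span (vec ` (T a b - {u}))"
proof -
  \<comment> \<open>Omitting \<open>a\<close> leaves a hyperplane that contains \<open>b\<close>,
    hence the red point belonging to \<open>b\<close>, and conversely.\<close>
  define r where "r = (if u = a then t + b else if u = b then t + a else t + u)"
  have r: "r \<in> R" using ab u m by (auto simp: r_def R_def T_def)
  obtain c where c: "vec r = (\<Sum>e\<in>T a b. c e *\<^sub>R vec e)"
     "r = t + b \<longrightarrow> c a = 0" "r = t + a \<longrightarrow> c b = 0" "\<forall>j\<in>{m..<t}. r = t + j \<longrightarrow> c j = 0"
    using red_coordinates[OF ab r] by blast
  have "c u = 0" using c(2-) u ab by (auto simp: r_def T_def)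
  then have "vec r = (\<Sum>e\<in>T a b - {u}. c e *\<^sub>R vec e)"
    unfolding c(1) using u finite_T by (simp add: sum.remove)
  also have "\<dots> \<in> span (vec ` (T a b - {u}))" by (intro span_sum span_scale span_base) auto
  finally show ?thesis using r by blast
qed

lemma vec_in_span_T:
  assumes ab: "a < m" "b < m" "a \<noteq> b" and e: "e \<in> E"
  shows "vec e \<in> span (vec ` T a b)"
proof -
  have T: "vec x \<in> span (vec ` T a b)" if "x \<in> T a b" for x using that by (intro span_base) auto
  consider "e < m" | "e \<in> {m..<t}" | "e \<in> R" using e by (fastforce simp: E_def R_def)
  then show ?thesis
  proof cases
    case 1
    have "vec e \<in> span (vec ` {a, b})"
      unfolding vec_line[OF 1] using line_coordinates[OF ab, of 1 "real e"]
      by (simp add: span_add span_scale span_base)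
    then show ?thesis using span_mono[of "vec ` {a, b}" "vec ` T a b"] by (auto simp: T_def)
  next
    case 2
    then show ?thesis by (intro T) (simp add: T_def)
  next
    case 3
    then obtain c where "vec e = (\<Sum>x\<in>T a b. c x *\<^sub>R vec x)" using red_coordinates[OF ab] by blast
    then show ?thesis using T by (simp add: span_sum span_scale)
  qed
qed

text \<open>\<open>T a b\<close> has room for two line points, and \<open>m \<ge> 2\<close> provides
  any that are needed to fill it.\<close>

lemma blue_pair_in_T:
  assumes "x \<in> B" "y \<in> B" "x \<noteq> y"
  shows "\<exists>a b. a < m \<and> b < m \<and> a \<noteq> b \<and> x \<in> T a b \<and> y \<in> T a b"
proof -
  have s: "T b a = T a b" for a b by (auto simp: T_def)
  have o: "\<exists>b<m. b \<noteq> a" for a using m(1) by (intro exI[of _ "if a = 0 then 1 else 0"]) auto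
  consider "x < m" "y < m" | "x < m" "\<not> y < m" | "\<not> x < m" "y < m" | "\<not> x < m" "\<not> y < m" by blast
  then show ?thesis
  proof cases
    case 1
    then show ?thesis using assms by (intro exI[of _ x] exI[of _ y]) (auto simp: T_def)
  next
    case 2
    then show ?thesis using assms o[of x] by (auto simp: T_def B_def)
  next
    case 3
    then show ?thesis using assms o[of y] by (auto simp: T_def B_def)
  next
    case 4
    then show ?thesis using assms m by (intro exI[of _ 0] exI[of _ 1]) (auto simp: T_def B_def)
  qed
qed

section \<open>Simplicity, representability and the conditions on the colouring\<close>

sublocale vector_matroid E indep vec
  unfolding indep_def[abs_def] by (rule vector_matroid_of_family) (simp add: E_def)

lemma dim_T:
  assumes "a < m" "b < m" "a \<noteq> b" "X \<subseteq> T a b"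
  shows "dim (vec ` X) = card X"
proof -
  have "inj_on vec X" "independent (vec ` X)"
    using independent_T[OF assms(1-3)] assms(4) by (meson inj_on_subset image_mono real_vector.independent_mono)+
  then show ?thesis by (simp add: real_vector.dim_eq_card_independent card_image)
qed

lemma E_eq: "E = R \<union> B" "R \<inter> B = {}" by (auto simp: E_def R_def B_def)

lemma rank_of_superset:
  assumes "a < m" "b < m" "a \<noteq> b" "T a b \<subseteq> X" "X \<subseteq> E"
  shows "rank X = k + 1"
proof -
  have "finite X" using assms(5) finite_ground finite_subset by blast
  have "dim (vec ` X) \<le> dim (vec ` T a b)"
    using assms vec_in_span_T[OF assms(1-3)] finite_T by (intro dim_mono_finite) auto
  moreover have "dim (vec ` T a b) \<le> dim (vec ` X)"
    using assms \<open>finite X\<close> by (intro dim_subset_finite) auto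
  ultimately show ?thesis using rank_eq_dim[OF assms(5)] dim_T[OF assms(1-3)] card_T[OF assms(1-3)] by simp
qed

lemma T01: "(0::nat) < m" "(1::nat) < m" "(0::nat) \<noteq> 1" using m by auto

lemma rank_E: "rank E = k + 1"
  using rank_of_superset[OF T01] T_subset[OF T01(1,2)] E_eq by auto

text \<open>Every vector is in the span of \<open>T 0 1\<close> and so has no entry beyond
  coordinate \<open>k\<close>; hence \<open>k + 1\<close> rows suffice.\<close>

lemma real_representable: real_representable
  unfolding real_representable_def
proof (intro exI allI impI)
  fix X assume X: "X \<subseteq> E"
  have "Poly_Mapping.lookup (vec e) i = (if i < k + 1 then Poly_Mapping.lookup (vec e) i else 0)" if "e \<in> X" for e i
  proof (cases "i < k + 1")
    case False
    have "vec e \<in> span (vec ` T 0 1)" using vec_in_span_T[OF T01] X that by blast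
    then obtain u where "vec e = (\<Sum>v\<in>vec ` T 0 1. u v *\<^sub>R v)"
      using real_vector.span_finite[of "vec ` T 0 1"] finite_T by auto
    then have "vec e = (\<Sum>x\<in>T 0 1. u (vec x) *\<^sub>R vec x)"
      using independent_T[OF T01] by (simp add: sum.reindex)
    then have "vec e = u (vec 0) *\<^sub>R vec 0 + u (vec 1) *\<^sub>R vec 1 + (\<Sum>j\<in>{m..<t}. u (vec j) *\<^sub>R vec j)"
      using sum_T[OF T01, of "\<lambda>x. u (vec x)"] by simp
    then show ?thesis
      using False k2 T01 by (simp add: lookup_add lookup_scaleR lookup_sum_basis vec_line lookup_single lookup_one when_def)
  qed simp
  then show "indep X \<longleftrightarrow> (\<forall>c :: nat \<Rightarrow> real. (\<forall>i<k + 1. (\<Sum>x\<in>X. c x * Poly_Mapping.lookup (vec x) i) = 0)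
      \<longrightarrow> (\<forall>x\<in>X. c x = 0))"
    using X finite_subset[OF X finite_ground] unfolding indep_def
    by (subst independent_columns_iff) auto
qed

lemma blue_nonzero:
  assumes "x \<in> B"
  shows "vec x \<noteq> 0"
proof -
  define y where "y = (if x = 0 then 1 else 0 :: nat)"
  have y: "y \<in> B" "x \<noteq> y" using m by (auto simp: y_def B_def)
  obtain a b where ab: "a < m" "b < m" "a \<noteq> b" "x \<in> T a b"
    using blue_pair_in_T[OF assms y] by blast
  then have "vec x \<in> vec ` T a b" by blast
  then show ?thesis using independent_T[OF ab(1-3)] real_vector.dependent_zero[of "vec ` T a b"] by auto
qed

lemma red_notin_span_of_blue:
  assumes "x \<in> B" "r \<in> R"
  shows "vec r \<notin> span {vec x}"
proof -
  define y where "y = (if x = 0 then 1 else 0 :: nat)"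
  have y: "y \<in> B" "x \<noteq> y" using m by (auto simp: y_def B_def)
  obtain a b where ab: "a < m" "b < m" "a \<noteq> b" "x \<in> T a b"
    using blue_pair_in_T[OF assms(1) y] by blast
  have "card (T a b - {x}) = k" using card_T[OF ab(1-3)] ab(4) by simp
  then have "2 \<le> card (T a b - {x})" using k2 by simp
  then obtain u w where uw: "u \<in> T a b - {x}" "w \<in> T a b - {x}" "u \<noteq> w" by (rule two_le_cardE)
  have "vec r \<notin> span (vec ` (T a b - {u, w}))"
    using red_not_in_span[OF ab(1-3) assms(2)] uw by blast
  moreover have "span {vec x} \<subseteq> span (vec ` (T a b - {u, w}))"
    using uw ab(4) by (intro span_mono) auto
  ultimately show ?thesis by blast
qed

lemma lookup_red:
  assumes "r \<in> R"
  shows "Poly_Mapping.lookup (vec r) 0 = (if r < t + m then 1 else 0)"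
    "Poly_Mapping.lookup (vec r) 1 = (if r < t + m then real (r - t) else 1)"
    "\<And>j. j \<in> {m..<t} \<Longrightarrow> Poly_Mapping.lookup (vec r) (j - m + 2) = (if r = t + j then 0 else 1)"
proof -
  define i where "i = r - t"
  have i: "r = t + i" "i < t" using assms by (auto simp: R_def i_def)
  have jk: "j - m + 2 \<le> k" if "j \<in> {m..<t}" for j using that m k2 by auto
  have "Poly_Mapping.lookup (vec r) 0 = (if r < t + m then 1 else 0) \<and>
    Poly_Mapping.lookup (vec r) 1 = (if r < t + m then real (r - t) else 1) \<and>
    (\<forall>j\<in>{m..<t}. Poly_Mapping.lookup (vec r) (j - m + 2) = (if r = t + j then 0 else 1))"
  proof (cases "i < m")
    case True
    show ?thesis
      unfolding i(1) vec_red_line[OF True] using True i jk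
      by (auto simp: lookup_add lookup_scaleR lookup_sum_vec lookup_single lookup_one when_def)
  next
    case False
    then have im: "i \<in> {m..<t}" using i by simp
    show ?thesis
      unfolding i(1) vec_red_basis[OF im] using False i jk
      by (auto simp: lookup_add lookup_scaleR lookup_sum_vec lookup_single lookup_one when_def)
  qed
  then show "Poly_Mapping.lookup (vec r) 0 = (if r < t + m then 1 else 0)"
    "Poly_Mapping.lookup (vec r) 1 = (if r < t + m then real (r - t) else 1)"
    "\<And>j. j \<in> {m..<t} \<Longrightarrow> Poly_Mapping.lookup (vec r) (j - m + 2) = (if r = t + j then 0 else 1)"
    by blast+
qed

lemma red_nonzero: "r \<in> R \<Longrightarrow> vec r \<noteq> 0"
  using lookup_red(1,2)[of r] by (auto split: if_splits)

text \<open>Coordinate 0 separates the two kinds of red vectors. Within the first kind coordinate 1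
  is the parameter; within the second the position of the vanishing coordinate identifies the
  index.\<close>

lemma red_notin_span_of_red:
  assumes r: "r \<in> R" "s \<in> R" "r \<noteq> s"
  shows "vec s \<notin> span {vec r}"
proof
  assume "vec s \<in> span {vec r}"
  then obtain c where c: "vec s = c *\<^sub>R vec r" unfolding span_singleton by blast
  have l: "Poly_Mapping.lookup (vec s) i = c * Poly_Mapping.lookup (vec r) i" for i
    unfolding c by (simp add: lookup_scaleR)
  have rs: "t \<le> r" "t \<le> s" using r by (auto simp: R_def)
  show False
  proof (cases "s < t + m")
    case True
    then have "c = 1" "r < t + m" using l[of 0] lookup_red(1)[OF r(1)] lookup_red(1)[OF r(2)] by (auto split: if_splits)
    then have "real (s - t) = real (r - t)"
      using l[of 1] lookup_red(2)[OF r(1)] lookup_red(2)[OF r(2)] True by simp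
    then show False using r(3) rs by simp
  next
    case False
    have "c \<noteq> 0" using c red_nonzero[OF r(2)] by auto
    then have "\<not> r < t + m" using l[of 0] lookup_red(1)[OF r(1)] lookup_red(1)[OF r(2)] False by (auto split: if_splits)
    then have "r - t \<in> {m..<t}" using r(1) by (auto simp: R_def)
    then show False
      using l[of "r - t - m + 2"] lookup_red(3)[OF r(1), of "r - t"] lookup_red(3)[OF r(2), of "r - t"] rs r(3)
      by auto
  qed
qed

lemma simple: simple
  unfolding simple_def
proof (intro ballI)
  fix x y assume xy: "x \<in> E" "y \<in> E"
  have nz: "vec z \<noteq> 0" if "z \<in> E" for z using that blue_nonzero red_nonzero E_eq by blast
  have pair: "indep {x, y}" if "vec y \<notin> span {vec x}" "x \<in> E" "y \<in> E" for x y
  proof -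
    have "vec x \<noteq> vec y" using that(1) by (auto simp: span_base)
    moreover have "independent {vec y, vec x}"
      using that(1) nz[OF that(2)] by (intro independent_insertI) (auto simp: real_vector.independent_empty)
    ultimately show ?thesis using that(2,3) by (auto simp: indep_def insert_commute)
  qed
  show "indep {x, y}"
  proof (cases "x = y")
    case True
    then show ?thesis using nz[OF xy(1)] xy by (simp add: indep_def)
  next
    case False
    consider "x \<in> B" "y \<in> B" | "x \<in> B" "y \<in> R" | "x \<in> R" "y \<in> B" | "x \<in> R" "y \<in> R"
      using xy E_eq by blast
    then show ?thesis
    proof cases
      case 1
      then obtain a b where ab: "a < m" "b < m" "a \<noteq> b" "{x, y} \<subseteq> T a b"
        using blue_pair_in_T[OF 1 False] by blast
      then show ?thesis
        using independent_T[OF ab(1-3)] xy unfolding indep_def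
        by (meson empty_subsetI image_mono inj_on_subset insert_subset real_vector.independent_mono)
    next
      case 2
      then show ?thesis using red_notin_span_of_blue pair xy by blast
    next
      case 3
      then show ?thesis using red_notin_span_of_blue[of y x] pair[where x = y and y = x] xy by (simp add: insert_commute)
    next
      case 4
      then show ?thesis using red_notin_span_of_red[OF 4 False] pair xy by blast
    qed
  qed
qed

text \<open>A red-free flat is spanned by its part in one basis \<open>T a b\<close>: two of its
  line points span all others on the line, and with at most one line point it fits into such a
  basis. Having rank \<open>k\<close> it omits exactly one basis element, and the red point of that
  blue hyperplane lies in its span.\<close>

lemma hyperplane_meets_red:
  assumes "hyperplane H"
  shows "H \<inter> R \<noteq> {}"
proof
  assume HR: "H \<inter> R = {}"
  have H: "flat H" "rank H = k" using assms rank_E by (auto simp: hyperplane_def)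
  have HE: "H \<subseteq> E" using H flat_iff by blast
  then have HB: "H \<subseteq> B" using HR E_eq by blast
  have fH: "finite H" using HE finite_ground finite_subset by blast
  have "\<exists>a b. a < m \<and> b < m \<and> a \<noteq> b \<and> vec ` H \<subseteq> span (vec ` (H \<inter> T a b))"
  proof (cases "\<exists>a b. a < m \<and> b < m \<and> a \<noteq> b \<and> a \<in> H \<and> b \<in> H")
    case True
    then obtain a b where ab: "a < m" "b < m" "a \<noteq> b" "a \<in> H" "b \<in> H" by blast
    have "vec e \<in> span (vec ` (H \<inter> T a b))" if "e \<in> H" for e
    proof (cases "e < m")
      case True
      have "vec e \<in> span (vec ` {a, b})"
        unfolding vec_line[OF True] using line_coordinates[OF ab(1-3), of 1 "real e"]
        by (simp add: span_add span_scale span_base)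
      moreover have "span (vec ` {a, b}) \<subseteq> span (vec ` (H \<inter> T a b))"
        using ab by (intro span_mono) (auto simp: T_def)
      ultimately show ?thesis by blast
    next
      case False
      then have "e \<in> H \<inter> T a b" using that HB by (auto simp: T_def B_def)
      then show ?thesis by (intro span_base) auto
    qed
    then show ?thesis using ab by blast
  next
    case False
    obtain a b where ab: "a < m" "b < m" "a \<noteq> b" "H \<subseteq> T a b"
    proof (cases "\<exists>a<m. a \<in> H")
      case True
      then obtain a where a: "a < m" "a \<in> H" by blast
      define b where "b = (if a = 0 then 1 else 0 :: nat)"
      have "e \<in> T a b" if "e \<in> H" for e
      proof (cases "e < m")
        case True
        then have "e = a" using \<open>\<nexists>a b. a < m \<and> b < m \<and> a \<noteq> b \<and> a \<in> H \<and> b \<in> H\<close> a that by blast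
        then show ?thesis by (simp add: T_def)
      qed (use that HB in \<open>auto simp: T_def B_def\<close>)
      then have "H \<subseteq> T a b" by blast
      then show ?thesis using that[of a b] a m by (auto simp: b_def)
    next
      case False
      then have "H \<subseteq> T 0 1" using HB by (auto simp: T_def B_def)
      then show ?thesis using that T01 by blast
    qed
    then have "vec ` H \<subseteq> span (vec ` (H \<inter> T a b))" by (auto intro: span_base)
    then show ?thesis using ab by blast
  qed
  then obtain a b where ab: "a < m" "b < m" "a \<noteq> b" and sp: "vec ` H \<subseteq> span (vec ` (H \<inter> T a b))" by blast
  have "k = dim (vec ` H)" using H(2) rank_eq_dim[OF HE] by simp
  also have "\<dots> \<le> dim (vec ` (H \<inter> T a b))" using sp fH by (intro dim_mono_finite) auto
  also have "\<dots> = card (H \<inter> T a b)" using dim_T[OF ab] by simp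
  finally have c: "k \<le> card (H \<inter> T a b)" .
  have "\<not> T a b \<subseteq> H" using rank_of_superset[OF ab _ HE] H(2) by auto
  then obtain u where u: "u \<in> T a b" "u \<notin> H" by blast
  have "card (T a b - {u}) = k" using card_T[OF ab] u by simp
  then have "H \<inter> T a b = T a b - {u}"
    using u c finite_T by (intro card_seteq) auto
  obtain r where r: "r \<in> R" "vec r \<in> span (vec ` (T a b - {u}))" using red_in_span[OF ab u(1)] by blast
  then have "vec r \<in> span (vec ` H)"
    using \<open>H \<inter> T a b = T a b - {u}\<close> span_mono[of "vec ` (T a b - {u})" "vec ` H"] by auto
  then have "r \<in> H" using H(1) r(1) E_eq unfolding flat_iff by blast
  then show False using r(1) HR by blast
qed

text \<open>Two blue elements spanning the line are part of a common basis. The other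
  \<open>k - 1\<close> basis elements span a complement, and a red point in their span would have
  two zero coordinates.\<close>

lemma red_free_flat_skew_to_line:
  assumes "matroid.line B (restrict_indep B) L"
  shows "\<exists>F. flat F \<and> rank F = k - 1 \<and> skew F L \<and> F \<inter> R = {}"
proof -
  have BE: "B \<subseteq> E" using E_eq by blast
  interpret MB: vector_matroid B "restrict_indep B" vec using vector_matroid_restrict[OF BE] .
  have L: "L \<subseteq> B" "MB.rank L = 2"
    using assms MB.flat_iff unfolding MB.line_def by blast+
  have LE: "L \<subseteq> E" using L BE by blast
  have dL: "dim (vec ` L) = 2" using L MB.rank_eq_dim by simp
  have fL: "finite L" using LE finite_ground finite_subset by blast
  have "dim (vec ` L) \<le> card (vec ` L)" using fL by (intro real_vector.dim_le_card) (auto intro: span_base)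
  then have "2 \<le> card L" using dL card_image_le[OF fL, of vec] by simp
  then obtain x y where xy: "x \<in> L" "y \<in> L" "x \<noteq> y" by (rule two_le_cardE)
  then obtain a b where ab: "a < m" "b < m" "a \<noteq> b" and T: "x \<in> T a b" "y \<in> T a b"
    using blue_pair_in_T L(1) by (metis subsetD)
  define X where "X = T a b - {x, y}"
  have XT: "X \<subseteq> T a b" by (auto simp: X_def)
  have XE: "X \<subseteq> E" using XT T_subset[OF ab(1,2)] BE by blast
  have cX: "card X = k - 1"
    using card_T[OF ab] T xy finite_T by (simp add: X_def card_Diff_subset)
  have rF: "rank (closure X) = k - 1" using rank_closure[OF XE] dim_T[OF ab XT] cX by simp
  have "X \<subseteq> closure X" using XE by (auto simp: closure_def intro: span_base)
  then have "T a b \<subseteq> closure X \<union> L" using xy by (auto simp: X_def)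
  then have "rank (closure X \<union> L) = k + 1"
    using rank_of_superset[OF ab] LE by (simp add: closure_def)
  moreover have "rank L = 2" using rank_eq_dim[OF LE] dL by simp
  ultimately have "skew (closure X) L" unfolding skew_def using rF k2 by simp
  moreover have "closure X \<inter> R = {}"
    using red_not_in_span[OF ab _ T xy(3)] by (auto simp: closure_def X_def)
  ultimately show ?thesis using flat_closure[OF XE] rF by blast
qed

lemma admissible: "admissible_colouring k R B"
  unfolding admissible_colouring_def two_colouring_def
proof (intro conjI allI impI)
  show "2 \<le> rank B" using rank_of_superset[OF T01, of B] T_subset[OF T01(1,2)] E_eq k2 by auto
qed (use E_eq hyperplane_meets_red red_free_flat_skew_to_line in auto)

lemma in_blue_counts: "t \<in> blue_counts k t"
proof -
  have "card R = t" "card B = t" by (auto simp: R_def B_def)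
  then show ?thesis
    unfolding blue_counts_def
    using matroid_axioms simple real_representable rank_E admissible by blast
qed

end

theorem theorem1p3:
  fixes k :: nat
  assumes "k \<ge> 1"
  shows "(\<forall>t\<ge>1. finite (blue_counts k t)) \<and>
         (k = 1 \<longrightarrow> (\<forall>t\<ge>1. max_blue k t = 0)) \<and>
         (k \<ge> 2 \<longrightarrow> (\<lambda>t. real (max_blue k t)) \<in> \<Theta>(\<lambda>t. real t))"
proof -
  obtain c where c: "c > 0" and bound: "\<And>t n. t \<ge> 1 \<Longrightarrow> n \<in> blue_counts k t \<Longrightarrow> c * real n \<le> real t"
    using blue_counts_linear_bound[of k] by blast
  have fin: "finite (blue_counts k t)" if "t \<ge> 1" for t
  proof (rule finite_subset)
    show "blue_counts k t \<subseteq> {..nat \<lfloor>real t / c\<rfloor>}"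
    proof
      fix n assume "n \<in> blue_counts k t"
      then have "real n \<le> real t / c" using bound[OF that] c by (simp add: field_simps)
      then show "n \<in> {..nat \<lfloor>real t / c\<rfloor>}" by (simp add: le_nat_floor)
    qed
  qed simp
  have "(\<lambda>t. real (max_blue k t)) \<in> \<Theta>(\<lambda>t. real t)" if k: "k \<ge> 2"
  proof (rule bigthetaI)
    have upper: "real (max_blue k t) \<le> (1 / c) * real t" if t: "t \<ge> 1" for t
    proof (cases "blue_counts k t = {}")
      case False
      \<comment> \<open>Finiteness makes the maximum an attained value, so the bound for members
        applies to it.\<close>
      then have "max_blue k t \<in> blue_counts k t" using Max_in[OF fin[OF t]] by (simp add: max_blue_def)
      then show ?thesis using bound[OF t] c by (simp add: field_simps)
    qed (use c in \<open>simp add: max_blue_def\<close>)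
    show "(\<lambda>t. real (max_blue k t)) \<in> O(\<lambda>t. real t)"
      using upper by (intro bigoI[of _ "1 / c"] eventually_sequentiallyI[of 1]) simp
    \<comment> \<open>The range of \<open>t\<close> in which the configuration exists; finitely many
      smaller values do not affect \<Omega>.\<close>
    have lower: "real t \<le> real (max_blue k t)" if t: "t \<ge> k + 1" for t
    proof -
      interpret extremal_configuration k t using k t by unfold_locales
      show ?thesis using in_blue_counts fin[of t] t by (auto simp: max_blue_def)
    qed
    show "(\<lambda>t. real (max_blue k t)) \<in> \<Omega>(\<lambda>t. real t)"
      unfolding bigomega_iff_bigo
      using lower by (intro bigoI[of _ 1] eventually_sequentiallyI[of "k + 1"]) simp
  qed
  moreover have "k = 1 \<longrightarrow> (\<forall>t\<ge>1. max_blue k t = 0)"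
    using blue_counts_one by (simp add: max_blue_def)
  ultimately show ?thesis using fin by blast
qed

end
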